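(* Let $\tau_1:I\to I$ and $\tau_2:I\to I$ be continuous, transitive, piecewise monotonic maps. Then there is an increasing conjugacy from $\tau_1$ to $\tau_2$ if and only if (i) the maps $\tau_1$ and $\tau_2$ are both increasing, or both decreasing, on their first interval of monotonicity, and (ii) there is a unital isomorphism $\Phi$ from the dimension triple for $\tau_1$ onto the dimension triple for $\tau_2$, taking the canonical sequence of generators for $DG(\tau_1)$ onto that for $DG(\tau_2)$.
   Context: Let $I=[0,1]$. A continuous map $\tau:I\to I$ is piecewise monotonic if there are points $0=a_0<a_1<\dots<a_n=1$ such that $\tau$ is strictly monotonic on each $(a_{i-1},a_i)$; the points are chosen so that no $(a_{i-1},a_i)$ is contained in a larger open interval on which $\tau$ is strictly monotonic. Then $\{a_0,\dots,a_n\}$ is the partition associated with $\tau$, the $(a_{i-1},a_i)$ are the intervals of monotonicity, and $(a_0,a_1)$ is the first interval of monotonicity. $\tau$ is transitive if for all non-empty open $U,V\subset I$ there is $n\ge0$ with $\tau^n(U)\cap V\neq\emptyset$. An increasing conjugacy from $\tau_1$ to $\tau_2$ is an increasing homeomorphism $h:I\to I$ with $h\circ\tau_1=\tau_2\circ h$. The generalized orbit of $x\in I$ is the smallest subset of $I$ containing $x$ that is forward and backward invariant under $\tau$. $I_1$ is the union of the generalized orbits of $a_0,\dots,a_n$, and $I_0=I\setminus I_1$. $X$ is the totally ordered set obtained from $I$ by replacing each $x\in I_1\setminus\{0,1\}$ by two points $x^-<x^+$, with the order topology (homeomorphic to a compact subset of $\mathbb R$); $\pi:X\to I$ is the collapse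 map ($\pi(x^\pm)=x$), and $X_0=\pi^{-1}(I_0)$. The local homeomorphism associated with $\tau$ is the unique continuous map $\sigma:X\to X$ with $\pi\circ\sigma=\tau\circ\pi$ on $X_0$. For $b_1<b_2$ in $I_1$, $I(b_1,b_2)$ denotes the clopen order interval $[b_1^+,b_2^-]_X$ of $X$ (with $0^+=0$, $1^-=1$). Let $(\mathcal L f)(x)=\sum_{\sigma y=x}f(y)$ for $f\in C(X,\mathbb Z)$. $DG(\tau)$ is $C(X,\mathbb Z)$ modulo $f\sim g$ iff $\mathcal L^nf=\mathcal L^ng$ for some $n\ge0$, ordered by $[f]\ge0$ iff $\mathcal L^nf\ge0$ for some $n$, with distinguished order unit $[1]$, and $\mathcal L_*[f]=[\mathcal Lf]$. The dimension triple of $\tau$ is $(DG(\tau),DG(\tau)^+,\mathcal L_* )$; an isomorphism of dimension triples is a group isomorphism carrying positive cone onto positive cone and intertwining the maps $\mathcal L_*$; it is unital if it carries $[1]$ to $[1]$. An interval $I(b_1,b_2)$ is identified with the class in $DG(\tau)$ of its characteristic function. The canonical sequence of generators for $DG(\tau)$ is the $n$-tuple $(I(a_0,a_1),I(a_1,a_2),\ldots,I(a_{n-1},a_n))$; in (ii) it is understood that $\Phi$ carries the sequence for $\tau_1$ term by term onto the sequence for $\tau_2$ (in particular the sequences have equal length). *)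

theory Defs
  imports "HOL-Analysis.Analysis" "HOL-Algebra.Group"
begin

text \<open>
  Interval maps are functions \<open>\<tau> :: real \<Rightarrow> real\<close> of which only the values on \<open>{0..1}\<close> are
  relevant; hypotheses and definitions are relativised to that interval.
\<close>

definition interval_map :: "(real \<Rightarrow> real) \<Rightarrow> bool" where
  "interval_map \<tau> \<longleftrightarrow> continuous_on {0..1} \<tau> \<and> \<tau> ` {0..1} \<subseteq> {0..1}"

definition strictly_monotonic_on :: "real set \<Rightarrow> (real \<Rightarrow> real) \<Rightarrow> bool" where
  "strictly_monotonic_on S \<tau> \<longleftrightarrow> strict_mono_on S \<tau> \<or> strict_antimono_on S \<tau>"

definition monotonicity_points :: "(real \<Rightarrow> real) \<Rightarrow> real list \<Rightarrow> bool" where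
  "monotonicity_points \<tau> as \<longleftrightarrow>
     2 \<le> length as \<and> hd as = 0 \<and> last as = 1 \<and> sorted_wrt (<) as \<and>
     (\<forall>i. Suc i < length as \<longrightarrow> strictly_monotonic_on {as ! i <..< as ! Suc i} \<tau>)"

definition piecewise_monotonic :: "(real \<Rightarrow> real) \<Rightarrow> bool" where
  "piecewise_monotonic \<tau> \<longleftrightarrow> (\<exists>as. monotonicity_points \<tau> as)"

definition maximal_monotonicity_points :: "(real \<Rightarrow> real) \<Rightarrow> real list \<Rightarrow> bool" where
  "maximal_monotonicity_points \<tau> as \<longleftrightarrow>
     monotonicity_points \<tau> as \<and>
     (\<forall>i. Suc i < length as \<longrightarrow>
       (\<forall>u v. {u<..<v} \<subseteq> {0..1} \<and> {as ! i <..< as ! Suc i} \<subset> {u<..<v} \<longrightarrow>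
          \<not> strictly_monotonic_on {u<..<v} \<tau>))"

text \<open>
  The associated partition, as the strictly increasing list \<open>[a\<^sub>0, \<dots>, a\<^sub>n]\<close>. For a continuous
  piecewise monotonic map there is exactly one maximal choice of the points.
\<close>

definition assoc_partition :: "(real \<Rightarrow> real) \<Rightarrow> real list" where
  "assoc_partition \<tau> = (THE as. maximal_monotonicity_points \<tau> as)"

definition first_interval :: "(real \<Rightarrow> real) \<Rightarrow> real set" where
  "first_interval \<tau> = {assoc_partition \<tau> ! 0 <..< assoc_partition \<tau> ! 1}"

definition transitive_map :: "(real \<Rightarrow> real) \<Rightarrow> bool" where
  "transitive_map \<tau> \<longleftrightarrow>
     (\<forall>U V. openin (top_of_set {0..1}) U \<and> openin (top_of_set {0..1}) V \<and> U \<noteq> {} \<and> V \<noteq> {} \<longrightarrow>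
        (\<exists>n. (\<tau> ^^ n) ` U \<inter> V \<noteq> {}))"

definition increasing_conjugacy ::
    "(real \<Rightarrow> real) \<Rightarrow> (real \<Rightarrow> real) \<Rightarrow> (real \<Rightarrow> real) \<Rightarrow> bool" where
  "increasing_conjugacy \<tau>1 \<tau>2 h \<longleftrightarrow>
     (\<exists>k. homeomorphism {0..1} {0..1} h k) \<and> strict_mono_on {0..1} h \<and>
     (\<forall>x\<in>{0..1}. h (\<tau>1 x) = \<tau>2 (h x))"

definition generalized_orbit :: "(real \<Rightarrow> real) \<Rightarrow> real \<Rightarrow> real set" where
  "generalized_orbit \<tau> x =
     \<Inter>{A. A \<subseteq> {0..1} \<and> x \<in> A \<and> \<tau> ` A \<subseteq> A \<and> {y \<in> {0..1}. \<tau> y \<in> A} \<subseteq> A}"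

definition I1 :: "(real \<Rightarrow> real) \<Rightarrow> real set" where
  "I1 \<tau> = (\<Union>a\<in>set (assoc_partition \<tau>). generalized_orbit \<tau> a)"

definition I0 :: "(real \<Rightarrow> real) \<Rightarrow> real set" where
  "I0 \<tau> = {0..1} - I1 \<tau>"

text \<open>
  The disconnected space \<open>X\<close> is encoded in \<open>real \<times> int\<close> with the lexicographic order: a point
  \<open>x\<close> that is not split is \<open>(x, 0)\<close>, and a split point yields \<open>x\<^sup>- = (x, -1)\<close> and
  \<open>x\<^sup>+ = (x, 1)\<close>. The collapse map \<open>X \<rightarrow> I\<close> is \<open>fst\<close>.
\<close>

type_synonym point = "real \<times> int"

definition point_less :: "point \<Rightarrow> point \<Rightarrow> bool" where
  "point_less p q \<longleftrightarrow> fst p < fst q \<or> (fst p = fst q \<and> snd p < snd q)"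

definition split_points :: "(real \<Rightarrow> real) \<Rightarrow> real set" where
  "split_points \<tau> = I1 \<tau> - {0, 1}"

definition X_space :: "(real \<Rightarrow> real) \<Rightarrow> point set" where
  "X_space \<tau> = ({0..1} - split_points \<tau>) \<times> {0} \<union> split_points \<tau> \<times> {-1, 1}"

definition X0 :: "(real \<Rightarrow> real) \<Rightarrow> point set" where
  "X0 \<tau> = {p \<in> X_space \<tau>. fst p \<in> I0 \<tau>}"

definition X_topology :: "(real \<Rightarrow> real) \<Rightarrow> point topology" where
  "X_topology \<tau> = topology_generated_by
     (insert (X_space \<tau>)
       ((\<lambda>p. {q \<in> X_space \<tau>. point_less q p}) ` X_space \<tau> \<union>
        (\<lambda>p. {q \<in> X_space \<tau>. point_less p q}) ` X_space \<tau>))"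

definition minus_point :: "(real \<Rightarrow> real) \<Rightarrow> real \<Rightarrow> point" where
  "minus_point \<tau> x = (if x \<in> split_points \<tau> then (x, -1) else (x, 0))"

definition plus_point :: "(real \<Rightarrow> real) \<Rightarrow> real \<Rightarrow> point" where
  "plus_point \<tau> x = (if x \<in> split_points \<tau> then (x, 1) else (x, 0))"

definition X_interval :: "(real \<Rightarrow> real) \<Rightarrow> real \<Rightarrow> real \<Rightarrow> point set" where
  "X_interval \<tau> b1 b2 =
     {p \<in> X_space \<tau>. \<not> point_less p (plus_point \<tau> b1) \<and> \<not> point_less (minus_point \<tau> b2) p}"

text \<open>Extensionality only pins down the irrelevant values of \<open>\<sigma>\<close> outside \<open>X\<close>.\<close>

definition local_homeo :: "(real \<Rightarrow> real) \<Rightarrow> point \<Rightarrow> point" where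
  "local_homeo \<tau> = (THE \<sigma>. \<sigma> \<in> extensional (X_space \<tau>) \<and>
     continuous_map (X_topology \<tau>) (X_topology \<tau>) \<sigma> \<and>
     (\<forall>p\<in>X0 \<tau>. fst (\<sigma> p) = \<tau> (fst p)))"

text \<open>\<open>C(X, \<int>)\<close>: integer-valued functions on \<open>X\<close> are extended by \<open>0\<close> outside \<open>X\<close>.\<close>

definition CXZ :: "(real \<Rightarrow> real) \<Rightarrow> (point \<Rightarrow> int) set" where
  "CXZ \<tau> = {f. continuous_map (X_topology \<tau>) (discrete_topology UNIV) f \<and>
              (\<forall>p. p \<notin> X_space \<tau> \<longrightarrow> f p = 0)}"

definition transfer_op :: "(real \<Rightarrow> real) \<Rightarrow> (point \<Rightarrow> int) \<Rightarrow> point \<Rightarrow> int" where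
  "transfer_op \<tau> f = (\<lambda>x. \<Sum>y | y \<in> X_space \<tau> \<and> local_homeo \<tau> y = x. f y)"

definition DG_rel :: "(real \<Rightarrow> real) \<Rightarrow> ((point \<Rightarrow> int) \<times> (point \<Rightarrow> int)) set" where
  "DG_rel \<tau> = {(f, g). f \<in> CXZ \<tau> \<and> g \<in> CXZ \<tau> \<and>
                 (\<exists>n. (transfer_op \<tau> ^^ n) f = (transfer_op \<tau> ^^ n) g)}"

definition DG_class :: "(real \<Rightarrow> real) \<Rightarrow> (point \<Rightarrow> int) \<Rightarrow> (point \<Rightarrow> int) set" where
  "DG_class \<tau> f = DG_rel \<tau> `` {f}"

text \<open>The abelian group \<open>DG(\<tau>)\<close>; its addition is the multiplication of the record.\<close>

definition DG :: "(real \<Rightarrow> real) \<Rightarrow> (point \<Rightarrow> int) set monoid" where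
  "DG \<tau> = \<lparr> carrier = CXZ \<tau> // DG_rel \<tau>,
            mult = (\<lambda>A B. \<Union>f\<in>A. \<Union>g\<in>B. DG_class \<tau> (\<lambda>p. f p + g p)),
            one = DG_class \<tau> (\<lambda>p. 0) \<rparr>"

definition DG_pos :: "(real \<Rightarrow> real) \<Rightarrow> (point \<Rightarrow> int) set set" where
  "DG_pos \<tau> = {DG_class \<tau> f | f. f \<in> CXZ \<tau> \<and> (\<exists>n. \<forall>p\<in>X_space \<tau>. 0 \<le> (transfer_op \<tau> ^^ n) f p)}"

definition DG_unit :: "(real \<Rightarrow> real) \<Rightarrow> (point \<Rightarrow> int) set" where
  "DG_unit \<tau> = DG_class \<tau> (indicator (X_space \<tau>))"

definition DG_shift :: "(real \<Rightarrow> real) \<Rightarrow> (point \<Rightarrow> int) set \<Rightarrow> (point \<Rightarrow> int) set" where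
  "DG_shift \<tau> A = (\<Union>f\<in>A. DG_class \<tau> (transfer_op \<tau> f))"

definition canonical_generators :: "(real \<Rightarrow> real) \<Rightarrow> (point \<Rightarrow> int) set list" where
  "canonical_generators \<tau> =
     map (\<lambda>i. DG_class \<tau> (indicator
            (X_interval \<tau> (assoc_partition \<tau> ! i) (assoc_partition \<tau> ! Suc i))))
         [0..<length (assoc_partition \<tau>) - 1]"

definition dimension_triple_iso ::
    "(real \<Rightarrow> real) \<Rightarrow> (real \<Rightarrow> real) \<Rightarrow> ((point \<Rightarrow> int) set \<Rightarrow> (point \<Rightarrow> int) set) \<Rightarrow> bool" where
  "dimension_triple_iso \<tau>1 \<tau>2 \<Phi> \<longleftrightarrow>
     \<Phi> \<in> iso (DG \<tau>1) (DG \<tau>2) \<and> \<Phi> ` DG_pos \<tau>1 = DG_pos \<tau>2 \<and>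
     (\<forall>A\<in>carrier (DG \<tau>1). \<Phi> (DG_shift \<tau>1 A) = DG_shift \<tau>2 (\<Phi> A))"

definition unital :: "(real \<Rightarrow> real) \<Rightarrow> (real \<Rightarrow> real) \<Rightarrow> ((point \<Rightarrow> int) set \<Rightarrow> (point \<Rightarrow> int) set) \<Rightarrow> bool" where
  "unital \<tau>1 \<tau>2 \<Phi> \<longleftrightarrow> \<Phi> (DG_unit \<tau>1) = DG_unit \<tau>2"

end

theory Submission
  imports Defs
begin

text \<open>
  Suppose \<open>\<Phi>\<close> is given. The transfer operator of \<open>\<tau>2\<close> has a positive eigenfunctional \<open>\<omega>2\<close> with
  eigenvalue \<open>l > 1\<close>: a transitive map has a horseshoe, so the number of preimages grows
  exponentially, and \<open>\<omega>2\<close> is a limit of normalised resolvents \<open>f \<mapsto> (\<Sum>n. t\<^sup>n L\<^sup>n f) (q)\<close> as \<open>t\<close> tends to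
  the critical value \<open>1/l\<close>. Then \<open>\<omega>1 = \<omega>2 \<circ> \<Phi>\<close> is an eigenfunctional for \<open>\<tau>1\<close> with the same
  eigenvalue, and no uniqueness of eigenfunctionals is needed. The distribution function of \<open>\<omega>i\<close> is
  continuous, since an atom would be multiplied by \<open>l\<close> along its orbit, and strictly increasing,
  since by transitivity a null interval would make its range countable. It conjugates \<open>\<tau>i\<close> to a
  piecewise linear map with slopes \<open>\<plusminus>l\<close>. The canonical generators fix the breakpoints and condition
  (i) the signs of the slopes, so the two piecewise linear maps differ by a constant; being onto,
  they coincide. Conversely, a conjugacy transports every construction literally.
\<close>

section \<open>Intervals of monotonicity\<close>

text \<open>What \<open>\<Phi>\<close> transports has to be an exact eigenfunctional with eigenvalue
  above 1. The set \<open>T\<close> of parameters for which the resolvent of the constant 1 is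
  bounded uniformly in the base point has no largest positive element. Its supremum
  \<open>t0\<close> therefore lies outside \<open>T\<close>, the normalising constants blow up, and
  the defect term \<open>f q\<close> of the resolvent identity disappears in the limit.
  Unboundedness may show only along varying base points, so these move with the parameter. This part
  uses all bounded functions and no topology. The topology of the split space matters for the
  uniqueness of \<open>local_homeo\<close> and for the fact that \<open>transfer_op\<close>
  preserves \<open>CXZ\<close>, which rests on the density of \<open>I1\<close>. Transitivity is
  weaker than mixing: an interval need not cover the space at any single time. The horseshoe is
  therefore built next to a periodic point that no orbit of a partition point hits, so that every
  path into it carries neighbourhoods onto neighbourhoods.\<close>

definition mono_sgn :: "int \<Rightarrow> real set \<Rightarrow> (real \<Rightarrow> real) \<Rightarrow> bool" where
  "mono_sgn e S f \<longleftrightarrow> (\<forall>x\<in>S. \<forall>y\<in>S. x < y \<longrightarrow> of_int e * f x < of_int e * f y)"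

lemma strictly_monotonic_on_iff_mono_sgn:
  "strictly_monotonic_on S f \<longleftrightarrow> (\<exists>e\<in>{1, -1}. mono_sgn e S f)"
  by (auto simp: strictly_monotonic_on_def mono_sgn_def monotone_on_def)

lemma mono_sgn_subset: "mono_sgn e S f \<Longrightarrow> T \<subseteq> S \<Longrightarrow> mono_sgn e T f"
  by (auto simp: mono_sgn_def)

lemma mono_sgn_inj_on: "mono_sgn e S f \<Longrightarrow> inj_on f S"
  unfolding mono_sgn_def by (intro inj_onI) (metis less_irrefl linorder_neqE)

lemma mono_sgn_unique:
  assumes "mono_sgn e S f" "mono_sgn e' S f" "e \<in> {1, -1}" "e' \<in> {1, -1}" "x \<in> S" "y \<in> S" "x < y"
  shows "e = e'"
proof -
  have "of_int e * f x < of_int e * f y" "of_int e' * f x < of_int e' * f y"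
    using assms unfolding mono_sgn_def by blast+
  then show ?thesis using assms(3,4) by auto
qed

lemma mono_sgn_closure:
  fixes f :: "real \<Rightarrow> real"
  assumes c: "continuous_on {a..b} f" and m: "mono_sgn e {a<..<b} f"
  shows "mono_sgn e {a..b} f"
proof -
  let ?g = "\<lambda>x. of_int e * f x"
  have cg: "continuous_on {a..b} ?g" by (intro continuous_intros c)
  have weak_left: "?g a \<le> ?g y" if y: "a < y" "y < b" for y
  proof -
    have "continuous_on {a..y} ?g" using cg y by (auto intro: continuous_on_subset)
    moreover have "closure {a<..<y} = {a..y}" using y by (simp add: closure_greaterThanLessThan)
    moreover have "?g x \<le> ?g y" if "x \<in> {a<..<y}" for x
      using m y that unfolding mono_sgn_def by (force intro: less_imp_le)
    ultimately show ?thesis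
      using continuous_le_on_closure[of "{a<..<y}" ?g a "?g y"] y by simp
  qed
  have weak_right: "?g y \<le> ?g b" if y: "a < y" "y < b" for y
  proof -
    have "continuous_on {y..b} ?g" using cg y by (auto intro: continuous_on_subset)
    moreover have "closure {y<..<b} = {y..b}" using y by (simp add: closure_greaterThanLessThan)
    moreover have "?g y \<le> ?g x" if "x \<in> {y<..<b}" for x
      using m y that unfolding mono_sgn_def by (force intro: less_imp_le)
    ultimately show ?thesis
      using continuous_ge_on_closure[of "{y<..<b}" ?g b "?g y"] y by simp
  qed
  have inner: "?g x < ?g y" if "a < x" "x < y" "y < b" for x y
    using m that unfolding mono_sgn_def by force
  show ?thesis unfolding mono_sgn_def
  proof (intro ballI impI)
    fix x y assume x: "x \<in> {a..b}" and y: "y \<in> {a..b}" and "x < y"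
    \<comment> \<open>Continuity yields only weak inequalities at the endpoints; the two inner
      points \<open>u < v\<close> supply the strict one.\<close>
    then obtain u where u: "x < u" "u < y" using dense by blast
    obtain v where v: "u < v" "v < y" using u dense by blast
    have "?g x \<le> ?g u"
      by (cases "x = a") (use weak_left[of u] inner[of x u] u x y in \<open>auto intro: less_imp_le\<close>)
    also have "?g u < ?g v" using inner[of u v] u v x y by auto
    also have "?g v \<le> ?g y"
      by (cases "y = b") (use weak_right[of v] inner[of v y] u v x y in \<open>auto intro: less_imp_le\<close>)
    finally show "?g x < ?g y" .
  qed
qed

lemma mono_sgn_union:
  fixes f :: "real \<Rightarrow> real"
  assumes "mono_sgn e {a..b} f" "mono_sgn e {b..c} f"
  shows "mono_sgn e {a..c} f"
  unfolding mono_sgn_def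
proof (intro ballI impI)
  fix x y assume *: "x \<in> {a..c}" "y \<in> {a..c}" "x < y"
  consider "y \<le> b" | "b \<le> x" | "x < b" "b < y" by linarith
  then show "of_int e * f x < of_int e * f y"
  proof cases
    case 3
    then have "of_int e * f x < of_int e * f b" "of_int e * f b < of_int e * f y"
      using assms * unfolding mono_sgn_def by auto
    then show ?thesis by linarith
  qed (use assms * in \<open>auto simp: mono_sgn_def\<close>)
qed

section \<open>Locating points in strictly increasing lists\<close>

lemma sorted_wrt_less_mono:
  fixes as :: "real list"
  assumes "sorted_wrt (<) as" "i \<le> j" "j < length as"
  shows "as ! i \<le> as ! j"
  using assms by (metis le_less less_irrefl sorted_wrt_iff_nth_less less_imp_le)

lemma sorted_wrt_less_locate_right:
  fixes as :: "real list"
  assumes "sorted_wrt (<) as" "as \<noteq> []" "hd as \<le> x" "x < last as"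
  obtains i where "Suc i < length as" "as ! i \<le> x" "x < as ! Suc i"
proof -
  define i where "i = (GREATEST i. i < length as \<and> as ! i \<le> x)"
  have ex: "0 < length as \<and> as ! 0 \<le> x" using assms by (auto simp: hd_conv_nth)
  have i: "i < length as \<and> as ! i \<le> x"
    unfolding i_def by (rule GreatestI_nat[where P="\<lambda>i. i < length as \<and> as ! i \<le> x", OF ex, of "length as"]) simp
  have gr: "j \<le> i" if "j < length as" "as ! j \<le> x" for j
    unfolding i_def using that
    by (intro Greatest_le_nat[where P="\<lambda>i. i < length as \<and> as ! i \<le> x" and b="length as"]) auto
  have "i \<noteq> length as - 1" using i assms by (auto simp: last_conv_nth)
  then have S: "Suc i < length as" using i by linarith
  moreover have "x < as ! Suc i" using gr[of "Suc i"] S by force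
  ultimately show ?thesis using that i by blast
qed

lemma sorted_wrt_less_locate_left:
  fixes as :: "real list"
  assumes "sorted_wrt (<) as" "as \<noteq> []" "hd as < x" "x \<le> last as"
  obtains i where "Suc i < length as" "as ! i < x" "x \<le> as ! Suc i"
proof (cases "x = last as")
  case True
  have l: "length as \<ge> 2" using assms True by (cases as; cases "tl as") auto
  let ?i = "length as - 2"
  have s: "Suc ?i = length as - 1" using l by simp
  have "as ! ?i < as ! Suc ?i" using assms(1) l s by (simp add: sorted_wrt_nth_less)
  then show ?thesis using that[of ?i] l True s assms by (auto simp: last_conv_nth)
next
  case False
  then obtain i where i: "Suc i < length as" "as ! i \<le> x" "x < as ! Suc i"
    using sorted_wrt_less_locate_right[of as x] assms by force
  show ?thesis
  proof (cases "as ! i = x")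
    case True
    then have "i \<noteq> 0" using assms by (auto simp: hd_conv_nth intro: ccontr)
    then have "as ! (i - 1) < x" "Suc (i - 1) = i"
      using assms(1) i True by (auto simp: sorted_wrt_nth_less)
    then show ?thesis using that[of "i - 1"] i True by auto
  next
    case False then show ?thesis using that[of i] i by auto
  qed
qed

lemma sorted_wrt_less_unique:
  fixes xs ys :: "real list"
  assumes "sorted_wrt (<) xs" "sorted_wrt (<) ys" "set xs = set ys"
  shows "xs = ys"
  by (rule strict_sorted_equal) (use assms in auto)

lemma sorted_wrt_less_gap:
  fixes as :: "real list"
  assumes "sorted_wrt (<) as" "Suc i < length as" "as ! i < x" "x < as ! Suc i"
  shows "x \<notin> set as"
proof
  assume "x \<in> set as"
  then obtain j where j: "j < length as" "x = as ! j" by (auto simp: in_set_conv_nth)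
  show False
  proof (cases "j \<le> i")
    case True then show False using sorted_wrt_less_mono[OF assms(1), of j i] assms j by auto
  next
    case False then show False using sorted_wrt_less_mono[OF assms(1), of "Suc i" j] assms j by auto
  qed
qed

section \<open>Turning points and the associated partition\<close>

definition turning_points :: "(real \<Rightarrow> real) \<Rightarrow> real set" where
  "turning_points \<tau> = {x\<in>{0<..<1}. \<forall>d>0. 0 \<le> x - d \<longrightarrow> x + d \<le> 1 \<longrightarrow>
     \<not> (\<exists>e\<in>{1,-1}. mono_sgn e {x-d<..<x+d} \<tau>)}"

locale pm_map =
  fixes \<tau> :: "real \<Rightarrow> real"
  assumes im: "interval_map \<tau>" and pm: "piecewise_monotonic \<tau>"
begin

lemma cont: "continuous_on {0..1} \<tau>"
  using im by (simp add: interval_map_def)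

lemma maps: "x \<in> {0..1} \<Longrightarrow> \<tau> x \<in> {0..1}"
  using im unfolding interval_map_def by blast

lemma mono_sgn_closedI:
  "mono_sgn e {a<..<b} \<tau> \<Longrightarrow> 0 \<le> a \<Longrightarrow> b \<le> 1 \<Longrightarrow> mono_sgn e {a..b} \<tau>"
  by (rule mono_sgn_closure[OF continuous_on_subset[OF cont]]) auto

lemma not_turning_pointE:
  assumes "x \<notin> turning_points \<tau>" "0 < x" "x < 1"
  obtains d e where "d > 0" "0 \<le> x - d" "x + d \<le> 1" "e \<in> {1,-1}" "mono_sgn e {x-d<..<x+d} \<tau>"
proof -
  have "\<not> (\<forall>d>0. 0 \<le> x - d \<longrightarrow> x + d \<le> 1 \<longrightarrow> \<not> (\<exists>e\<in>{1,-1}. mono_sgn e {x-d<..<x+d} \<tau>))"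
    using assms unfolding turning_points_def by simp
  then show ?thesis using that by blast
qed

lemma monotonicity_pointsD:
  assumes "monotonicity_points \<tau> as"
  shows "as \<noteq> []" "hd as = 0" "last as = 1" "sorted_wrt (<) as"
    "Suc i < length as \<Longrightarrow> \<exists>e\<in>{1,-1}. mono_sgn e {as ! i<..<as ! Suc i} \<tau>"
    "i < length as \<Longrightarrow> 0 \<le> as ! i \<and> as ! i \<le> 1"
proof -
  show *: "as \<noteq> []" "hd as = 0" "last as = 1" "sorted_wrt (<) as"
    using assms by (auto simp: monotonicity_points_def)
  show "Suc i < length as \<Longrightarrow> \<exists>e\<in>{1,-1}. mono_sgn e {as ! i<..<as ! Suc i} \<tau>"
    using assms by (auto simp: monotonicity_points_def strictly_monotonic_on_iff_mono_sgn)
  show "0 \<le> as ! i \<and> as ! i \<le> 1" if "i < length as"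
    using sorted_wrt_less_mono[OF *(4), of 0 i] sorted_wrt_less_mono[OF *(4), of i "length as - 1"] * that
    by (auto simp: hd_conv_nth last_conv_nth)
qed

lemma turning_points_subset:
  assumes m: "monotonicity_points \<tau> as"
  shows "turning_points \<tau> \<subseteq> set as"
proof
  fix x assume x: "x \<in> turning_points \<tau>"
  note D = monotonicity_pointsD[OF m]
  have x01: "0 < x" "x < 1" using x by (auto simp: turning_points_def)
  obtain i where i: "Suc i < length as" "as ! i \<le> x" "x < as ! Suc i"
    using sorted_wrt_less_locate_right[OF D(4,1), of x] x01 D by auto
  show "x \<in> set as"
  proof (rule ccontr)
    assume "x \<notin> set as"
    then have l: "as ! i < x" using i by (metis Suc_lessD le_less nth_mem)
    define d where "d = min (x - as ! i) (as ! Suc i - x)"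
    obtain e where "e \<in> {1,-1}" "mono_sgn e {as ! i<..<as ! Suc i} \<tau>" using D(5)[OF i(1)] by blast
    then have "\<exists>e\<in>{1,-1}. mono_sgn e {x-d<..<x+d} \<tau>"
      by (intro bexI[of _ e]) (auto elim!: mono_sgn_subset simp: d_def)
    moreover have "d > 0" "0 \<le> x - d" "x + d \<le> 1"
      using l i D(6)[of i] D(6)[of "Suc i"] by (auto simp: d_def min_def)
    ultimately show False using x by (auto simp: turning_points_def)
  qed
qed

text \<open>Induction on the number of entries of a given admissible list inside the interval.
  Around an inner entry that is no turning point the map has one local sign, and it must agree with
  the signs of both halves.\<close>

lemma mono_sgn_no_turning:
  assumes m: "monotonicity_points \<tau> as"
  shows "0 \<le> c \<Longrightarrow> c < d \<Longrightarrow> d \<le> 1 \<Longrightarrow> {c<..<d} \<inter> turning_points \<tau> = {} \<Longrightarrow>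
     card (set as \<inter> {c<..<d}) = n \<Longrightarrow> \<exists>e\<in>{1,-1}. mono_sgn e {c..d} \<tau>"
proof (induction n arbitrary: c d rule: less_induct)
  case (less n)
  note D = monotonicity_pointsD[OF m]
  show ?case
  proof (cases "set as \<inter> {c<..<d} = {}")
    case True
    obtain i where i: "Suc i < length as" "as ! i \<le> c" "c < as ! Suc i"
      using sorted_wrt_less_locate_right[OF D(4,1), of c] less.prems D by auto
    have "as ! Suc i \<in> set as" using i by simp
    then have "d \<le> as ! Suc i" using True i by force
    then obtain e where "e \<in> {1,-1}" "mono_sgn e {as ! i..as ! Suc i} \<tau>"
      using D(5)[OF i(1)] D(6)[of i] D(6)[of "Suc i"] i mono_sgn_closedI by fastforce
    then show ?thesis using \<open>d \<le> as ! Suc i\<close> i by (intro bexI[of _ e]) (auto elim!: mono_sgn_subset)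
  next
    case False
    then obtain x where x: "x \<in> set as" "c < x" "x < d" by auto
    have fin: "finite (set as \<inter> {c<..<d})" by simp
    have c1: "card (set as \<inter> {c<..<x}) < n" and c2: "card (set as \<inter> {x<..<d}) < n"
      unfolding less.prems(5)[symmetric] using x by (auto intro!: psubset_card_mono[OF fin])
    obtain e1 where e1: "e1 \<in> {1,-1}" "mono_sgn e1 {c..x} \<tau>"
      using less.IH[OF c1, of c x] less.prems x by (force simp: disjoint_iff)
    obtain e2 where e2: "e2 \<in> {1,-1}" "mono_sgn e2 {x..d} \<tau>"
      using less.IH[OF c2, of x d] less.prems x by (force simp: disjoint_iff)
    have "x \<notin> turning_points \<tau>" using less.prems x by auto
    then obtain r e where r: "r > 0" "0 \<le> x - r" "x + r \<le> 1" "e \<in> {1,-1}" "mono_sgn e {x-r<..<x+r} \<tau>"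
      using not_turning_pointE less.prems x by (metis le_less_trans less_le_trans)
    \<comment> \<open>Half the radius keeps the closed intervals \<open>{?u..x}\<close> and
      \<open>{x..?v}\<close> inside the open neighbourhood of \<open>x\<close> on which the sign
      \<open>e\<close> is known.\<close>
    let ?u = "max c (x - r/2)" and ?v = "min d (x + r/2)"
    have "mono_sgn e {?u..x} \<tau>" "mono_sgn e1 {?u..x} \<tau>"
      using r e1 x by (auto elim!: mono_sgn_subset)
    then have "e1 = e" using mono_sgn_unique[of e "{?u..x}" \<tau> e1 ?u x] r e1 x by auto
    moreover have "mono_sgn e {x..?v} \<tau>" "mono_sgn e2 {x..?v} \<tau>"
      using r e2 x by (auto elim!: mono_sgn_subset)
    then have "e2 = e" using mono_sgn_unique[of e "{x..?v}" \<tau> e2 x ?v] r e2 x by auto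
    ultimately show ?thesis using e1 e2 mono_sgn_union by blast
  qed
qed

text \<open>This describes the entries without reference to the list, which makes the maximal list
  unique. An interior entry that is no turning point would let its two adjacent intervals merge,
  against maximality.\<close>

lemma maximal_set:
  assumes m: "maximal_monotonicity_points \<tau> as"
  shows "set as = insert 0 (insert 1 (turning_points \<tau>))"
proof -
  have mp: "monotonicity_points \<tau> as" using m by (simp add: maximal_monotonicity_points_def)
  note D = monotonicity_pointsD[OF mp]
  have "x \<in> turning_points \<tau>" if x: "x \<in> set as" "x \<noteq> 0" "x \<noteq> 1" for x
  proof (rule ccontr)
    assume nt: "x \<notin> turning_points \<tau>"
    have x01: "0 < x" "x < 1" using x D(6) by (auto simp: in_set_conv_nth) (metis le_less)+
    obtain j where j: "j < length as" "x = as ! j" using x by (auto simp: in_set_conv_nth)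
    then have j0: "j \<noteq> 0" "j \<noteq> length as - 1" using x D by (auto simp: hd_conv_nth last_conv_nth intro: ccontr)
    define i where "i = j - 1"
    have i: "x = as ! Suc i" "Suc (Suc i) < length as" using j j0 by (auto simp: i_def)
    let ?u = "as ! i" and ?v = "as ! Suc (Suc i)"
    have uv: "?u < x" "x < ?v" using i D(4) by (auto simp: sorted_wrt_nth_less)
    have b: "0 \<le> ?u" "?v \<le> 1" using D(6) i by auto
    have "card (turning_points \<tau> \<inter> {?u<..<?v}) = 0"
      using sorted_wrt_less_gap[OF D(4), of i] sorted_wrt_less_gap[OF D(4), of "Suc i"] i nt
        turning_points_subset[OF mp] by (auto simp: card_eq_0_iff disjoint_iff) (metis linorder_neqE subsetD Suc_lessD)
    then have "{?u<..<?v} \<inter> turning_points \<tau> = {}"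
      using finite_subset[OF turning_points_subset[OF mp]] by (auto simp: card_eq_0_iff)
    then obtain e where "e \<in> {1,-1}" "mono_sgn e {?u..?v} \<tau>"
      using mono_sgn_no_turning[OF mp, of ?u ?v] uv b by force
    then have "strictly_monotonic_on {?u<..<?v} \<tau>"
      unfolding strictly_monotonic_on_iff_mono_sgn by (intro bexI[of _ e]) (auto elim!: mono_sgn_subset)
    moreover have "{?u<..<?v} \<subseteq> {0..1}" "{as ! i<..<as ! Suc i} \<subset> {?u<..<?v}"
    proof -
      have "x \<in> {?u<..<?v}" "x \<notin> {as ! i<..<as ! Suc i}" using uv i by auto
      then show "{as ! i<..<as ! Suc i} \<subset> {?u<..<?v}" using uv i by fastforce
    qed (use b in auto)
    ultimately show False using m i unfolding maximal_monotonicity_points_def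
      by (meson Suc_lessD)
  qed
  moreover have "0 \<in> set as" "1 \<in> set as" using D by (metis hd_in_set, metis last_in_set)
  ultimately show ?thesis using turning_points_subset[OF mp] by blast
qed

lemma ex1_maximal: "\<exists>!as. maximal_monotonicity_points \<tau> as"
proof (rule ex_ex1I)
  fix as bs assume "maximal_monotonicity_points \<tau> as" "maximal_monotonicity_points \<tau> bs"
  then show "as = bs" using maximal_set
    by (metis sorted_wrt_less_unique maximal_monotonicity_points_def monotonicity_points_def)
next
  obtain bs where bs: "monotonicity_points \<tau> bs" using pm by (auto simp: piecewise_monotonic_def)
  \<comment> \<open>The candidate is read off from the turning points; any admissible list contains
    them, so the set is finite.\<close>
  define A where "A = insert 0 (insert 1 (turning_points \<tau>))"
  have fA: "finite A" using turning_points_subset[OF bs] by (auto simp: A_def intro: finite_subset)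
  have A01: "A \<subseteq> {0..1}" by (auto simp: A_def turning_points_def)
  define as where "as = sorted_list_of_set A"
  have set: "set as = A" and s: "sorted_wrt (<) as" using fA by (auto simp: as_def)
  have ne: "as \<noteq> []" using set by (auto simp: A_def)
  have hd0: "hd as = 0"
  proof -
    obtain j where j: "j < length as" "as ! j = 0" using set by (metis A_def in_set_conv_nth insertI1)
    have "hd as \<le> 0" using sorted_wrt_less_mono[OF s, of 0 j] j ne by (simp add: hd_conv_nth)
    moreover have "hd as \<in> A" using set ne by auto
    ultimately show ?thesis using A01 by auto
  qed
  have last1: "last as = 1"
  proof -
    obtain j where j: "j < length as" "as ! j = 1" using set by (metis A_def in_set_conv_nth insertI1 insertI2)
    have "1 \<le> last as" using sorted_wrt_less_mono[OF s, of j "length as - 1"] j ne by (simp add: last_conv_nth)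
    moreover have "last as \<in> A" using set ne last_in_set by blast
    ultimately show ?thesis using A01 by auto
  qed
  have len: "2 \<le> length as" using hd0 last1 ne by (cases as; cases "tl as") auto
  have mono: "\<exists>e\<in>{1,-1}. mono_sgn e {as ! i..as ! Suc i} \<tau>" if i: "Suc i < length as" for i
  proof -
    have "as ! i \<in> A" "as ! Suc i \<in> A" using i set by (metis Suc_lessD nth_mem)+
    moreover have "{as ! i<..<as ! Suc i} \<inter> turning_points \<tau> = {}"
      using sorted_wrt_less_gap[OF s i] set by (auto simp: A_def)
    moreover have "as ! i < as ! Suc i" using s i by (simp add: sorted_wrt_nth_less)
    ultimately show ?thesis using mono_sgn_no_turning[OF bs, of "as ! i" "as ! Suc i"] A01 by force
  qed
  have mp: "monotonicity_points \<tau> as"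
    unfolding monotonicity_points_def strictly_monotonic_on_iff_mono_sgn
    using len hd0 last1 s mono by (force intro: mono_sgn_subset)
  have "\<not> strictly_monotonic_on {u<..<v} \<tau>"
    if i: "Suc i < length as" "{u<..<v} \<subseteq> {0..1}" "{as ! i <..< as ! Suc i} \<subset> {u<..<v}" for i u v
  proof
    assume "strictly_monotonic_on {u<..<v} \<tau>"
    then obtain e where e: "e \<in> {1,-1}" "mono_sgn e {u<..<v} \<tau>"
      by (auto simp: strictly_monotonic_on_iff_mono_sgn)
    have lt: "as ! i < as ! Suc i" using s i by (simp add: sorted_wrt_nth_less)
    have uv: "u \<le> as ! i" "as ! Suc i \<le> v" "u < v"
      using i(3) lt by (auto simp: psubset_eq greaterThanLessThan_subseteq_greaterThanLessThan)
    have uv01: "0 \<le> u" "v \<le> 1" using i(2) uv(3)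
      by (auto simp: greaterThanLessThan_subseteq_atLeastAtMost_iff)
    \<comment> \<open>A strictly larger interval has an entry in its interior. Monotonicity around
      that entry shows that it is no turning point, and 0 and 1 cannot be interior.\<close>
    have "u < as ! i \<or> as ! Suc i < v" using i(3) uv by (metis le_less psubset_eq)
    then obtain x where x: "x \<in> set as" "u < x" "x < v"
      using uv lt i(1) by (metis Suc_lessD le_less_trans less_le_trans nth_mem)
    define d where "d = min (x - u) (v - x)"
    have "d > 0" "0 \<le> x - d" "x + d \<le> 1" "{x-d<..<x+d} \<subseteq> {u<..<v}"
      using x uv01 by (auto simp: d_def min_def)
    then have "x \<notin> turning_points \<tau>"
      using e mono_sgn_subset unfolding turning_points_def by blast
    then have "x = 0 \<or> x = 1" using x set by (auto simp: A_def)
    then show False using x uv01 by auto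
  qed
  then show "\<exists>as. maximal_monotonicity_points \<tau> as"
    unfolding maximal_monotonicity_points_def using mp by blast
qed

abbreviation "as \<equiv> assoc_partition \<tau>"

lemma maximal_as: "maximal_monotonicity_points \<tau> as"
  unfolding assoc_partition_def by (rule theI'[OF ex1_maximal])

lemma as_eqI: "maximal_monotonicity_points \<tau> bs \<Longrightarrow> as = bs"
  using ex1_maximal maximal_as by blast

lemma mp_as: "monotonicity_points \<tau> as"
  using maximal_as by (simp add: maximal_monotonicity_points_def)

lemmas as_ne = monotonicity_pointsD(1)[OF mp_as]
  and as_hd = monotonicity_pointsD(2)[OF mp_as]
  and as_last = monotonicity_pointsD(3)[OF mp_as]
  and as_sorted = monotonicity_pointsD(4)[OF mp_as]

lemma as_01: "i < length as \<Longrightarrow> 0 \<le> as ! i" "i < length as \<Longrightarrow> as ! i \<le> 1"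
  using monotonicity_pointsD(6)[OF mp_as] by auto

lemma as_less: "i < j \<Longrightarrow> j < length as \<Longrightarrow> as ! i < as ! j"
  using as_sorted by (simp add: sorted_wrt_nth_less)

lemma as_len: "2 \<le> length as"
  using mp_as by (simp add: monotonicity_points_def)

lemma as_0: "as ! 0 = 0" and as_end: "as ! (length as - 1) = 1"
  using as_hd as_last as_ne by (auto simp: hd_conv_nth last_conv_nth)

lemma set_as: "set as = insert 0 (insert 1 (turning_points \<tau>))"
  by (rule maximal_set[OF maximal_as])

lemma set_as_01: "x \<in> set as \<Longrightarrow> 0 \<le> x \<and> x \<le> 1"
  using set_as by (auto simp: turning_points_def)

section \<open>Laps and their signs\<close>

definition lap :: "nat \<Rightarrow> real set" where
  "lap i = {as ! i..as ! Suc i}"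

definition dirs :: "nat \<Rightarrow> int" where
  "dirs i = (if mono_sgn 1 (lap i) \<tau> then 1 else -1)"

lemma dirs_cases: "dirs i = 1 \<or> dirs i = -1"
  by (simp add: dirs_def)

lemma lap_subset: "Suc i < length as \<Longrightarrow> lap i \<subseteq> {0..1}"
  using as_01[of i] as_01[of "Suc i"] by (auto simp: lap_def)

lemma mono_lap: "Suc i < length as \<Longrightarrow> mono_sgn (dirs i) (lap i) \<tau>"
  using monotonicity_pointsD(5)[OF mp_as, of i] mono_sgn_closedI[of _ "as ! i" "as ! Suc i"] as_01[of i] as_01[of "Suc i"]
  unfolding dirs_def lap_def by auto

lemma mono_lap_less:
  "Suc i < length as \<Longrightarrow> x \<in> lap i \<Longrightarrow> y \<in> lap i \<Longrightarrow> x < y \<Longrightarrow> dirs i * \<tau> x < dirs i * \<tau> y"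
  using mono_lap unfolding mono_sgn_def by auto

lemma locate_right:
  assumes "0 \<le> x" "x < 1" obtains i where "Suc i < length as" "as ! i \<le> x" "x < as ! Suc i"
  using sorted_wrt_less_locate_right[OF as_sorted as_ne] assms as_hd as_last by auto

lemma locate_left:
  assumes "0 < x" "x \<le> 1" obtains i where "Suc i < length as" "as ! i < x" "x \<le> as ! Suc i"
  using sorted_wrt_less_locate_left[OF as_sorted as_ne] assms as_hd as_last by auto

lemma locate:
  assumes "0 \<le> x" "x \<le> 1" obtains i where "Suc i < length as" "x \<in> lap i"
proof (cases "x < 1")
  case True
  then obtain i where "Suc i < length as" "as ! i \<le> x" "x < as ! Suc i" using locate_right assms by blast
  then show ?thesis using that[of i] by (auto simp: lap_def)
next
  case False
  then obtain i where "Suc i < length as" "as ! i < x" "x \<le> as ! Suc i" using locate_left[of x] assms by auto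
  then show ?thesis using that[of i] by (auto simp: lap_def)
qed

text \<open>Two adjacent laps of equal sign would form one larger interval of monotonicity.
  Consequently the sign on the first lap, which condition (i) compares, determines all the
  others.\<close>

lemma dirs_alternate:
  assumes i: "Suc (Suc i) < length as"
  shows "dirs (Suc i) = - dirs i"
proof (rule ccontr)
  assume "dirs (Suc i) \<noteq> - dirs i"
  then have eq: "dirs (Suc i) = dirs i" using dirs_cases[of i] dirs_cases[of "Suc i"] by auto
  have "mono_sgn (dirs i) {as ! i..as ! Suc (Suc i)} \<tau>"
    using mono_sgn_union[of "dirs i" "as ! i" "as ! Suc i" \<tau> "as ! Suc (Suc i)"]
      mono_lap[of i] mono_lap[of "Suc i"] i eq by (simp add: lap_def)
  then have "strictly_monotonic_on {as ! i<..<as ! Suc (Suc i)} \<tau>"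
    unfolding strictly_monotonic_on_iff_mono_sgn using dirs_cases[of i]
    by (intro bexI[of _ "dirs i"]) (auto elim!: mono_sgn_subset)
  moreover have "{as ! i<..<as ! Suc (Suc i)} \<subseteq> {0..1}"
    using as_01[of i] as_01[of "Suc (Suc i)"] i by auto
  moreover have "{as ! i<..<as ! Suc i} \<subset> {as ! i<..<as ! Suc (Suc i)}"
  proof -
    have "as ! Suc i \<in> {as ! i<..<as ! Suc (Suc i)} - {as ! i<..<as ! Suc i}"
      using as_less[of i "Suc i"] as_less[of "Suc i" "Suc (Suc i)"] i by auto
    moreover have "{as ! i<..<as ! Suc i} \<subseteq> {as ! i<..<as ! Suc (Suc i)}"
      using as_less[of "Suc i" "Suc (Suc i)"] i by auto
    ultimately show ?thesis by blast
  qed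
  ultimately show False using maximal_as i unfolding maximal_monotonicity_points_def
    by (meson Suc_lessD)
qed

lemma first_interval_mono:
  "strict_mono_on (first_interval \<tau>) \<tau> \<longleftrightarrow> dirs 0 = 1"
  "strict_antimono_on (first_interval \<tau>) \<tau> \<longleftrightarrow> dirs 0 = -1"
proof -
  have l: "Suc 0 < length as" using as_len by simp
  have m: "mono_sgn (dirs 0) {as ! 0<..<as ! Suc 0} \<tau>"
    by (rule mono_sgn_subset[OF mono_lap[OF l]]) (auto simp: lap_def)
  have lt: "as ! 0 < as ! Suc 0" using as_less l by blast
  have un: "e = dirs 0" if "mono_sgn e {as ! 0<..<as ! Suc 0} \<tau>" "e \<in> {1,-1}" for e
  proof -
    obtain x where x: "as ! 0 < x" "x < as ! Suc 0" using lt dense by blast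
    obtain y where y: "x < y" "y < as ! Suc 0" using x dense by blast
    show ?thesis by (rule mono_sgn_unique[OF that(1) m that(2), of x y]) (use x y dirs_cases[of 0] in auto)
  qed
  have "strict_mono_on (first_interval \<tau>) \<tau> \<longleftrightarrow> mono_sgn 1 {as ! 0<..<as ! Suc 0} \<tau>"
    "strict_antimono_on (first_interval \<tau>) \<tau> \<longleftrightarrow> mono_sgn (-1) {as ! 0<..<as ! Suc 0} \<tau>"
    by (auto simp: first_interval_def mono_sgn_def monotone_on_def)
  then show "strict_mono_on (first_interval \<tau>) \<tau> \<longleftrightarrow> dirs 0 = 1"
    "strict_antimono_on (first_interval \<tau>) \<tau> \<longleftrightarrow> dirs 0 = -1"
    using un m by (metis insertI1 insertI2)+
qed

end

section \<open>Dynamics of transitive interval maps\<close>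

lemma continuous_sign_change:
  fixes F :: "real \<Rightarrow> real"
  assumes "continuous_on {u<..<v} F" "x \<in> {u<..<v}" "y \<in> {u<..<v}" "F x \<le> 0" "0 \<le> F y"
  obtains z where "z \<in> {u<..<v}" "F z = 0"
proof -
  have "connected (F ` {u<..<v})" using assms(1) by (intro connected_continuous_image) auto
  then have "{F x..F y} \<subseteq> F ` {u<..<v}" using assms(2,3) by (intro connected_contains_Icc) auto
  then have "0 \<in> F ` {u<..<v}" using assms(4,5) by auto
  then obtain z where "z \<in> {u<..<v}" "0 = F z" by blast
  then show ?thesis using that by metis
qed

lemma funpow_mod_div: "(f ^^ n) x = (f ^^ (n mod r)) ((f ^^ (r * (n div r))) x)"
proof -
  have "f ^^ n = f ^^ (n mod r) \<circ> f ^^ (r * (n div r))" by (metis funpow_add mod_mult_div_eq)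
  then show ?thesis by (metis comp_apply)
qed

lemma interval_avoiding_finite:
  fixes F :: "real set"
  assumes "finite F" "a < b"
  obtains u v where "a \<le> u" "u < v" "v \<le> b" "{u<..<v} \<inter> F = {}"
proof -
  have o: "open ({a<..<b} - F)" using assms by (intro open_Diff finite_imp_closed) auto
  have "infinite ({a<..<b} - F)" using assms by (simp add: infinite_Ioo)
  then obtain x where x: "x \<in> {a<..<b} - F" by (metis all_not_in_conv finite.emptyI)
  then obtain e where e: "e > 0" "ball x e \<subseteq> {a<..<b} - F" using o open_contains_ball by blast
  have "{x<..<x + e} \<subseteq> ball x e" by (auto simp: dist_real_def)
  then have s: "{x<..<x + e} \<subseteq> {a<..<b} - F" using e by blast
  then have "{x<..<x + e} \<subseteq> {a<..<b}" by blast
  then have "a \<le> x \<and> x + e \<le> b" using e by (simp add: greaterThanLessThan_subseteq_greaterThanLessThan)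
  then show ?thesis using that[of x "x + e"] e s by auto
qed

locale trans_map = pm_map +
  assumes tr: "transitive_map \<tau>"
begin

lemma iter_maps: "x \<in> {0..1} \<Longrightarrow> (\<tau> ^^ n) x \<in> {0..1}"
  by (induction n) (use maps in auto)

lemma iter_image_subset: "S \<subseteq> {0..1} \<Longrightarrow> (\<tau> ^^ n) ` S \<subseteq> {0..1}"
  using iter_maps by blast

lemma iter_cont: "continuous_on {0..1} (\<tau> ^^ n)"
proof (induction n)
  case (Suc n)
  have "continuous_on {0..1} (\<tau> \<circ> (\<tau> ^^ n))"
    by (rule continuous_on_compose[OF Suc continuous_on_subset[OF cont]]) (use iter_maps in blast)
  then show ?case by simp
qed (simp add: id_def)

lemma trans_interval:
  assumes "0 \<le> u" "u < v" "v \<le> 1" "0 \<le> a" "a < b" "b \<le> 1"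
  shows "\<exists>n x. x \<in> {u<..<v} \<and> (\<tau> ^^ n) x \<in> {a<..<b}"
proof -
  have "openin (top_of_set {0..1}) {u<..<v}" "openin (top_of_set {0..1}) {a<..<b}"
    using assms by (auto intro!: open_subset)
  moreover have "{u<..<v} \<noteq> {}" "{a<..<b} \<noteq> {}" using assms by auto
  ultimately have "\<exists>n. (\<tau> ^^ n) ` {u<..<v} \<inter> {a<..<b} \<noteq> {}"
    using tr unfolding transitive_map_def by blast
  then show ?thesis by blast
qed

text \<open>Otherwise \<open>\<tau> x - x\<close> would have constant sign on the open interval, all
  orbits would be monotone, and no point of one half could ever move to the other half in the
  opposite direction.\<close>

lemma fixed_interior: obtains c where "0 < c" "c < 1" "\<tau> c = c"
proof (rule ccontr)
  assume "\<not> thesis"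
  then have nf: "\<And>x. x \<in> {0<..<1} \<Longrightarrow> \<tau> x \<noteq> x" using that by (metis greaterThanLessThan_iff)
  let ?g = "\<lambda>x. \<tau> x - x"
  have cg: "continuous_on {0..1} ?g" by (intro continuous_intros cont)
  then have cg': "continuous_on {0<..<1} ?g" by (rule continuous_on_subset) auto
  have cl: "closure {0<..<1::real} = {0..1}" by simp
  have h: "(1/2::real) \<in> {0<..<1}" by simp
  consider "?g (1/2) > 0" | "?g (1/2) < 0" using nf[OF h] by linarith
  then show False
  proof cases
    case 1
    have "?g x \<ge> 0" if x: "x \<in> {0<..<1}" for x
    proof (rule ccontr)
      assume "\<not> ?g x \<ge> 0"
      then have "?g x \<le> 0" "0 \<le> ?g (1/2)" using 1 by auto
      then obtain z where "z \<in> {0<..<1}" "?g z = 0" by (rule continuous_sign_change[OF cg' x h])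
      then show False using nf[of z] by simp
    qed
    then have ge: "?g x \<ge> 0" if "x \<in> {0..1}" for x
      using continuous_ge_on_closure[of "{0<..<1}" ?g x 0] cg cl that by auto
    have "(\<tau> ^^ n) x \<ge> x" if "x \<in> {0..1}" for n x
    proof (induction n)
      case (Suc n) then show ?case using ge[OF iter_maps[OF that, of n]] by auto
    qed simp
    then have up: "x \<le> (\<tau> ^^ n) x" if "0 \<le> x" "x \<le> 1" for n x using that by simp
    obtain n x where "1/2 < x" "x < 1" "(\<tau> ^^ n) x < 1/2"
      using trans_interval[of "1/2" 1 0 "1/2"] by auto
    then show False using up[of x n] by linarith
  next
    case 2
    have "?g x \<le> 0" if x: "x \<in> {0<..<1}" for x
    proof (rule ccontr)
      assume "\<not> ?g x \<le> 0"
      then have "?g (1/2) \<le> 0" "0 \<le> ?g x" using 2 by auto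
      then obtain z where "z \<in> {0<..<1}" "?g z = 0" by (rule continuous_sign_change[OF cg' h x])
      then show False using nf[of z] by simp
    qed
    then have ge: "?g x \<le> 0" if "x \<in> {0..1}" for x
      using continuous_le_on_closure[of "{0<..<1}" ?g x 0] cg cl that by auto
    have "(\<tau> ^^ n) x \<le> x" if "x \<in> {0..1}" for n x
    proof (induction n)
      case (Suc n) then show ?case using ge[OF iter_maps[OF that, of n]] by auto
    qed simp
    then have dn: "(\<tau> ^^ n) x \<le> x" if "0 \<le> x" "x \<le> 1" for n x using that by simp
    obtain n x where "0 < x" "x < 1/2" "1/2 < (\<tau> ^^ n) x"
      using trans_interval[of 0 "1/2" "1/2" 1] by auto
    then show False using dn[of x n] by linarith
  qed
qed

text \<open>If \<open>C\<close> is the component of the forward orbit \<open>U\<close> of an interval, then \<open>U\<close> is a finite union of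
  images of \<open>C\<close> that are permuted cyclically, and since one of them accumulates at the fixed point
  \<open>c\<close>, all of them do.\<close>

lemma orbit_cover:
  assumes uv: "0 \<le> u" "u < v" "v \<le> 1" and c: "0 < c" "c < 1" "\<tau> c = c"
    and y: "0 < y" "y < 1" "y \<noteq> c"
  shows "\<exists>n x. x \<in> {u<..<v} \<and> (\<tau> ^^ n) x = y"
proof -
  define J where "J = {u<..<v}"
  define U where "U = (\<Union>n. (\<tau> ^^ n) ` J)"
  define x0 where "x0 = (u + v) / 2"
  have x0: "x0 \<in> J" "u < x0" "x0 < v" using uv by (auto simp: J_def x0_def)
  have J01: "J \<subseteq> {0..1}" using uv by (auto simp: J_def)
  have U01: "U \<subseteq> {0..1}" using iter_image_subset[OF J01] by (auto simp: U_def)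
  have JU: "J \<subseteq> U"
  proof
    fix x assume "x \<in> J" then have "x \<in> (\<tau> ^^ 0) ` J" by simp
    then show "x \<in> U" unfolding U_def by blast
  qed
  have UU: "(\<tau> ^^ m) ` U \<subseteq> U" for m
  proof
    fix z assume "z \<in> (\<tau> ^^ m) ` U"
    then obtain n x where "x \<in> J" "z = (\<tau> ^^ m) ((\<tau> ^^ n) x)" by (auto simp: U_def)
    then have "z = (\<tau> ^^ (m + n)) x" by (simp add: funpow_add)
    then show "z \<in> U" using \<open>x \<in> J\<close> unfolding U_def by blast
  qed
  have dense: "\<exists>x\<in>U. a < x \<and> x < b" if ab: "0 \<le> a" "a < b" "b \<le> 1" for a b
  proof -
    obtain n x where "x \<in> {u<..<v}" "(\<tau> ^^ n) x \<in> {a<..<b}" using trans_interval[OF uv ab] by blast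
    moreover from this have "(\<tau> ^^ n) x \<in> U" unfolding U_def J_def by blast
    ultimately show ?thesis by auto
  qed
  define C where "C = connected_component_set U x0"
  have CU: "C \<subseteq> U" unfolding C_def by (rule connected_component_subset)
  have C01: "C \<subseteq> {0..1}" using CU U01 by blast
  have conC: "connected C" by (simp add: C_def)
  have JC: "J \<subseteq> C" unfolding C_def
    by (rule connected_component_maximal[OF x0(1) _ JU]) (simp add: J_def)
  have conI: "connected ((\<tau> ^^ n) ` C)" for n
    by (rule connected_continuous_image[OF continuous_on_subset[OF iter_cont C01] conC])
  \<comment> \<open>\<open>r\<close> is a return time of the component \<open>C\<close>. Starting to
    the left of \<open>x0\<close> and landing to its right rules out \<open>r = 0\<close>, which
    transitivity alone allows.\<close>
  obtain r x where rx: "x \<in> {u<..<x0}" "(\<tau> ^^ r) x \<in> {x0<..<v}"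
    using trans_interval[of u x0 x0 v] uv x0 by auto
  have r: "r \<noteq> 0" using rx by (auto intro: ccontr)
  have xJ: "x \<in> J" "(\<tau> ^^ r) x \<in> J" using rx x0 uv by (auto simp: J_def)
  have CrC: "(\<tau> ^^ r) ` C \<subseteq> C"
  proof -
    have "(\<tau> ^^ r) x \<in> C" using xJ JC by blast
    then have "C = connected_component_set U ((\<tau> ^^ r) x)"
      unfolding C_def by (metis connected_component_eq)
    moreover have "(\<tau> ^^ r) ` C \<subseteq> connected_component_set U ((\<tau> ^^ r) x)"
    proof (rule connected_component_maximal[OF _ conI])
      show "(\<tau> ^^ r) x \<in> (\<tau> ^^ r) ` C" using xJ JC by blast
      show "(\<tau> ^^ r) ` C \<subseteq> U" using UU[of r] CU by blast
    qed
    ultimately show ?thesis by simp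
  qed
  have CrqC: "(\<tau> ^^ (r * q)) ` C \<subseteq> C" for q
  proof (induction q)
    case (Suc q)
    have "(\<tau> ^^ (r * Suc q)) z = (\<tau> ^^ r) ((\<tau> ^^ (r * q)) z)" for z by (simp add: funpow_add)
    then show ?case using Suc CrC by auto
  qed simp
  \<comment> \<open>Since \<open>\<tau> ^^ r\<close> maps \<open>C\<close> into itself, times matter
    only modulo \<open>r\<close>. The union is finite, so its closure is the union of the
    closures.\<close>
  have Ueq: "U \<subseteq> \<Union>((\<lambda>j. (\<tau> ^^ j) ` C) ` {..<r})"
  proof
    fix z assume "z \<in> U"
    then obtain n x where x: "x \<in> J" "z = (\<tau> ^^ n) x" by (auto simp: U_def)
    have "z = (\<tau> ^^ (n mod r)) ((\<tau> ^^ (r * (n div r))) x)" using x funpow_mod_div by metis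
    moreover have "(\<tau> ^^ (r * (n div r))) x \<in> C" using CrqC x JC by blast
    ultimately show "z \<in> \<Union>((\<lambda>j. (\<tau> ^^ j) ` C) ` {..<r})" using r by auto
  qed
  have "c \<in> closure U" unfolding closure_approachable
  proof (intro allI impI)
    fix e :: real assume "e > 0"
    then obtain x where "x \<in> U" "c < x" "x < min 1 (c + e)" using dense[of c "min 1 (c + e)"] c by auto
    then show "\<exists>y\<in>U. dist y c < e" by (intro bexI[of _ x]) (auto simp: dist_real_def)
  qed
  then have "c \<in> closure (\<Union>((\<lambda>j. (\<tau> ^^ j) ` C) ` {..<r}))" using closure_mono[OF Ueq] by blast
  moreover have "closure (\<Union>((\<lambda>j. (\<tau> ^^ j) ` C) ` {..<r})) \<subseteq> (\<Union>j<r. closure ((\<tau> ^^ j) ` C))"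
  proof (rule closure_minimal)
    show "\<Union>((\<lambda>j. (\<tau> ^^ j) ` C) ` {..<r}) \<subseteq> (\<Union>j<r. closure ((\<tau> ^^ j) ` C))"
      by (intro UN_mono closure_subset) simp
  qed (intro closed_UN; simp)
  ultimately have "c \<in> (\<Union>j<r. closure ((\<tau> ^^ j) ` C))" by blast
  then obtain j where j: "j < r" "c \<in> closure ((\<tau> ^^ j) ` C)" by auto
  have push: "c \<in> closure ((\<tau> ^^ n) ` S)" if "c \<in> closure S" "S \<subseteq> {0..1}" for n S
  proof -
    have cl: "closure S \<subseteq> {0..1}" using that(2) by (simp add: closure_minimal)
    have "(\<tau> ^^ n) ` closure S \<subseteq> closure ((\<tau> ^^ n) ` S)"
      by (rule image_closure_subset[OF continuous_on_subset[OF iter_cont cl]]) (auto simp: closure_subset)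
    moreover have "(\<tau> ^^ n) c = c" by (induction n) (auto simp: c)
    ultimately show ?thesis using that(1) by (metis image_subset_iff)
  qed
  have "c \<in> closure ((\<tau> ^^ (r - j)) ` (\<tau> ^^ j) ` C)"
    by (rule push[OF j(2) iter_image_subset[OF C01]])
  moreover have "(\<tau> ^^ (r - j)) ` (\<tau> ^^ j) ` C = (\<tau> ^^ r) ` C"
    using j funpow_add[of "r - j" j \<tau>] by (simp add: image_comp)
  ultimately have "c \<in> closure C" using closure_mono[OF CrC] by auto
  then have cC: "c \<in> closure ((\<tau> ^^ n) ` C)" for n by (rule push[OF _ C01])
  \<comment> \<open>Every image of \<open>C\<close> is connected and accumulates at
    \<open>c\<close>, so it contains everything strictly between \<open>c\<close> and any of its
    points.\<close>
  have fill: "z \<in> U" if xz: "x \<in> U" "c < z \<and> z < x \<or> x < z \<and> z < c" for x z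
  proof -
    obtain n where n: "x \<in> (\<tau> ^^ n) ` C" using xz(1) JC unfolding U_def by blast
    have "\<bar>z - c\<bar> > 0" using xz(2) by auto
    then obtain d where d: "d \<in> (\<tau> ^^ n) ` C" "dist d c < \<bar>z - c\<bar>"
      using cC[of n] unfolding closure_approachable by blast
    have "z \<in> {d..x} \<or> z \<in> {x..d}" using d(2) xz(2) by (auto simp: dist_real_def abs_if split: if_splits)
    then have "z \<in> (\<tau> ^^ n) ` C"
      using connected_contains_Icc[OF conI d(1) n] connected_contains_Icc[OF conI n d(1)] by blast
    then show ?thesis using UU[of n] CU by blast
  qed
  have "y \<in> U"
  proof (cases "c < y")
    case True
    then obtain x where "x \<in> U" "y < x" using dense[of y 1] y by auto
    then show ?thesis using fill[of x y] True by blast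
  next
    case False
    then obtain x where "x \<in> U" "x < y" using dense[of 0 y] y by auto
    then show ?thesis using fill[of x y] False y by auto
  qed
  then show ?thesis unfolding U_def J_def by blast
qed

text \<open>Iterates never collapse an interval to a point: some piece of it lies in a single lap,
  where the map is strictly monotonic.\<close>

lemma iter_image_interval:
  assumes "0 \<le> u" "u < v" "v \<le> 1"
  shows "\<exists>a b. a < b \<and> {a..b} \<subseteq> (\<tau> ^^ n) ` {u<..<v}"
proof (induction n)
  case 0
  obtain a where a: "u < a" "a < v" using assms dense by blast
  obtain b where b: "a < b" "b < v" using a dense by blast
  have "{a..b} \<subseteq> {u<..<v}" using a b by auto
  then show ?case using b by auto
next
  case (Suc n)
  then obtain a b where ab: "a < b" "{a..b} \<subseteq> (\<tau> ^^ n) ` {u<..<v}" by blast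
  have "{u<..<v} \<subseteq> {0..1}" using assms by auto
  then have s01: "{a..b} \<subseteq> {0..1}" using ab(2) iter_image_subset by (meson order_trans)
  then have a01: "0 \<le> a" "a < 1" using ab(1) by auto
  obtain i where i: "Suc i < length as" "as ! i \<le> a" "a < as ! Suc i" using locate_right a01 by blast
  let ?b = "min b (as ! Suc i)"
  have "a < ?b" using ab i by auto
  moreover have lp: "a \<in> lap i" "?b \<in> lap i" using i ab by (auto simp: lap_def)
  ultimately have ne: "\<tau> a \<noteq> \<tau> ?b" using mono_lap_less[OF i(1) lp] by auto
  have "connected (\<tau> ` {a..?b})" using s01 ab(1) i
    by (intro connected_continuous_image continuous_on_subset[OF cont]) (auto simp: min_def split: if_splits)
  moreover have "\<tau> a \<in> \<tau> ` {a..?b}" "\<tau> ?b \<in> \<tau> ` {a..?b}" using \<open>a < ?b\<close> by simp_all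
  ultimately have "{\<tau> a..\<tau> ?b} \<subseteq> \<tau> ` {a..?b}" "{\<tau> ?b..\<tau> a} \<subseteq> \<tau> ` {a..?b}"
    using connected_contains_Icc by metis+
  moreover have "\<tau> ` {a..?b} \<subseteq> (\<tau> ^^ Suc n) ` {u<..<v}"
  proof -
    have "\<tau> ` {a..?b} \<subseteq> \<tau> ` {a..b}" by (intro image_mono) auto
    also have "\<dots> \<subseteq> \<tau> ` (\<tau> ^^ n) ` {u<..<v}" using ab(2) by (rule image_mono)
    finally show ?thesis by (simp add: image_comp)
  qed
  moreover have "\<tau> a < \<tau> ?b \<or> \<tau> ?b < \<tau> a" using ne by linarith
  ultimately show ?case by (meson order_trans)
qed

text \<open>Without periodic points in the interval, each \<open>(\<tau> ^^ k) x - x\<close> with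
  \<open>k \<ge> 1\<close> has constant sign there. A point \<open>z\<close> carried to the left in
  time \<open>n\<close> and a point \<open>y\<close> carried to the right in time \<open>n'\<close>
  then disagree about the sign at time \<open>n * n'\<close>.\<close>

lemma periodic_dense:
  assumes uv: "0 \<le> u" "u < v" "v \<le> 1"
  obtains x k where "x \<in> {u<..<v}" "k \<ge> 1" "(\<tau> ^^ k) x = x"
proof (rule ccontr)
  assume "\<not> thesis"
  then have np: "\<And>x k. x \<in> {u<..<v} \<Longrightarrow> k \<ge> 1 \<Longrightarrow> (\<tau> ^^ k) x \<noteq> x" using that by blast
  have nz: False if xy: "x \<in> {u<..<v}" "y \<in> {u<..<v}" "(\<tau> ^^ k) x - x \<le> 0" "0 \<le> (\<tau> ^^ k) y - y" "k \<ge> 1" for x y k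
  proof -
    have "continuous_on {u<..<v} (\<lambda>x. (\<tau> ^^ k) x - x)"
      using uv by (intro continuous_intros continuous_on_subset[OF iter_cont]) auto
    then obtain z where "z \<in> {u<..<v}" "(\<tau> ^^ k) z - z = 0"
      by (rule continuous_sign_change[OF _ xy(1-4)])
    then show False using np[of z k] xy(5) by simp
  qed
  \<comment> \<open>a return to the right of the starting point forces all multiples of it to the right\<close>
  have right: "z < (\<tau> ^^ (m * Suc k)) z" if "z \<in> {u<..<v}" "m \<ge> 1" "(\<tau> ^^ m) z \<in> {u<..<v}" "z < (\<tau> ^^ m) z" for z m k
  proof (induction k)
    case (Suc k)
    show ?case
    proof (rule ccontr)
      assume "\<not> ?case"
      moreover have "(\<tau> ^^ (m * Suc (Suc k))) z = (\<tau> ^^ (m * Suc k)) ((\<tau> ^^ m) z)"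
        by (metis add.commute comp_apply funpow_add mult_Suc_right)
      ultimately show False using nz[of "(\<tau> ^^ m) z" z "m * Suc k"] Suc that by auto
    qed
  qed (use that in simp)
  have left: "(\<tau> ^^ (m * Suc k)) z < z" if "z \<in> {u<..<v}" "m \<ge> 1" "(\<tau> ^^ m) z \<in> {u<..<v}" "(\<tau> ^^ m) z < z" for z m k
  proof (induction k)
    case (Suc k)
    show ?case
    proof (rule ccontr)
      assume "\<not> ?case"
      moreover have "(\<tau> ^^ (m * Suc (Suc k))) z = (\<tau> ^^ (m * Suc k)) ((\<tau> ^^ m) z)"
        by (metis add.commute comp_apply funpow_add mult_Suc_right)
      ultimately show False using nz[of z "(\<tau> ^^ m) z" "m * Suc k"] Suc that by auto
    qed
  qed (use that in simp)
  define m where "m = (u + v) / 2"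
  have m: "u < m" "m < v" using uv by (auto simp: m_def)
  obtain n x where nx: "x \<in> {m<..<v}" "(\<tau> ^^ n) x \<in> {u<..<m}"
    using trans_interval[of m v u m] uv m by auto
  have x01: "x \<in> {0..1}" using nx uv m by auto
  have ict: "continuous_on {0..1} (\<tau> ^^ n)" by (rule iter_cont)
  then obtain d where d: "d > 0" "\<And>w. w \<in> {0..1} \<Longrightarrow> dist w x < d \<Longrightarrow> dist ((\<tau> ^^ n) w) ((\<tau> ^^ n) x) < min ((\<tau> ^^ n) x - u) (m - (\<tau> ^^ n) x)"
    using x01 nx unfolding continuous_on_iff by (metis diff_gt_0_iff_gt greaterThanLessThan_iff min_less_iff_conj)
  define q where "q = min v (x + d)"
  have q: "x < q" "q \<le> v" using nx d by (auto simp: q_def)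
  have in_um: "(\<tau> ^^ n) w \<in> {u<..<m}" if "w \<in> {x<..<q}" for w
    using d(2)[of w] that nx uv m by (auto simp: q_def dist_real_def abs_less_iff)
  \<comment> \<open>The image of a short interval to the right of \<open>x\<close> contains an
    interval to the left of \<open>m\<close>. Transitivity finds in it a point \<open>y\<close> that
    travels to the right of \<open>m\<close>, and \<open>y\<close> is itself the image of some
    \<open>z\<close> that was carried left.\<close>
  obtain a b where ab: "a < b" "{a..b} \<subseteq> (\<tau> ^^ n) ` {x<..<q}"
    using iter_image_interval[of x q n] q x01 uv by auto
  have ab01: "{a..b} \<subseteq> {u<..<m}" using ab in_um by blast
  have "a \<in> {u<..<m}" "b \<in> {u<..<m}" by (rule subsetD[OF ab01], use ab in simp)+
  then have "0 \<le> a" "b \<le> 1" using uv m by auto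
  then obtain n' y where y: "y \<in> {a<..<b}" "(\<tau> ^^ n') y \<in> {m<..<v}"
    using trans_interval[of a b m v] ab uv m by auto
  obtain z where z: "z \<in> {x<..<q}" "y = (\<tau> ^^ n) z" using ab y by (metis atLeastAtMost_iff greaterThanLessThan_iff image_iff less_imp_le subsetD)
  have zy: "z \<in> {u<..<v}" "y \<in> {u<..<v}" "y < z" "y < m" "m < z"
    using z q nx y ab01 m in_um[OF z(1)] by auto
  have n1: "n \<ge> 1" using z zy by (cases n) auto
  have n'1: "n' \<ge> 1" using y zy by (cases n') auto
  have eq: "n * Suc (n' - 1) = n * n'" "n' * Suc (n - 1) = n * n'" using n1 n'1 by (auto simp: mult.commute)
  have "(\<tau> ^^ (n * Suc (n' - 1))) z < z"
    by (rule left) (use zy z n1 in auto)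
  then have 1: "(\<tau> ^^ (n * n')) z - z \<le> 0" unfolding eq by simp
  have "y < (\<tau> ^^ (n' * Suc (n - 1))) y"
    by (rule right) (use zy y n'1 m in auto)
  then have 2: "0 \<le> (\<tau> ^^ (n * n')) y - y" unfolding eq by simp
  have "1 \<le> n * n'" using n1 n'1 by simp
  then show False using nz[OF zy(1,2) 1 2] by blast
qed

text \<open>Inside a lap the map is strictly monotonic and therefore open; at a turning point it
  folds, hence the exclusion of partition points.\<close>

lemma local_open:
  assumes x: "x \<in> {0..1}" "x \<notin> set as" and e: "\<epsilon> > 0"
  shows "\<exists>\<eta>>0. {\<tau> x - \<eta><..<\<tau> x + \<eta>} \<subseteq> \<tau> ` ({x - \<epsilon><..<x + \<epsilon>} \<inter> {0..1})"
proof -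
  have "x \<noteq> 1" using x set_as by auto
  then obtain i where i: "Suc i < length as" "as ! i \<le> x" "x < as ! Suc i"
    using locate_right[of x] x by auto
  have lt: "as ! i < x" using i x by (metis Suc_lessD le_less nth_mem)
  define a where "a = max (as ! i) (x - \<epsilon>/2)"
  define b where "b = min (as ! Suc i) (x + \<epsilon>/2)"
  have ab: "a < x" "x < b" using lt i e by (auto simp: a_def b_def)
  have lp: "a \<in> lap i" "x \<in> lap i" "b \<in> lap i" "{a..b} \<subseteq> lap i"
    using lt i e by (auto simp: a_def b_def lap_def)
  have "{a..b} \<subseteq> {x - \<epsilon><..<x + \<epsilon>}" using e by (auto simp: a_def b_def)
  then have s: "{a..b} \<subseteq> {x - \<epsilon><..<x + \<epsilon>} \<inter> {0..1}"
    using lap_subset[OF i(1)] lp(4) by blast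
  have m: "dirs i * \<tau> a < dirs i * \<tau> x" "dirs i * \<tau> x < dirs i * \<tau> b"
    using mono_lap_less[OF i(1)] lp ab by auto
  define \<eta> where "\<eta> = min \<bar>\<tau> a - \<tau> x\<bar> \<bar>\<tau> b - \<tau> x\<bar>"
  have "\<eta> > 0" using m by (auto simp: \<eta>_def)
  have "connected (\<tau> ` {a..b})"
    using s by (intro connected_continuous_image continuous_on_subset[OF cont]) auto
  moreover have "\<tau> a \<in> \<tau> ` {a..b}" "\<tau> b \<in> \<tau> ` {a..b}" using ab by simp_all
  ultimately have "{\<tau> a..\<tau> b} \<subseteq> \<tau> ` {a..b}" "{\<tau> b..\<tau> a} \<subseteq> \<tau> ` {a..b}"
    using connected_contains_Icc by metis+
  moreover have "{\<tau> x - \<eta><..<\<tau> x + \<eta>} \<subseteq> {\<tau> a..\<tau> b} \<or> {\<tau> x - \<eta><..<\<tau> x + \<eta>} \<subseteq> {\<tau> b..\<tau> a}"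
    using m dirs_cases[of i] by (auto simp: \<eta>_def)
  ultimately show ?thesis using \<open>\<eta> > 0\<close> s by (meson image_mono order_trans)
qed

lemma local_open_iter:
  assumes q: "q \<in> {0..1}" and e: "\<epsilon> > 0"
  shows "(\<And>j. j < n \<Longrightarrow> (\<tau> ^^ j) q \<notin> set as) \<Longrightarrow> 
    \<exists>\<eta>>0. {(\<tau> ^^ n) q - \<eta><..<(\<tau> ^^ n) q + \<eta>} \<inter> {0..1} \<subseteq> (\<tau> ^^ n) ` ({q - \<epsilon><..<q + \<epsilon>} \<inter> {0..1})"
proof (induction n)
  case 0 then show ?case using e by (intro exI[of _ \<epsilon>]) auto
next
  case (Suc n)
  then obtain \<eta> where h: "\<eta> > 0" "{(\<tau> ^^ n) q - \<eta><..<(\<tau> ^^ n) q + \<eta>} \<inter> {0..1} \<subseteq> (\<tau> ^^ n) ` ({q - \<epsilon><..<q + \<epsilon>} \<inter> {0..1})"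
    by (meson less_SucI)
  obtain \<eta>' where h': "\<eta>' > 0" "{\<tau> ((\<tau> ^^ n) q) - \<eta>'<..<\<tau> ((\<tau> ^^ n) q) + \<eta>'} \<subseteq> \<tau> ` ({(\<tau> ^^ n) q - \<eta><..<(\<tau> ^^ n) q + \<eta>} \<inter> {0..1})"
    using local_open[OF iter_maps[OF q] Suc.prems[of n] h(1)] by auto
  have "\<tau> ` ({(\<tau> ^^ n) q - \<eta><..<(\<tau> ^^ n) q + \<eta>} \<inter> {0..1}) \<subseteq> \<tau> ` (\<tau> ^^ n) ` ({q - \<epsilon><..<q + \<epsilon>} \<inter> {0..1})"
    using h by (intro image_mono)
  then have "{\<tau> ((\<tau> ^^ n) q) - \<eta>'<..<\<tau> ((\<tau> ^^ n) q) + \<eta>'} \<subseteq> (\<tau> ^^ Suc n) ` ({q - \<epsilon><..<q + \<epsilon>} \<inter> {0..1})"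
    using h'(2) by (simp add: image_comp)
  then show ?case using h'(1) by (intro exI[of _ \<eta>']) auto
qed

text \<open>An orbit that contains a periodic point is finite, so each of the finitely many
  partition points reaches only finitely many periodic points, while these are dense.\<close>

lemma periodic_off_partition_orbits:
  obtains p k where "0 < p" "p < 1" "p \<noteq> c" "k \<ge> 1" "(\<tau> ^^ k) p = p" "\<And>n a. a \<in> set as \<Longrightarrow> (\<tau> ^^ n) a \<noteq> p"
proof -
  define P where "P = {x \<in> {0<..<1}. \<exists>k\<ge>1. (\<tau> ^^ k) x = x}"
  have fin: "finite (P \<inter> range (\<lambda>n. (\<tau> ^^ n) a))" for a
  proof (cases "P \<inter> range (\<lambda>n. (\<tau> ^^ n) a) = {}")
    case False
    then obtain i k where ik: "k \<ge> 1" "(\<tau> ^^ k) ((\<tau> ^^ i) a) = (\<tau> ^^ i) a" by (auto simp: P_def)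
    have "(\<tau> ^^ n) a \<in> (\<lambda>n. (\<tau> ^^ n) a) ` {..<i + k}" for n
    proof (cases "n < i")
      case False
      then have n: "n = (n - i) + i" by simp
      have "(\<tau> ^^ n) a = (\<tau> ^^ (n - i)) ((\<tau> ^^ i) a)" by (subst n) (simp add: funpow_add del: le_add_diff_inverse2)
      also have "\<dots> = (\<tau> ^^ ((n - i) mod k)) ((\<tau> ^^ i) a)" using funpow_mod_eq[OF ik(2)] by simp
      also have "\<dots> = (\<tau> ^^ ((n - i) mod k + i)) a" by (simp add: funpow_add)
      finally show ?thesis using ik(1) by (intro image_eqI[of _ _ "(n - i) mod k + i"]) auto
    qed auto
    then have "range (\<lambda>n. (\<tau> ^^ n) a) \<subseteq> (\<lambda>n. (\<tau> ^^ n) a) ` {..<i + k}" by blast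
    then show ?thesis by (meson finite_Int finite_imageI finite_lessThan finite_subset)
  qed simp
  define F where "F = insert c (\<Union>a\<in>set as. P \<inter> range (\<lambda>n. (\<tau> ^^ n) a))"
  have "finite F" unfolding F_def using fin by (intro finite.insertI finite_UN_I) auto
  then obtain u v where uv: "0 \<le> u" "u < v" "v \<le> 1" "{u<..<v} \<inter> F = {}"
    using interval_avoiding_finite[of F 0 1] by auto
  then obtain p k where pk: "p \<in> {u<..<v}" "k \<ge> 1" "(\<tau> ^^ k) p = p" using periodic_dense by blast
  then have "p \<notin> F" "p \<in> P" using uv by (auto simp: P_def)
  then show ?thesis using that[of p k] pk uv by (auto simp: F_def)
qed

text \<open>Let \<open>p\<close> be periodic with \<open>p\<close> off all orbits of partition
  points. The images of an arbitrarily small neighbourhood of \<open>p\<close> all contain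
  \<open>p\<close> and extend to one fixed \<open>r \<noteq> p\<close>. As \<open>p\<close> can be
  reached openly from every subinterval, each subinterval of the segment from \<open>p\<close> to
  \<open>r\<close> eventually covers the whole segment.\<close>

lemma horseshoe:
  obtains a b M B1 B2 where "0 \<le> a" "a < b" "b \<le> 1" "M \<ge> 1" "B1 \<subseteq> {a..b}" "B2 \<subseteq> {a..b}" "B1 \<inter> B2 = {}"
    "{a..b} \<subseteq> (\<tau> ^^ M) ` B1" "{a..b} \<subseteq> (\<tau> ^^ M) ` B2"
proof -
  obtain c where c: "0 < c" "c < 1" "\<tau> c = c" by (rule fixed_interior)
  obtain p k where p: "0 < p" "p < 1" "p \<noteq> c" and k: "k \<ge> 1" "(\<tau> ^^ k) p = p"
    and good: "\<And>n a. a \<in> set as \<Longrightarrow> (\<tau> ^^ n) a \<noteq> p" by (rule periodic_off_partition_orbits[of c]) blast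
  define W where "W = (\<lambda>\<epsilon>. {p - \<epsilon><..<p + \<epsilon>} \<inter> {0..1})"
  define K where "K = (\<lambda>\<epsilon>. \<Union>n. (\<tau> ^^ (k * n)) ` W \<epsilon>)"
  have W01: "W \<epsilon> \<subseteq> {0..1}" for \<epsilon> by (auto simp: W_def)
  have pW: "p \<in> W \<epsilon>" if "\<epsilon> > 0" for \<epsilon> using that p by (auto simp: W_def)
  have kn: "(\<tau> ^^ (k * n)) p = p" for n
    by (induction n) (auto simp: funpow_add k)
  have pK: "p \<in> (\<tau> ^^ (k * n)) ` W \<epsilon>" if "\<epsilon> > 0" for n \<epsilon>
    using kn[of n] pW[OF that] by (metis image_eqI)
  have conW: "connected ((\<tau> ^^ n) ` W \<epsilon>)" for n \<epsilon>
    by (rule connected_continuous_image[OF continuous_on_subset[OF iter_cont W01]])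
       (auto simp: W_def intro!: convex_connected convex_Int)
  have Kmono: "K \<epsilon> \<subseteq> K \<epsilon>'" if "\<epsilon> \<le> \<epsilon>'" for \<epsilon> \<epsilon>'
    using that unfolding K_def W_def by (intro UN_mono image_mono) auto
  have K01: "K \<epsilon> \<subseteq> {0..1}" for \<epsilon> using iter_image_subset[OF W01] by (auto simp: K_def)
  have Kcon: "{x..p} \<subseteq> K \<epsilon> \<and> {p..x} \<subseteq> K \<epsilon>" if x: "x \<in> K \<epsilon>" "\<epsilon> > 0" for x \<epsilon>
  proof -
    obtain n where "x \<in> (\<tau> ^^ (k * n)) ` W \<epsilon>" using x(1) unfolding K_def by blast
    then have "{x..p} \<subseteq> (\<tau> ^^ (k * n)) ` W \<epsilon>" "{p..x} \<subseteq> (\<tau> ^^ (k * n)) ` W \<epsilon>"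
      using connected_contains_Icc[OF conW] pK[OF x(2)] by blast+
    then show ?thesis by (auto simp: K_def)
  qed
  \<comment> \<open>Some \<open>y0\<close> off the orbit of \<open>p\<close> is hit from every
    neighbourhood of \<open>p\<close>. The last \<open>n mod k\<close> iterates cannot reach
    \<open>y0\<close> from within distance \<open>\<delta>\<close> of \<open>p\<close>, so the
    preceding multiple of \<open>k\<close> must already have left that ball. Hence the sets
    \<open>K \<epsilon>\<close> do not shrink to \<open>p\<close>.\<close>
  obtain \<delta> where \<delta>: "\<delta> > 0" "\<And>\<epsilon>. \<epsilon> > 0 \<Longrightarrow> \<exists>y\<in>K \<epsilon>. \<bar>y - p\<bar> \<ge> \<delta>"
  proof -
    have "finite (insert c ((\<lambda>j. (\<tau> ^^ j) p) ` {..<k}))" by simp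
    then obtain u v where uv: "0 \<le> u" "u < v" "v \<le> 1" "{u<..<v} \<inter> insert c ((\<lambda>j. (\<tau> ^^ j) p) ` {..<k}) = {}"
      by (rule interval_avoiding_finite[of _ 0 1]) auto
    obtain y0 where y0: "u < y0" "y0 < v" using uv dense by blast
    have y0': "0 < y0" "y0 < 1" "y0 \<noteq> c" "\<And>j. j < k \<Longrightarrow> (\<tau> ^^ j) p \<noteq> y0" using y0 uv by auto
    have "\<exists>d>0. \<forall>x\<in>{0..1}. dist x p < d \<longrightarrow> (\<tau> ^^ j) x \<noteq> y0" if "j < k" for j
    proof -
      have "continuous_on {0..1} (\<tau> ^^ j)" by (rule iter_cont)
      moreover have "dist y0 ((\<tau> ^^ j) p) > 0" using y0'(4)[OF that] by auto
      ultimately obtain d where "d > 0" "\<forall>x\<in>{0..1}. dist x p < d \<longrightarrow> dist ((\<tau> ^^ j) x) ((\<tau> ^^ j) p) < dist y0 ((\<tau> ^^ j) p)"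
        using p unfolding continuous_on_iff by (metis atLeastAtMost_iff less_imp_le)
      then show ?thesis by (intro exI[of _ d]) auto
    qed
    then obtain d where d: "\<And>j. j < k \<Longrightarrow> d j > 0" "\<And>j x. j < k \<Longrightarrow> x \<in> {0..1} \<Longrightarrow> dist x p < d j \<Longrightarrow> (\<tau> ^^ j) x \<noteq> y0"
      by metis
    define \<delta> where "\<delta> = Min (d ` {..<k})"
    have ne: "d ` {..<k} \<noteq> {}" "finite (d ` {..<k})" using k(1) by (auto simp: lessThan_empty_iff)
    have "\<delta> > 0" unfolding \<delta>_def using d(1) ne by (subst Min_gr_iff) auto
    moreover have "\<exists>y\<in>K \<epsilon>. \<bar>y - p\<bar> \<ge> \<delta>" if e: "\<epsilon> > 0" for \<epsilon>
    proof (rule ccontr)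
      assume "\<not> (\<exists>y\<in>K \<epsilon>. \<bar>y - p\<bar> \<ge> \<delta>)"
      then have close: "dist y p < \<delta>" if "y \<in> K \<epsilon>" for y using that by (auto simp: dist_real_def)
      obtain n x where nx: "x \<in> {max 0 (p - \<epsilon>)<..<min 1 (p + \<epsilon>)}" "(\<tau> ^^ n) x = y0"
        using orbit_cover[of "max 0 (p - \<epsilon>)" "min 1 (p + \<epsilon>)" c y0] p e c y0' by auto
      have xW: "x \<in> W \<epsilon>" using nx by (auto simp: W_def)
      have eq: "y0 = (\<tau> ^^ (n mod k)) ((\<tau> ^^ (k * (n div k))) x)" using nx funpow_mod_div by metis
      have inK: "(\<tau> ^^ (k * (n div k))) x \<in> K \<epsilon>" using xW unfolding K_def by blast
      have "n mod k < k" using k by simp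
      moreover then have "\<delta> \<le> d (n mod k)" unfolding \<delta>_def using ne by (intro Min_le) auto
      ultimately show False using d(2)[of "n mod k"] close[OF inK] K01 inK eq by fastforce
    qed
    ultimately show ?thesis using that by blast
  qed
  \<comment> \<open>Each \<open>K \<epsilon>\<close> contains \<open>p + \<delta>\<close> or
    \<open>p - \<delta>\<close>. If the first fails for one \<open>\<epsilon>1\<close>, it fails for
    all smaller radii, so the second holds for these and by monotonicity for all.\<close>
  obtain r where r: "r \<noteq> p" "\<And>\<epsilon>. \<epsilon> > 0 \<Longrightarrow> r \<in> K \<epsilon>"
  proof (cases "\<forall>\<epsilon>>0. p + \<delta> \<in> K \<epsilon>")
    case True then show ?thesis using that[of "p + \<delta>"] \<delta> by auto
  next
    case False
    then obtain \<epsilon>1 where e1: "\<epsilon>1 > 0" "p + \<delta> \<notin> K \<epsilon>1" by blast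
    have "p - \<delta> \<in> K \<epsilon>" if e: "\<epsilon> > 0" for \<epsilon>
    proof -
      let ?e = "min \<epsilon> \<epsilon>1"
      have e0: "?e > 0" using e e1 by auto
      obtain y where y: "y \<in> K ?e" "\<bar>y - p\<bar> \<ge> \<delta>" using \<delta>(2)[OF e0] by blast
      have n: "p + \<delta> \<notin> K ?e" using e1 Kmono[of ?e \<epsilon>1] by auto
      have "\<not> y \<ge> p + \<delta>"
      proof
        assume "y \<ge> p + \<delta>"
        then have "p + \<delta> \<in> {p..y}" using \<delta> by auto
        then show False using Kcon[OF y(1) e0] n by blast
      qed
      then have "p - \<delta> \<in> {y..p}" using y \<delta> by auto
      then have "p - \<delta> \<in> K ?e" using Kcon[OF y(1) e0] by blast
      then show ?thesis using Kmono[of ?e \<epsilon>] by auto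
    qed
    then show ?thesis using that[of "p - \<delta>"] \<delta> by auto
  qed
  have r01: "r \<in> {0..1}" by (rule subsetD[OF K01[of 1] r(2)]) simp
  define a where "a = min p r"
  define b where "b = max p r"
  have ab: "0 \<le> a" "a < b" "b \<le> 1" using r r01 p by (auto simp: a_def b_def)
  have coverW: "\<exists>n. {a..b} \<subseteq> (\<tau> ^^ n) ` W \<epsilon>" if e: "\<epsilon> > 0" for \<epsilon>
  proof -
    obtain n where "r \<in> (\<tau> ^^ (k * n)) ` W \<epsilon>" using r(2)[OF e] unfolding K_def by blast
    then have "{r..p} \<subseteq> (\<tau> ^^ (k * n)) ` W \<epsilon>" "{p..r} \<subseteq> (\<tau> ^^ (k * n)) ` W \<epsilon>"
      using connected_contains_Icc[OF conW] pK[OF e] by blast+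
    then show ?thesis by (intro exI[of _ "k * n"]) (auto simp: a_def b_def min_def max_def split: if_splits)
  qed
  \<comment> \<open>The path from \<open>q\<close> to \<open>p\<close> meets no partition point,
    since no orbit of such a point hits \<open>p\<close>. So a neighbourhood of \<open>p\<close> is
    covered by an image of the interval around \<open>q\<close>, and it grows further to cover
    \<open>{a..b}\<close>.\<close>
  have cover: "\<exists>n. {a..b} \<subseteq> (\<tau> ^^ n) ` {u<..<v}" if uv: "a \<le> u" "u < v" "v \<le> b" for u v
  proof -
    obtain N q where q: "q \<in> {u<..<v}" "(\<tau> ^^ N) q = p"
      using orbit_cover[of u v c p] uv ab c p by auto
    define e where "e = min (q - u) (v - q)"
    have e: "e > 0" using q by (auto simp: e_def)
    have q01: "q \<in> {0..1}" using q uv ab by auto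
    have ng: "(\<tau> ^^ j) q \<notin> set as" if "j < N" for j
    proof
      assume s: "(\<tau> ^^ j) q \<in> set as"
      have "N = (N - j) + j" using that by simp
      then have "(\<tau> ^^ (N - j)) ((\<tau> ^^ j) q) = p" using q(2) by (metis comp_apply funpow_add)
      then show False using good[OF s] by blast
    qed
    obtain \<eta> where h: "\<eta> > 0" "{p - \<eta><..<p + \<eta>} \<inter> {0..1} \<subseteq> (\<tau> ^^ N) ` ({q - e<..<q + e} \<inter> {0..1})"
      using local_open_iter[OF q01 e, of N] ng q(2) by auto
    have "{q - e<..<q + e} \<inter> {0..1} \<subseteq> {u<..<v}" by (auto simp: e_def)
    then have h2: "W \<eta> \<subseteq> (\<tau> ^^ N) ` {u<..<v}" using h(2) unfolding W_def by blast
    obtain n where "{a..b} \<subseteq> (\<tau> ^^ n) ` W \<eta>" using coverW[OF h(1)] by blast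
    also have "\<dots> \<subseteq> (\<tau> ^^ n) ` (\<tau> ^^ N) ` {u<..<v}" using h2 by (rule image_mono)
    also have "\<dots> = (\<tau> ^^ (n + N)) ` {u<..<v}" by (simp add: funpow_add image_comp)
    finally show ?thesis by blast
  qed
  define m where "m = (a + b) / 2"
  have m: "a < m" "m < b" using ab by (auto simp: m_def)
  obtain n1 where n1: "{a..b} \<subseteq> (\<tau> ^^ n1) ` {a<..<m}" using cover[of a m] m by auto
  obtain n2 where n2: "{a..b} \<subseteq> (\<tau> ^^ n2) ` {m<..<b}" using cover[of m b] m by auto
  \<comment> \<open>One branch goes from the left half through the right half, the other the
    opposite way; taking the detour in both orders makes the two covering times equal to
    \<open>n1 + n2\<close>.\<close>
  define B1 where "B1 = {x\<in>{a<..<m}. (\<tau> ^^ n1) x \<in> {m<..<b}}"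
  define B2 where "B2 = {x\<in>{m<..<b}. (\<tau> ^^ n2) x \<in> {a<..<m}}"
  have c1: "{a..b} \<subseteq> (\<tau> ^^ (n1 + n2)) ` B1"
  proof
    fix y assume "y \<in> {a..b}"
    then obtain w where w: "w \<in> {m<..<b}" "y = (\<tau> ^^ n2) w" using n2 by blast
    then have "w \<in> {a..b}" using m by auto
    then obtain x where x: "x \<in> {a<..<m}" "w = (\<tau> ^^ n1) x" using n1 by blast
    then have "y = (\<tau> ^^ (n1 + n2)) x" using w by (simp add: add.commute[of n1] funpow_add)
    then show "y \<in> (\<tau> ^^ (n1 + n2)) ` B1" using x w by (auto simp: B1_def)
  qed
  have c2: "{a..b} \<subseteq> (\<tau> ^^ (n1 + n2)) ` B2"
  proof
    fix y assume "y \<in> {a..b}"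
    then obtain w where w: "w \<in> {a<..<m}" "y = (\<tau> ^^ n1) w" using n1 by blast
    then have "w \<in> {a..b}" using m by auto
    then obtain x where x: "x \<in> {m<..<b}" "w = (\<tau> ^^ n2) x" using n2 by blast
    then have "y = (\<tau> ^^ (n1 + n2)) x" using w by (simp add: funpow_add)
    then show "y \<in> (\<tau> ^^ (n1 + n2)) ` B2" using x w by (auto simp: B2_def)
  qed
  have "n1 + n2 \<noteq> 0"
  proof
    assume "n1 + n2 = 0"
    then have "a \<in> B1" using c1 ab by auto
    then show False by (auto simp: B1_def)
  qed
  then have "1 \<le> n1 + n2" by linarith
  moreover have "B1 \<subseteq> {a..b}" "B2 \<subseteq> {a..b}" "B1 \<inter> B2 = {}" using m by (auto simp: B1_def B2_def)
  ultimately show ?thesis using that[of a b "n1 + n2" B1 B2] ab c1 c2 by blast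
qed

lemma finite_fiber: "finite {x\<in>{0..1}. \<tau> x = y}"
proof -
  define A where "A = (\<Union>i\<in>{i. Suc i < length as}. \<tau> -` {y} \<inter> lap i)"
  have "finite {i. Suc i < length as}" by (rule finite_subset[of _ "{..<length as}"]) auto
  moreover have "finite (\<tau> -` {y} \<inter> lap i)" if "i \<in> {i. Suc i < length as}" for i
    using mono_sgn_inj_on[OF mono_lap[of i]] that by (intro finite_vimage_IntI) auto
  ultimately have "finite A" unfolding A_def by (rule finite_UN_I)
  moreover have "{x\<in>{0..1}. \<tau> x = y} \<subseteq> A"
  proof
    fix x assume x: "x \<in> {x\<in>{0..1}. \<tau> x = y}"
    then obtain i where "Suc i < length as" "x \<in> lap i" using locate[of x] by auto
    then show "x \<in> A" using x unfolding A_def by blast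
  qed
  ultimately show ?thesis by (rule finite_subset[rotated])
qed

lemma finite_fiber_iter: "finite {x\<in>{0..1}. (\<tau> ^^ n) x = y}"
proof (induction n arbitrary: y)
  case 0 show ?case by (rule finite_subset[of _ "{y}"]) auto
next
  case (Suc n)
  have "{x\<in>{0..1}. (\<tau> ^^ Suc n) x = y} \<subseteq> (\<Union>w\<in>{w\<in>{0..1}. \<tau> w = y}. {x\<in>{0..1}. (\<tau> ^^ n) x = w})"
    using iter_maps by auto
  then show ?case by (rule finite_subset) (use Suc finite_fiber in auto)
qed

text \<open>Each preimage in \<open>{a..b}\<close> has one preimage in \<open>B1\<close> and another
  in \<open>B2\<close>, so every block of \<open>M\<close> steps doubles the count.\<close>

lemma exponential_growth:
  obtains a b M where "0 \<le> a" "a < b" "b \<le> 1" "M \<ge> 1"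
    "\<And>y k. y \<in> {a..b} \<Longrightarrow> 2 ^ k \<le> card {x\<in>{0..1}. (\<tau> ^^ (M * k)) x = y}"
proof -
  obtain a b M B1 B2 where H: "0 \<le> a" "a < b" "b \<le> 1" "M \<ge> 1" "B1 \<subseteq> {a..b}" "B2 \<subseteq> {a..b}" "B1 \<inter> B2 = {}"
    "{a..b} \<subseteq> (\<tau> ^^ M) ` B1" "{a..b} \<subseteq> (\<tau> ^^ M) ` B2" by (rule horseshoe)
  have ab01: "{a..b} \<subseteq> {0..1}" using H by auto
  have fin: "finite {x\<in>{a..b}. (\<tau> ^^ n) x = y}" for n y
    by (rule finite_subset[OF _ finite_fiber_iter[of n y]]) (use ab01 in blast)
  have B: "2 ^ k \<le> card {x\<in>{a..b}. (\<tau> ^^ (M * k)) x = y}" if "y \<in> {a..b}" for y k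
  proof (induction k)
    case 0
    have "{x\<in>{a..b}. (\<tau> ^^ (M * 0)) x = y} = {y}" using that by auto
    then show ?case by simp
  next
    case (Suc k)
    let ?S = "{x\<in>{a..b}. (\<tau> ^^ (M * k)) x = y}"
    have "\<forall>w\<in>?S. \<exists>x\<in>B1. (\<tau> ^^ M) x = w" "\<forall>w\<in>?S. \<exists>x\<in>B2. (\<tau> ^^ M) x = w"
      using H(8,9) by blast+
    then obtain f1 f2 where f: "\<And>w. w \<in> ?S \<Longrightarrow> f1 w \<in> B1 \<and> (\<tau> ^^ M) (f1 w) = w"
      "\<And>w. w \<in> ?S \<Longrightarrow> f2 w \<in> B2 \<and> (\<tau> ^^ M) (f2 w) = w" by metis
    have i1: "inj_on f1 ?S" by (rule inj_on_inverseI[where g="\<tau> ^^ M"]) (use f(1) in blast)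
    have i2: "inj_on f2 ?S" by (rule inj_on_inverseI[where g="\<tau> ^^ M"]) (use f(2) in blast)
    have "2 ^ Suc k \<le> card ?S + card ?S" using Suc by simp
    also have "\<dots> = card (f1 ` ?S) + card (f2 ` ?S)" using i1 i2 by (simp add: card_image)
    also have "\<dots> = card (f1 ` ?S \<union> f2 ` ?S)"
    proof (rule card_Un_disjoint[symmetric])
      have "f1 ` ?S \<subseteq> B1" "f2 ` ?S \<subseteq> B2" using f by blast+
      then show "f1 ` ?S \<inter> f2 ` ?S = {}" using H(7) by blast
    qed (rule finite_imageI[OF fin])+
    also have "\<dots> \<le> card {x\<in>{a..b}. (\<tau> ^^ (M * Suc k)) x = y}"
    proof (rule card_mono[OF fin])
      have eq: "(\<tau> ^^ (M * Suc k)) x = (\<tau> ^^ (M * k)) ((\<tau> ^^ M) x)" for x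
        by (metis add.commute comp_apply funpow_add mult_Suc_right)
      show "f1 ` ?S \<union> f2 ` ?S \<subseteq> {x\<in>{a..b}. (\<tau> ^^ (M * Suc k)) x = y}"
      proof
        fix z assume "z \<in> f1 ` ?S \<union> f2 ` ?S"
        then obtain w where w: "w \<in> ?S" "z = f1 w \<or> z = f2 w" by blast
        then have "z \<in> {a..b}" "(\<tau> ^^ M) z = w" using f[OF w(1)] H(5,6) by blast+
        then show "z \<in> {x\<in>{a..b}. (\<tau> ^^ (M * Suc k)) x = y}" using w(1) unfolding eq by simp
      qed
    qed
    finally show ?case .
  qed
  show ?thesis
  proof (rule that[OF H(1-4)])
    fix y k assume "y \<in> {a..b}"
    then have "2 ^ k \<le> card {x\<in>{a..b}. (\<tau> ^^ (M * k)) x = y}" by (rule B)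
    also have "\<dots> \<le> card {x\<in>{0..1}. (\<tau> ^^ (M * k)) x = y}"
      by (rule card_mono[OF finite_fiber_iter]) (use ab01 in blast)
    finally show "2 ^ k \<le> card {x\<in>{0..1}. (\<tau> ^^ (M * k)) x = y}" .
  qed
qed

text \<open>With a single lap all iterates would be injective, which contradicts the two disjoint
  branches of the horseshoe.\<close>

lemma three_points: "3 \<le> length as"
proof (rule ccontr)
  assume "\<not> 3 \<le> length as"
  then have l: "length as = 2" using as_len by simp
  have "lap 0 = {0..1}" using as_0 as_end l by (simp add: lap_def)
  then have inj: "inj_on \<tau> {0..1}" using mono_sgn_inj_on[OF mono_lap[of 0]] l by simp
  have injn: "inj_on (\<tau> ^^ n) {0..1}" for n
  proof (induction n)
    case (Suc n)
    have "inj_on (\<tau> \<circ> (\<tau> ^^ n)) {0..1}"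
      by (rule comp_inj_on[OF Suc inj_on_subset[OF inj]]) (use iter_maps in blast)
    then show ?case by (simp add: comp_def)
  qed simp
  obtain a b M B1 B2 where H: "0 \<le> a" "a < b" "b \<le> 1" "M \<ge> 1" "B1 \<subseteq> {a..b}" "B2 \<subseteq> {a..b}" "B1 \<inter> B2 = {}"
    "{a..b} \<subseteq> (\<tau> ^^ M) ` B1" "{a..b} \<subseteq> (\<tau> ^^ M) ` B2" by (rule horseshoe)
  have "a \<in> {a..b}" using H(2) by simp
  then obtain x1 x2 where x: "x1 \<in> B1" "a = (\<tau> ^^ M) x1" "x2 \<in> B2" "a = (\<tau> ^^ M) x2"
    using H(8,9) by blast
  have "{a..b} \<subseteq> {0..1}" using H(1,3) by simp
  then have "x1 \<in> {0..1}" "x2 \<in> {0..1}" using x H(5,6) by blast+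
  moreover have "(\<tau> ^^ M) x1 = (\<tau> ^^ M) x2" using x(2,4) by (rule subst)
  ultimately have "x1 = x2" using inj_onD[OF injn] by blast
  then show False using H(7) x by blast
qed

text \<open>The image is closed, so a missing point leaves a gap. Transitivity is applied to the two
  halves of the gap because time 0 must be excluded.\<close>

lemma surj: "\<tau> ` {0..1} = {0..1}"
proof (rule ccontr)
  assume ne: "\<tau> ` {0..1} \<noteq> {0..1}"
  have "\<tau> ` {0..1} \<subseteq> {0..1}" using maps by blast
  then obtain y where y: "y \<in> {0..1}" "y \<notin> \<tau> ` {0..1}" using ne by blast
  have "closed (\<tau> ` {0..1})" by (intro compact_imp_closed compact_continuous_image cont) simp
  then obtain e where e: "e > 0" "ball y e \<inter> \<tau> ` {0..1} = {}"
    using y by (metis Compl_iff disjoint_eq_subset_Compl inf_commute open_Compl open_contains_ball)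
  have e': "z \<notin> \<tau> ` {0..1}" if "\<bar>z - y\<bar> < e" for z
    using e that by (auto simp: dist_real_def abs_minus_commute disjoint_iff)
  define u where "u = max 0 (y - e)"
  define v where "v = min 1 (y + e)"
  define m where "m = (u + v) / 2"
  have uv: "0 \<le> u" "u < m" "m < v" "v \<le> 1" using y e by (auto simp: u_def v_def m_def)
  obtain n x where nx: "x \<in> {u<..<m}" "(\<tau> ^^ n) x \<in> {m<..<v}"
    using trans_interval[of u m m v] uv by auto
  have "n \<noteq> 0" using nx by (auto intro: ccontr)
  then obtain k where "n = Suc k" by (cases n) auto
  then have "(\<tau> ^^ n) x \<in> \<tau> ` {0..1}" using iter_maps[of x k] nx uv by auto
  moreover have "\<bar>(\<tau> ^^ n) x - y\<bar> < e" using nx uv by (auto simp: u_def v_def)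
  ultimately show False using e' by blast
qed

section \<open>Generalized orbits and the set \<open>I1\<close>\<close>

lemma generalized_orbit_subset: "x \<in> {0..1} \<Longrightarrow> generalized_orbit \<tau> x \<subseteq> {0..1}"
  unfolding generalized_orbit_def using maps by (intro Inter_lower) force

lemma generalized_orbit_self: "x \<in> generalized_orbit \<tau> x"
  by (auto simp: generalized_orbit_def)

lemma generalized_orbit_iff:
  assumes "y \<in> {0..1}"
  shows "\<tau> y \<in> generalized_orbit \<tau> x \<longleftrightarrow> y \<in> generalized_orbit \<tau> x"
proof
  assume *: "\<tau> y \<in> generalized_orbit \<tau> x"
  show "y \<in> generalized_orbit \<tau> x" unfolding generalized_orbit_def
  proof (rule InterI)
    fix A assume A: "A \<in> {A. A \<subseteq> {0..1} \<and> x \<in> A \<and> \<tau> ` A \<subseteq> A \<and> {y \<in> {0..1}. \<tau> y \<in> A} \<subseteq> A}"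
    then have "\<tau> y \<in> A" using * unfolding generalized_orbit_def by (rule InterD[rotated])
    then show "y \<in> A" using A assms by blast
  qed
next
  assume *: "y \<in> generalized_orbit \<tau> x"
  show "\<tau> y \<in> generalized_orbit \<tau> x" unfolding generalized_orbit_def
  proof (rule InterI)
    fix A assume A: "A \<in> {A. A \<subseteq> {0..1} \<and> x \<in> A \<and> \<tau> ` A \<subseteq> A \<and> {y \<in> {0..1}. \<tau> y \<in> A} \<subseteq> A}"
    then have "y \<in> A" using * unfolding generalized_orbit_def by (rule InterD[rotated])
    then show "\<tau> y \<in> A" using A by blast
  qed
qed

text \<open>The points whose orbit meets the orbit of \<open>x\<close> form an invariant set, and
  this set is a countable union of finite fibres.\<close>

lemma countable_generalized_orbit:
  assumes "x \<in> {0..1}"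
  shows "countable (generalized_orbit \<tau> x)"
proof -
  define A where "A = {y\<in>{0..1}. \<exists>m n. (\<tau> ^^ m) y = (\<tau> ^^ n) x}"
  have eq: "A = (\<Union>m. \<Union>n. {y\<in>{0..1}. (\<tau> ^^ m) y = (\<tau> ^^ n) x})" by (auto simp: A_def)
  have "countable A" unfolding eq by (intro countable_UN) (auto intro: countable_finite finite_fiber_iter[simplified])
  moreover have "generalized_orbit \<tau> x \<subseteq> A"
    unfolding generalized_orbit_def
  proof (intro Inter_lower CollectI conjI)
    show "x \<in> A" using assms unfolding A_def by blast
    show "\<tau> ` A \<subseteq> A"
    proof
      fix z assume "z \<in> \<tau> ` A"
      then obtain y m n where y: "z = \<tau> y" "y \<in> {0..1}" "(\<tau> ^^ m) y = (\<tau> ^^ n) x" unfolding A_def by blast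
      have "(\<tau> ^^ m) z = (\<tau> ^^ Suc n) x" using y by (simp add: funpow_swap1[symmetric])
      then show "z \<in> A" using y maps unfolding A_def by blast
    qed
    show "{y\<in>{0..1}. \<tau> y \<in> A} \<subseteq> A"
    proof
      fix y assume "y \<in> {y\<in>{0..1}. \<tau> y \<in> A}"
      then obtain m n where y: "y \<in> {0..1}" "(\<tau> ^^ m) (\<tau> y) = (\<tau> ^^ n) x"
        unfolding A_def by blast
      then have "(\<tau> ^^ Suc m) y = (\<tau> ^^ n) x" by (simp add: funpow_swap1)
      then show "y \<in> A" using y unfolding A_def by blast
    qed
  qed (auto simp: A_def)
  ultimately show ?thesis by (rule countable_subset[rotated])
qed

lemma I1_subset: "I1 \<tau> \<subseteq> {0..1}"
  using generalized_orbit_subset set_as_01 by (fastforce simp: I1_def)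

lemma set_as_I1: "set as \<subseteq> I1 \<tau>"
  using generalized_orbit_self by (auto simp: I1_def)

lemma as_I1: "i < length as \<Longrightarrow> as ! i \<in> I1 \<tau>"
  using set_as_I1 by auto

lemma zero_one_I1: "0 \<in> I1 \<tau>" "1 \<in> I1 \<tau>"
  using set_as_I1 set_as by auto

lemma I1_iff: "y \<in> {0..1} \<Longrightarrow> \<tau> y \<in> I1 \<tau> \<longleftrightarrow> y \<in> I1 \<tau>"
  using generalized_orbit_iff by (auto simp: I1_def)

lemma I1_iter_iff: "y \<in> {0..1} \<Longrightarrow> (\<tau> ^^ n) y \<in> I1 \<tau> \<longleftrightarrow> y \<in> I1 \<tau>"
  by (induction n) (use I1_iff iter_maps in auto)

lemma countable_I1: "countable (I1 \<tau>)"
  unfolding I1_def using countable_generalized_orbit set_as_01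
  by (intro countable_UN) (auto intro: countable_finite)

text \<open>If an interval missed \<open>I1\<close>, then by \<open>orbit_cover\<close> the fixed
  point \<open>c\<close> would be the only possible interior point of \<open>I1\<close>. There would
  be just two laps, meeting at \<open>c\<close> with opposite signs, so \<open>c = \<tau> c\<close>
  would be an extreme value of \<open>\<tau>\<close>, against surjectivity.\<close>

lemma I1_dense:
  assumes uv: "0 \<le> u" "u < v" "v \<le> 1"
  obtains x where "x \<in> I1 \<tau>" "u < x" "x < v"
proof (rule ccontr)
  assume "\<not> thesis"
  then have none: "\<And>x. x \<in> {u<..<v} \<Longrightarrow> x \<notin> I1 \<tau>" using that by auto
  obtain c where c: "0 < c" "c < 1" "\<tau> c = c" by (rule fixed_interior)
  have only: "y = c" if y: "y \<in> I1 \<tau>" "0 < y" "y < 1" for y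
  proof (rule ccontr)
    assume "y \<noteq> c"
    then obtain n x where nx: "x \<in> {u<..<v}" "(\<tau> ^^ n) x = y" using orbit_cover[OF uv c y(2,3)] by blast
    then have "x \<in> I1 \<tau>" using I1_iter_iff[of x n] y uv by auto
    then show False using none nx by blast
  qed
  have l: "length as = 3"
  proof (rule ccontr)
    assume "length as \<noteq> 3"
    then have l4: "4 \<le> length as" using three_points by simp
    have "as ! 1 < as ! 2" "as ! 0 < as ! 1" "as ! 2 < as ! 3" "as ! 3 \<le> 1"
      using as_less[of 1 2] as_less[of 0 1] as_less[of 2 3] as_01[of 3] l4 by auto
    moreover have "as ! 1 \<in> I1 \<tau>" "as ! 2 \<in> I1 \<tau>" using as_I1 l4 by auto
    moreover have "as ! 0 = 0" by (rule as_0)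
    ultimately have "as ! 1 = c" "as ! 2 = c" by (intro only; linarith | simp)+
    then show False using \<open>as ! 1 < as ! 2\<close> by simp
  qed
  have as1: "0 < as ! 1" "as ! 1 < 1" using as_less[of 0 1] as_less[of 1 2] as_0 as_end l by auto
  then have a1: "as ! 1 = c" using only as_I1[of 1] l by simp
  have laps: "lap 0 = {0..c}" "lap 1 = {c..1}" using as_0 as_end l a1 by (auto simp: lap_def numeral_2_eq_2)
  have alt: "dirs 1 = - dirs 0" using dirs_alternate[of 0] l by simp
  have m0: "dirs 0 * \<tau> x < dirs 0 * c" if "0 \<le> x" "x < c" for x
    using mono_lap_less[of 0 x c] l laps that c by auto
  have m1: "dirs 0 * \<tau> x < dirs 0 * c" if "c < x" "x \<le> 1" for x
    using mono_lap_less[of 1 c x] l laps that c alt by auto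
  have all: "dirs 0 * \<tau> x \<le> dirs 0 * c" if "x \<in> {0..1}" for x
    using m0[of x] m1[of x] that c(3) by (cases "x < c"; cases "x = c") (auto simp del: of_int_eq_iff)
  have "0 \<in> \<tau> ` {0..1}" "1 \<in> \<tau> ` {0..1}" unfolding surj by simp_all
  then obtain x0 x1 where "x0 \<in> {0..1}" "0 = \<tau> x0" "x1 \<in> {0..1}" "1 = \<tau> x1" by blast
  then show False using all[of x0] all[of x1] dirs_cases[of 0] c by auto
qed

end

section \<open>The split space and the transfer operator\<close>

definition side :: "real \<Rightarrow> int \<Rightarrow> real \<Rightarrow> real set" where
  "side x e d = {y. 0 < of_int e * (y - x) \<and> of_int e * (y - x) < d}"

lemma side_simps: "y \<in> side x 1 d \<longleftrightarrow> x < y \<and> y < x + d" "y \<in> side x (-1) d \<longleftrightarrow> x - d < y \<and> y < x"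
  by (auto simp: side_def)

definition valid :: "real \<Rightarrow> int \<Rightarrow> bool" where
  "valid x e \<longleftrightarrow> e = 1 \<and> 0 \<le> x \<and> x < 1 \<or> e = -1 \<and> 0 < x \<and> x \<le> 1"

text \<open>Membership of the one-sided point of \<open>x\<close> on side \<open>e\<close> in the
  order interval from the right side of \<open>b\<close> to the left side of \<open>b'\<close>.
  Adjacent intervals then partition their union exactly, with no shared endpoint.\<close>

definition in_ival :: "real \<Rightarrow> real \<Rightarrow> real \<Rightarrow> int \<Rightarrow> bool" where
  "in_ival b b' x e \<longleftrightarrow> e = 1 \<and> b \<le> x \<and> x < b' \<or> e = -1 \<and> b < x \<and> x \<le> b'"

lemma valid_cases:
  assumes "valid x e"
  obtains "e = 1" "0 \<le> x" "x < 1" | "e = -1" "0 < x" "x \<le> 1"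
  using assms by (auto simp: valid_def)

lemma valid_01: "valid x e \<Longrightarrow> x \<in> {0..1}"
  by (auto simp: valid_def)

lemma in_ival_valid: "in_ival b b' x e \<Longrightarrow> 0 \<le> b \<Longrightarrow> b' \<le> 1 \<Longrightarrow> valid x e"
  by (auto simp: in_ival_def valid_def)

lemma in_ival_split:
  assumes "b \<le> g" "g \<le> b'"
  shows "in_ival b b' x e \<longleftrightarrow> in_ival b g x e \<or> in_ival g b' x e"
    "\<not> (in_ival b g x e \<and> in_ival g b' x e)"
  using assms by (auto simp: in_ival_def)

lemma side_mono: "y \<in> side x e d \<Longrightarrow> d \<le> d' \<Longrightarrow> y \<in> side x e d'"
  by (auto simp: side_def)

context trans_map
begin

abbreviation "X \<equiv> X_space \<tau>"

text \<open>\<open>sp x e\<close> is the point of the split space on side \<open>e \<in> {-1, 1}\<close> of \<open>x\<close>; both sides give the same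
  point if \<open>x\<close> is not split, and \<open>valid x e\<close> excludes the outer sides of \<open>0\<close> and \<open>1\<close>.\<close>

definition sp :: "real \<Rightarrow> int \<Rightarrow> point" where
  "sp x e = (if x \<in> split_points \<tau> then (x, e) else (x, 0))"

lemma minus_point_eq: "minus_point \<tau> x = sp x (-1)" and plus_point_eq: "plus_point \<tau> x = sp x 1"
  by (auto simp: sp_def minus_point_def plus_point_def)

lemma split_points_iff: "x \<in> split_points \<tau> \<longleftrightarrow> x \<in> I1 \<tau> \<and> 0 < x \<and> x < 1"
  using I1_subset by (fastforce simp: split_points_def)

lemma fst_sp [simp]: "fst (sp x e) = x"
  by (simp add: sp_def)

lemma sp_in_X: "valid x e \<Longrightarrow> sp x e \<in> X"
  by (auto simp: sp_def X_space_def valid_def)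

lemma X_01: "p \<in> X \<Longrightarrow> fst p \<in> {0..1}"
  by (auto simp: X_space_def split_points_iff)

lemma X_cases:
  assumes "p \<in> X"
  obtains x e where "valid x e" "p = sp x e"
proof -
  obtain x k where p: "p = (x, k)" by force
  consider "x \<in> {0..1} - split_points \<tau>" "k = 0" | "x \<in> split_points \<tau>" "k = 1" | "x \<in> split_points \<tau>" "k = -1"
    using assms p by (auto simp: X_space_def)
  then show ?thesis
  proof cases
    case 1
    show ?thesis
    proof (cases "x < 1")
      case True then show ?thesis using 1 p by (intro that[of x 1]) (auto simp: valid_def sp_def)
    next
      case False then show ?thesis using 1 p by (intro that[of x "-1"]) (auto simp: valid_def sp_def)
    qed
  next
    case 2 then show ?thesis using p by (intro that[of x 1]) (auto simp: valid_def sp_def split_points_iff)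
  next
    case 3 then show ?thesis using p by (intro that[of x "-1"]) (auto simp: valid_def sp_def split_points_iff)
  qed
qed

lemma X_fiber: "p \<in> X \<Longrightarrow> fst p = x \<Longrightarrow> p = sp x 1 \<or> p = sp x (-1)"
  by (auto simp: X_space_def sp_def)

lemma point_less_linear: "point_less p q \<or> p = q \<or> point_less q p"
  by (auto simp: point_less_def prod_eq_iff)

lemma topspace_X [simp]: "topspace (X_topology \<tau>) = X"
  unfolding X_topology_def topology_generated_by_topspace by auto

lemma openin_ray:
  assumes "p \<in> X"
  shows "openin (X_topology \<tau>) {q \<in> X. point_less q p}" "openin (X_topology \<tau>) {q \<in> X. point_less p q}"
  unfolding X_topology_def using assms by (auto intro!: topology_generated_by_Basis)

section \<open>The topology of the split space through one-sided neighbourhoods\<close>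

definition sided_open :: "point set \<Rightarrow> bool" where
  "sided_open U \<longleftrightarrow> U \<subseteq> X \<and> (\<forall>x e. valid x e \<longrightarrow> sp x e \<in> U \<longrightarrow> (\<exists>d>0. \<forall>q\<in>X. fst q \<in> side x e d \<longrightarrow> q \<in> U))"

lemma sided_open_lower_ray:
  assumes p: "p \<in> X" shows "sided_open {q \<in> X. point_less q p}"
  unfolding sided_open_def
proof (intro conjI allI impI)
  fix x e assume v: "valid x e" and m: "sp x e \<in> {q \<in> X. point_less q p}"
  show "\<exists>d>0. \<forall>q\<in>X. fst q \<in> side x e d \<longrightarrow> q \<in> {q \<in> X. point_less q p}"
  proof (cases "x < fst p")
    case True
    then show ?thesis using v
      by (intro exI[of _ "fst p - x"]) (auto simp: side_def valid_def point_less_def)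
  next
    case False
    then have eq: "fst p = x" "snd (sp x e) < snd p" using m by (auto simp: point_less_def)
    have "p = sp x 1 \<or> p = sp x (-1)" using X_fiber p eq by blast
    then have "snd p = snd (sp x 1) \<or> snd p = snd (sp x (-1))" by metis
    then have "e = -1" using eq v by (auto simp: sp_def valid_def split: if_splits)
    then show ?thesis using eq by (intro exI[of _ 1]) (auto simp: side_def point_less_def)
  qed
qed auto

lemma sided_open_upper_ray:
  assumes p: "p \<in> X" shows "sided_open {q \<in> X. point_less p q}"
  unfolding sided_open_def
proof (intro conjI allI impI)
  fix x e assume v: "valid x e" and m: "sp x e \<in> {q \<in> X. point_less p q}"
  show "\<exists>d>0. \<forall>q\<in>X. fst q \<in> side x e d \<longrightarrow> q \<in> {q \<in> X. point_less p q}"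
  proof (cases "fst p < x")
    case True
    then show ?thesis using v
      by (intro exI[of _ "x - fst p"]) (auto simp: side_def valid_def point_less_def)
  next
    case False
    then have eq: "fst p = x" "snd p < snd (sp x e)" using m by (auto simp: point_less_def)
    have "p = sp x 1 \<or> p = sp x (-1)" using X_fiber p eq by blast
    then have "snd p = snd (sp x 1) \<or> snd p = snd (sp x (-1))" by metis
    then have "e = 1" using eq v by (auto simp: sp_def valid_def split: if_splits)
    then show ?thesis using eq by (intro exI[of _ 1]) (auto simp: side_def point_less_def)
  qed
qed auto

lemma sided_open_if_openin:
  assumes "openin (X_topology \<tau>) U" shows "sided_open U"
proof -
  have "generate_topology_on (insert X
       ((\<lambda>p. {q \<in> X. point_less q p}) ` X \<union> (\<lambda>p. {q \<in> X. point_less p q}) ` X)) U"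
    using assms by (simp add: X_topology_def openin_topology_generated_by_iff)
  then show ?thesis
  proof induction
    case Empty show ?case by (simp add: sided_open_def)
  next
    case (Int a b)
    show ?case unfolding sided_open_def
    proof (intro conjI allI impI)
      fix x e assume v: "valid x e" "sp x e \<in> a \<inter> b"
      obtain d1 where d1: "d1 > 0" "\<forall>q\<in>X. fst q \<in> side x e d1 \<longrightarrow> q \<in> a"
        using Int.IH(1) v unfolding sided_open_def by blast
      obtain d2 where d2: "d2 > 0" "\<forall>q\<in>X. fst q \<in> side x e d2 \<longrightarrow> q \<in> b"
        using Int.IH(2) v unfolding sided_open_def by blast
      show "\<exists>d>0. \<forall>q\<in>X. fst q \<in> side x e d \<longrightarrow> q \<in> a \<inter> b"
        using d1 d2 by (intro exI[of _ "min d1 d2"]) (auto simp: side_def)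
    qed (use Int.IH in \<open>auto simp: sided_open_def\<close>)
  next
    case (UN K)
    show ?case unfolding sided_open_def
    proof (intro conjI allI impI)
      fix x e assume v: "valid x e" "sp x e \<in> \<Union>K"
      then obtain k where k: "k \<in> K" "sp x e \<in> k" by blast
      then obtain d where "d > 0" "\<forall>q\<in>X. fst q \<in> side x e d \<longrightarrow> q \<in> k"
        using UN.IH[OF k(1)] v unfolding sided_open_def by blast
      then show "\<exists>d>0. \<forall>q\<in>X. fst q \<in> side x e d \<longrightarrow> q \<in> \<Union>K" using k by blast
    qed (use UN.IH in \<open>auto simp: sided_open_def\<close>)
  next
    case (Basis s)
    then consider "s = X" | p where "p \<in> X" "s = {q \<in> X. point_less q p}" | p where "p \<in> X" "s = {q \<in> X. point_less p q}"
      by blast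
    then show ?case
    proof cases
      case 1 then show ?thesis by (auto simp: sided_open_def intro: exI[of _ 1])
    qed (auto intro: sided_open_lower_ray sided_open_upper_ray)
  qed
qed

text \<open>Only points below \<open>p\<close> are controlled here. The upper copy of a split point
  has an immediate predecessor and 0 has nothing below it; in all remaining cases \<open>p\<close>
  is the left side of \<open>x\<close>, and sided openness gives the neighbourhood.\<close>

lemma left_nbhd:
  assumes U: "sided_open U" and p: "p \<in> U"
  shows "\<exists>L. openin (X_topology \<tau>) L \<and> p \<in> L \<and> (\<forall>q\<in>L. point_less q p \<longrightarrow> q \<in> U)"
proof -
  have pX: "p \<in> X" using U p by (auto simp: sided_open_def)
  obtain x e where v: "valid x e" "p = sp x e" by (rule X_cases[OF pX])
  consider "x \<in> split_points \<tau>" "e = 1" | "x = 0" | "x > 0" "p = sp x (-1)"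
    by (cases "x \<in> split_points \<tau>"; cases "x = 0") (use v in \<open>auto simp: valid_def sp_def\<close>)
  then show ?thesis
  proof cases
    case 1
    then have "sp x (-1) \<in> X" by (intro sp_in_X) (auto simp: valid_def split_points_iff)
    then have "openin (X_topology \<tau>) {q \<in> X. point_less (sp x (-1)) q}" by (rule openin_ray)
    moreover have "p \<in> {q \<in> X. point_less (sp x (-1)) q}" using 1 pX v by (auto simp: point_less_def sp_def)
    moreover have "\<not> point_less q p" if "q \<in> {q \<in> X. point_less (sp x (-1)) q}" for q
      using that 1 v by (auto simp: point_less_def sp_def X_space_def)
    ultimately show ?thesis by blast
  next
    case 2
    have "\<not> point_less q p" if "q \<in> X" for q
      using that 2 v X_01[OF that] by (auto simp: point_less_def sp_def X_space_def split_points_iff)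
    moreover have "openin (X_topology \<tau>) X" by (metis openin_topspace topspace_X)
    ultimately show ?thesis using pX by blast
  next
    case 3
    then have v1: "valid x (-1)" using v by (auto simp: valid_def)
    then obtain d where d: "d > 0" "\<forall>q\<in>X. fst q \<in> side x (-1) d \<longrightarrow> q \<in> U"
      using U p 3 unfolding sided_open_def by blast
    obtain y where y: "max 0 (x - d) < y" "y < x" using dense[of "max 0 (x - d)" x] d 3 by auto
    have "valid y 1" using y v1 by (auto simp: valid_def)
    then have "openin (X_topology \<tau>) {q \<in> X. point_less (sp y 1) q}" by (intro openin_ray sp_in_X)
    moreover have "p \<in> {q \<in> X. point_less (sp y 1) q}" using pX y 3 by (auto simp: point_less_def)
    moreover have "q \<in> U" if q: "q \<in> X" "point_less (sp y 1) q" "point_less q p" for q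
    proof -
      have "fst q \<noteq> x"
      proof
        assume fq: "fst q = x"
        then have "snd q = snd (sp x 1) \<or> snd q = snd (sp x (-1))" using X_fiber[OF q(1)] by metis
        then show False using q(3) 3 fq by (auto simp: point_less_def sp_def split: if_splits)
      qed
      then have "fst q \<in> side x (-1) d" using q y 3 by (auto simp: side_def point_less_def)
      then show ?thesis using d q by blast
    qed
    ultimately show ?thesis by blast
  qed
qed

lemma right_nbhd:
  assumes U: "sided_open U" and p: "p \<in> U"
  shows "\<exists>L. openin (X_topology \<tau>) L \<and> p \<in> L \<and> (\<forall>q\<in>L. point_less p q \<longrightarrow> q \<in> U)"
proof -
  have pX: "p \<in> X" using U p by (auto simp: sided_open_def)
  obtain x e where v: "valid x e" "p = sp x e" by (rule X_cases[OF pX])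
  consider "x \<in> split_points \<tau>" "e = -1" | "x = 1" | "x < 1" "p = sp x 1"
    by (cases "x \<in> split_points \<tau>"; cases "x = 1") (use v in \<open>auto simp: valid_def sp_def\<close>)
  then show ?thesis
  proof cases
    case 1
    then have "sp x 1 \<in> X" by (intro sp_in_X) (auto simp: valid_def split_points_iff)
    then have "openin (X_topology \<tau>) {q \<in> X. point_less q (sp x 1)}" by (rule openin_ray)
    moreover have "p \<in> {q \<in> X. point_less q (sp x 1)}" using 1 pX v by (auto simp: point_less_def sp_def)
    moreover have "\<not> point_less p q" if "q \<in> {q \<in> X. point_less q (sp x 1)}" for q
      using that 1 v by (auto simp: point_less_def sp_def X_space_def)
    ultimately show ?thesis by blast
  next
    case 2
    have "\<not> point_less p q" if "q \<in> X" for q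
      using that 2 v X_01[OF that] by (auto simp: point_less_def sp_def X_space_def split_points_iff)
    moreover have "openin (X_topology \<tau>) X" by (metis openin_topspace topspace_X)
    ultimately show ?thesis using pX by blast
  next
    case 3
    then have v1: "valid x 1" using v by (auto simp: valid_def)
    then obtain d where d: "d > 0" "\<forall>q\<in>X. fst q \<in> side x 1 d \<longrightarrow> q \<in> U"
      using U p 3 unfolding sided_open_def by blast
    obtain y where y: "x < y" "y < min 1 (x + d)" using dense[of x "min 1 (x + d)"] d 3 by auto
    have "valid y (-1)" using y v1 by (auto simp: valid_def)
    then have "openin (X_topology \<tau>) {q \<in> X. point_less q (sp y (-1))}" by (intro openin_ray sp_in_X)
    moreover have "p \<in> {q \<in> X. point_less q (sp y (-1))}" using pX y 3 by (auto simp: point_less_def)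
    moreover have "q \<in> U" if q: "q \<in> X" "point_less q (sp y (-1))" "point_less p q" for q
    proof -
      have "fst q \<noteq> x"
      proof
        assume fq: "fst q = x"
        then have "snd q = snd (sp x 1) \<or> snd q = snd (sp x (-1))" using X_fiber[OF q(1)] by metis
        then show False using q(3) 3 fq by (auto simp: point_less_def sp_def split: if_splits)
      qed
      then have "fst q \<in> side x 1 d" using q y 3 by (auto simp: side_def point_less_def)
      then show ?thesis using d q by blast
    qed
    ultimately show ?thesis by blast
  qed
qed

text \<open>Intersecting a neighbourhood that is good below \<open>p\<close> with one that is good
  above \<open>p\<close> gives openness. An unsplit interior point carries both sides, so it is
  tested twice.\<close>

lemma openin_X_iff: "openin (X_topology \<tau>) U \<longleftrightarrow> sided_open U"
proof
  assume U: "sided_open U"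
  show "openin (X_topology \<tau>) U"
  proof (subst openin_subopen, rule ballI)
    fix p assume p: "p \<in> U"
    obtain L where L: "openin (X_topology \<tau>) L" "p \<in> L" "\<forall>q\<in>L. point_less q p \<longrightarrow> q \<in> U"
      using left_nbhd[OF U p] by blast
    obtain R where R: "openin (X_topology \<tau>) R" "p \<in> R" "\<forall>q\<in>R. point_less p q \<longrightarrow> q \<in> U"
      using right_nbhd[OF U p] by blast
    have "L \<inter> R \<subseteq> U" using L R p point_less_linear by blast
    then show "\<exists>T. openin (X_topology \<tau>) T \<and> p \<in> T \<and> T \<subseteq> U"
      using L R by (intro exI[of _ "L \<inter> R"]) auto
  qed
qed (rule sided_open_if_openin)

text \<open>This serves the uniqueness of \<open>local_homeo\<close>: continuous maps into a
  Hausdorff space that agree on a dense set coincide.\<close>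

lemma Hausdorff_X: "Hausdorff_space (X_topology \<tau>)"
proof -
  have sep: "\<exists>U V. openin (X_topology \<tau>) U \<and> openin (X_topology \<tau>) V \<and> p \<in> U \<and> q \<in> V \<and> disjnt U V"
    if pq: "p \<in> X" "q \<in> X" "point_less p q" for p q
  proof (cases "\<exists>r\<in>X. point_less p r \<and> point_less r q")
    case True
    then obtain r where r: "r \<in> X" "point_less p r" "point_less r q" by blast
    show ?thesis
      by (rule exI[of _ "{z \<in> X. point_less z r}"], rule exI[of _ "{z \<in> X. point_less r z}"])
         (use openin_ray[OF r(1)] r pq in \<open>auto simp: disjnt_def point_less_def\<close>)
  next
    case False
    have "disjnt {z \<in> X. point_less z q} {z \<in> X. point_less p z}" using False by (auto simp: disjnt_def)
    then show ?thesis using openin_ray(1)[OF pq(2)] openin_ray(2)[OF pq(1)] pq by blast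
  qed
  show ?thesis unfolding Hausdorff_space_def
  proof (intro allI impI, elim conjE)
    fix p q assume pq: "p \<in> topspace (X_topology \<tau>)" "q \<in> topspace (X_topology \<tau>)" "p \<noteq> q"
    then consider "point_less p q" | "point_less q p" using point_less_linear by blast
    then show "\<exists>U V. openin (X_topology \<tau>) U \<and> openin (X_topology \<tau>) V \<and> p \<in> U \<and> q \<in> V \<and> disjnt U V"
    proof cases
      case 1 then show ?thesis using sep pq by simp
    next
      case 2 then show ?thesis using sep[of q p] pq by (metis disjnt_sym topspace_X)
    qed
  qed
qed

lemma side_nonempty:
  assumes "valid x e" "d > 0"
  obtains u v where "0 \<le> u" "u < v" "v \<le> 1" "{u<..<v} \<subseteq> side x e d"
  using assms(1)
proof (cases rule: valid_cases)
  case 1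
  moreover have "{x<..<min 1 (x + d)} \<subseteq> side x e d" using 1 by (auto simp: side_def)
  ultimately show ?thesis using that[of x "min 1 (x + d)"] assms(2) by simp
next
  case 2
  moreover have "{max 0 (x - d)<..<x} \<subseteq> side x e d" using 2 by (auto simp: side_def)
  ultimately show ?thesis using that[of "max 0 (x - d)" x] assms(2) by simp
qed

lemma I0_dense:
  assumes "0 \<le> u" "u < v" "v \<le> 1"
  obtains x where "x \<in> I0 \<tau>" "u < x" "x < v"
proof -
  have "uncountable ({u<..<v} - I1 \<tau>)"
    using assms countable_I1 uncountable_open_interval by (intro uncountable_minus_countable) auto
  then obtain x where "x \<in> {u<..<v} - I1 \<tau>" by (metis countable_empty all_not_in_conv)
  then show ?thesis using that[of x] assms by (auto simp: I0_def)
qed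

lemma I0_unsplit: "x \<in> I0 \<tau> \<Longrightarrow> sp x e = (x, 0)"
  by (auto simp: I0_def sp_def split_points_iff)

lemma I0_in_X: "x \<in> I0 \<tau> \<Longrightarrow> (x, 0) \<in> X0 \<tau>"
  by (auto simp: I0_def X0_def X_space_def split_points_iff)

lemma X0_dense: "X_topology \<tau> closure_of X0 \<tau> = X"
proof -
  have "\<exists>y. y \<in> X0 \<tau> \<and> y \<in> T" if T: "p \<in> T" "openin (X_topology \<tau>) T" for p T
  proof -
    have so: "sided_open T" using T by (simp add: openin_X_iff)
    then have "p \<in> X" using T by (auto simp: sided_open_def)
    then obtain x e where v: "valid x e" "p = sp x e" by (rule X_cases)
    then obtain d where d: "d > 0" "\<forall>q\<in>X. fst q \<in> side x e d \<longrightarrow> q \<in> T"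
      using so T unfolding sided_open_def by blast
    obtain u w where uw: "0 \<le> u" "u < w" "w \<le> 1" "{u<..<w} \<subseteq> side x e d" by (rule side_nonempty[OF v(1) d(1)])
    obtain y where y: "y \<in> I0 \<tau>" "u < y" "y < w" by (rule I0_dense[OF uw(1-3)])
    have "(y, 0) \<in> X0 \<tau>" by (rule I0_in_X[OF y(1)])
    moreover have "(y, 0) \<in> T" using d(2) uw(4) y I0_in_X[OF y(1)] by (auto simp: X0_def)
    ultimately show ?thesis by blast
  qed
  then show ?thesis by (auto simp: in_closure_of intro!: set_eqI)
qed

section \<open>The local homeomorphism\<close>

definition lap_side :: "nat \<Rightarrow> real \<Rightarrow> int \<Rightarrow> bool" where
  "lap_side i x e \<longleftrightarrow> Suc i < length as \<and> in_ival (as ! i) (as ! Suc i) x e"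

lemma lap_side_ex: "valid x e \<Longrightarrow> \<exists>i. lap_side i x e"
proof (erule valid_cases)
  assume "e = 1" "0 \<le> x" "x < 1"
  then show ?thesis using locate_right[of x] by (metis in_ival_def lap_side_def)
next
  assume "e = -1" "0 < x" "x \<le> 1"
  then show ?thesis using locate_left[of x] by (metis in_ival_def lap_side_def)
qed

lemma lap_side_unique: "lap_side i x e \<Longrightarrow> lap_side j x e \<Longrightarrow> i = j"
proof (induction i j rule: linorder_wlog)
  case (le i j)
  show ?case
  proof (rule ccontr)
    assume "i \<noteq> j"
    then have "as ! Suc i \<le> as ! j"
      using le by (intro sorted_wrt_less_mono[OF as_sorted]) (auto simp: lap_side_def)
    then show False using le by (auto simp: lap_side_def in_ival_def)
  qed
qed simp

text \<open>\<open>\<tau>\<close> carries side \<open>e\<close> of \<open>x\<close> to side \<open>dr x e\<close> of \<open>\<tau> x\<close>.\<close>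

definition dr :: "real \<Rightarrow> int \<Rightarrow> int" where
  "dr x e = e * dirs (SOME i. lap_side i x e)"

lemma dr_eq: "lap_side i x e \<Longrightarrow> dr x e = e * dirs i"
  unfolding dr_def using lap_side_unique by (metis someI)

lemma side_map:
  assumes v: "valid x e" and eps: "\<epsilon> > 0"
  shows "\<exists>d>0. \<forall>y\<in>side x e d. y \<in> {0..1} \<and> \<tau> y \<in> side (\<tau> x) (dr x e) \<epsilon>"
proof -
  obtain i where i: "lap_side i x e" using lap_side_ex[OF v] by blast
  then have li: "Suc i < length as" "in_ival (as ! i) (as ! Suc i) x e" by (auto simp: lap_side_def)
  have x01: "x \<in> {0..1}" by (rule valid_01[OF v])
  obtain d1 where d1: "d1 > 0" "\<And>y. y \<in> {0..1} \<Longrightarrow> dist y x < d1 \<Longrightarrow> dist (\<tau> y) (\<tau> x) < \<epsilon>"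
    using cont x01 eps unfolding continuous_on_iff by blast
  define d where "d = min d1 (if e = 1 then as ! Suc i - x else x - as ! i)"
  have "d > 0" using li d1 by (auto simp: d_def in_ival_def)
  moreover have "y \<in> {0..1} \<and> \<tau> y \<in> side (\<tau> x) (dr x e) \<epsilon>" if y: "y \<in> side x e d" for y
  proof -
    have lp: "x \<in> lap i" "y \<in> lap i" using li y by (auto simp: lap_def in_ival_def d_def side_def)
    then have y01: "y \<in> {0..1}" using lap_subset li by blast
    have "dist y x < d1" using y v by (auto simp: d_def side_def valid_def dist_real_def)
    then have dd: "\<bar>\<tau> y - \<tau> x\<bar> < \<epsilon>" using d1(2)[OF y01] by (simp add: dist_real_def)
    have "0 < dr x e * (\<tau> y - \<tau> x)"
      using v
    proof (cases rule: valid_cases)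
      case 1
      then have "x < y" using y by (simp add: side_simps)
      then show ?thesis using mono_lap_less[OF li(1) lp] 1 dr_eq[OF i] by (auto simp: algebra_simps)
    next
      case 2
      then have "y < x" using y by (simp add: side_simps)
      then show ?thesis using mono_lap_less[OF li(1) lp(2) lp(1)] 2 dr_eq[OF i] by (auto simp: algebra_simps)
    qed
    moreover have "dr x e = 1 \<or> dr x e = -1" using dr_eq[OF i] dirs_cases[of i] v by (auto simp: valid_def)
    ultimately show ?thesis using dd y01 by (auto simp: side_def)
  qed
  ultimately show ?thesis by blast
qed

text \<open>The image side cannot point out of the unit interval, because it contains images of
  points close to \<open>x\<close>.\<close>

lemma valid_image:
  assumes v: "valid x e" shows "valid (\<tau> x) (dr x e)"
proof -
  obtain i where i: "lap_side i x e" using lap_side_ex[OF v] by blast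
  have cs: "dr x e = 1 \<or> dr x e = -1" using dr_eq[OF i] dirs_cases[of i] v by (auto simp: valid_def)
  obtain d where d: "d > 0" "\<forall>y\<in>side x e d. y \<in> {0..1} \<and> \<tau> y \<in> side (\<tau> x) (dr x e) 1"
    using side_map[OF v, of 1] by auto
  obtain y where y: "y \<in> side x e d" using side_nonempty[OF v d(1)] by (metis dense greaterThanLessThan_iff subsetD)
  then have "\<tau> y \<in> {0..1}" "\<tau> y \<in> side (\<tau> x) (dr x e) 1" using d(2) maps by blast+
  then show ?thesis using cs maps[OF valid_01[OF v]] by (auto simp: valid_def side_simps)
qed

text \<open>An explicit form of the local homeomorphism. The point 1 has only a left side although
  its marker is 0, hence the extra test; for unsplit interior points either side gives the same
  image.\<close>

definition sg :: "point \<Rightarrow> point" where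
  "sg p = (if snd p = -1 \<or> fst p = 1 then sp (\<tau> (fst p)) (dr (fst p) (-1)) else sp (\<tau> (fst p)) (dr (fst p) 1))"

lemma fst_sg [simp]: "fst (sg p) = \<tau> (fst p)"
  by (simp add: sg_def)

lemma sg_sp:
  assumes v: "valid x e" shows "sg (sp x e) = sp (\<tau> x) (dr x e)"
proof (cases "x \<in> split_points \<tau>")
  case True
  then show ?thesis using v by (auto simp: sg_def sp_def valid_def split_points_iff)
next
  case False
  show ?thesis
  proof (cases "x = 0 \<or> x = 1")
    case True
    then show ?thesis using v False by (auto simp: sg_def sp_def valid_def)
  next
    case n: False
    then have "x \<notin> I1 \<tau>" "x \<in> {0..1}" using False v by (auto simp: split_points_iff valid_def)
    then have "\<tau> x \<notin> split_points \<tau>" using I1_iff by (auto simp: split_points_iff)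
    then show ?thesis by (auto simp: sg_def sp_def)
  qed
qed

lemma sg_in_X:
  assumes "p \<in> X" shows "sg p \<in> X"
proof -
  obtain x e where v: "valid x e" "p = sp x e" by (rule X_cases[OF assms])
  then show ?thesis using sg_sp sp_in_X valid_image by metis
qed

lemma sg_I0: "x \<in> I0 \<tau> \<Longrightarrow> sg (x, 0) = (\<tau> x, 0) \<and> \<tau> x \<in> I0 \<tau>"
proof -
  assume x: "x \<in> I0 \<tau>"
  then have "\<tau> x \<in> I0 \<tau>" using I1_iff[of x] maps[of x] by (auto simp: I0_def)
  then have "sp (\<tau> x) e = (\<tau> x, 0)" for e by (rule I0_unsplit)
  then show ?thesis using \<open>\<tau> x \<in> I0 \<tau>\<close> by (auto simp: sg_def)
qed

lemma continuous_sg: "continuous_map (X_topology \<tau>) (X_topology \<tau>) sg"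
  unfolding continuous_map_def topspace_X
proof (intro conjI allI impI)
  show "sg \<in> X \<rightarrow> X" using sg_in_X by blast
  fix U assume "openin (X_topology \<tau>) U"
  then have U: "sided_open U" by (simp add: openin_X_iff)
  have "sided_open {p \<in> X. sg p \<in> U}" unfolding sided_open_def
  proof (intro conjI allI impI)
    fix x e assume v: "valid x e" and "sp x e \<in> {p \<in> X. sg p \<in> U}"
    then have "sp (\<tau> x) (dr x e) \<in> U" using sg_sp by auto
    then obtain d' where d': "d' > 0" "\<forall>q\<in>X. fst q \<in> side (\<tau> x) (dr x e) d' \<longrightarrow> q \<in> U"
      using U valid_image[OF v] unfolding sided_open_def by blast
    obtain d where "d > 0" "\<forall>y\<in>side x e d. y \<in> {0..1} \<and> \<tau> y \<in> side (\<tau> x) (dr x e) d'"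
      using side_map[OF v d'(1)] by blast
    then show "\<exists>d>0. \<forall>q\<in>X. fst q \<in> side x e d \<longrightarrow> q \<in> {p \<in> X. sg p \<in> U}"
      using d'(2) sg_in_X by (intro exI[of _ d]) auto
  qed auto
  then show "openin (X_topology \<tau>) {p \<in> X. sg p \<in> U}" by (simp add: openin_X_iff)
qed

text \<open>Over \<open>I0\<close> the fibres of the collapse map are single points, so any
  candidate is forced on \<open>X0\<close>; density and the Hausdorff property extend the agreement
  to all of \<open>X\<close>.\<close>

lemma local_homeo_eq: "local_homeo \<tau> = restrict sg X"
  unfolding local_homeo_def
proof (rule the_equality)
  have "continuous_map (X_topology \<tau>) (X_topology \<tau>) (restrict sg X)"
    by (rule continuous_map_eq[OF continuous_sg]) simp
  moreover have "fst (restrict sg X p) = \<tau> (fst p)" if "p \<in> X0 \<tau>" for p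
    using that by (simp add: X0_def)
  ultimately show "restrict sg X \<in> extensional X \<and>
      continuous_map (X_topology \<tau>) (X_topology \<tau>) (restrict sg X) \<and>
      (\<forall>p\<in>X0 \<tau>. fst (restrict sg X p) = \<tau> (fst p))" by auto
next
  fix s assume s: "s \<in> extensional X \<and> continuous_map (X_topology \<tau>) (X_topology \<tau>) s \<and>
      (\<forall>p\<in>X0 \<tau>. fst (s p) = \<tau> (fst p))"
  have X0: "s p = sg p" if p: "p \<in> X0 \<tau>" for p
  proof -
    have pX: "p \<in> X" "fst p \<in> I0 \<tau>" using p by (auto simp: X0_def)
    then have p0: "p = (fst p, 0)" using I0_unsplit by (metis X_fiber)
    have "s p \<in> X" using s pX(1) continuous_map_image_subset_topspace[of "X_topology \<tau>" "X_topology \<tau>" s] by auto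
    moreover have "fst (s p) = \<tau> (fst p)" using s p by blast
    ultimately have "s p = (\<tau> (fst p), 0)" using X_fiber I0_unsplit sg_I0[OF pX(2)] by metis
    then show ?thesis using sg_I0[OF pX(2)] p0 by metis
  qed
  have "s p = sg p" if "p \<in> X" for p
    by (rule forall_in_closure_of_eq[of p "X_topology \<tau>" "X0 \<tau>" "X_topology \<tau>" s sg])
       (use that X0_dense Hausdorff_X s continuous_sg X0 in auto)
  then show "s = restrict sg X" using s by (intro extensionalityI[of _ X]) auto
qed

section \<open>The transfer operator and interval indicators\<close>

lemma transfer_op_eq: "transfer_op \<tau> f q = (\<Sum>p | p \<in> X \<and> sg p = q. f p)"
  unfolding transfer_op_def local_homeo_eq by (intro sum.cong) auto

lemma transfer_op_add: "transfer_op \<tau> (\<lambda>p. f p + g p) = (\<lambda>p. transfer_op \<tau> f p + transfer_op \<tau> g p)"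
  by (rule ext) (simp add: transfer_op_eq sum.distrib)

lemma transfer_op_scale: "transfer_op \<tau> (\<lambda>p. k * f p) = (\<lambda>p. k * transfer_op \<tau> f p)"
  by (rule ext) (simp add: transfer_op_eq sum_distrib_left)

lemma CXZ_iff: "f \<in> CXZ \<tau> \<longleftrightarrow> (\<forall>p. p \<notin> X \<longrightarrow> f p = 0) \<and>
    (\<forall>x e. valid x e \<longrightarrow> (\<exists>d>0. \<forall>q\<in>X. fst q \<in> side x e d \<longrightarrow> f q = f (sp x e)))"
proof -
  have "continuous_map (X_topology \<tau>) (discrete_topology UNIV) f \<longleftrightarrow>
    (\<forall>x e. valid x e \<longrightarrow> (\<exists>d>0. \<forall>q\<in>X. fst q \<in> side x e d \<longrightarrow> f q = f (sp x e)))" (is "?L \<longleftrightarrow> ?R")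
  proof
    assume L: ?L
    show ?R
    proof (intro allI impI)
      fix x e assume v: "valid x e"
      have "openin (X_topology \<tau>) {p \<in> X. f p \<in> {f (sp x e)}}"
        using openin_continuous_map_preimage[OF L, of "{f (sp x e)}"] by simp
      then have "sided_open {p \<in> X. f p \<in> {f (sp x e)}}" by (simp only: openin_X_iff)
      then show "\<exists>d>0. \<forall>q\<in>X. fst q \<in> side x e d \<longrightarrow> f q = f (sp x e)"
        using v sp_in_X[OF v] unfolding sided_open_def by blast
    qed
  next
    assume R: ?R
    have "sided_open {p \<in> X. f p \<in> U}" for U
      unfolding sided_open_def
    proof (intro conjI allI impI)
      fix x e assume v: "valid x e" "sp x e \<in> {p \<in> X. f p \<in> U}"
      then obtain d where "d > 0" "\<forall>q\<in>X. fst q \<in> side x e d \<longrightarrow> f q = f (sp x e)" using R by blast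
      then show "\<exists>d>0. \<forall>q\<in>X. fst q \<in> side x e d \<longrightarrow> q \<in> {p \<in> X. f p \<in> U}"
        using v by (intro exI[of _ d]) auto
    qed auto
    then show ?L unfolding continuous_map_def by (simp add: openin_X_iff)
  qed
  then show ?thesis unfolding CXZ_def by blast
qed

lemma CXZ_add:
  assumes "f \<in> CXZ \<tau>" "g \<in> CXZ \<tau>" shows "(\<lambda>p. f p + g p) \<in> CXZ \<tau>"
  unfolding CXZ_iff
proof (intro conjI allI impI)
  fix x e assume v: "valid x e"
  obtain d1 where d1: "d1 > 0" "\<forall>q\<in>X. fst q \<in> side x e d1 \<longrightarrow> f q = f (sp x e)"
    using assms(1) v unfolding CXZ_iff by blast
  obtain d2 where d2: "d2 > 0" "\<forall>q\<in>X. fst q \<in> side x e d2 \<longrightarrow> g q = g (sp x e)"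
    using assms(2) v unfolding CXZ_iff by blast
  show "\<exists>d>0. \<forall>q\<in>X. fst q \<in> side x e d \<longrightarrow> f q + g q = f (sp x e) + g (sp x e)"
    using d1 d2 by (intro exI[of _ "min d1 d2"]) (auto simp: side_def)
qed (use assms in \<open>auto simp: CXZ_iff\<close>)

lemma CXZ_scale: "f \<in> CXZ \<tau> \<Longrightarrow> (\<lambda>p. k * f p) \<in> CXZ \<tau>"
  unfolding CXZ_iff by (metis mult_zero_right)

lemma CXZ_unit: "indicator X \<in> CXZ \<tau>"
  unfolding CXZ_iff using sp_in_X by (auto intro: exI[of _ 1])

lemma X_interval_subset: "X_interval \<tau> b b' \<subseteq> X"
  by (auto simp: X_interval_def)

lemma sp_in_interval:
  assumes v: "valid x e" and b: "b \<in> I1 \<tau>" "b' \<in> I1 \<tau>" "b < b'"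
  shows "sp x e \<in> X_interval \<tau> b b' \<longleftrightarrow> in_ival b b' x e"
proof -
  have b01: "0 \<le> b" "b' \<le> 1" using b I1_subset by auto
  have 1: "point_less (sp x e) (sp b 1) \<longleftrightarrow> x < b \<or> x = b \<and> e = -1"
    using v b b01 by (auto simp: point_less_def sp_def valid_def split_points_iff)
  have 2: "point_less (sp b' (-1)) (sp x e) \<longleftrightarrow> b' < x \<or> x = b' \<and> e = 1"
    using v b b01 by (auto simp: point_less_def sp_def valid_def split_points_iff)
  show ?thesis unfolding X_interval_def plus_point_eq minus_point_eq
    using 1 2 v sp_in_X[OF v] b by (auto simp: in_ival_def valid_def)
qed

lemma X_interval_cases:
  assumes p: "p \<in> X_interval \<tau> b b'" and b: "b \<in> I1 \<tau>" "b' \<in> I1 \<tau>" "b < b'"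
  obtains x e where "valid x e" "p = sp x e" "in_ival b b' x e"
proof -
  have "p \<in> X" using p X_interval_subset by blast
  then obtain x e where v: "valid x e" "p = sp x e" by (rule X_cases)
  then show ?thesis using sp_in_interval[OF v(1) b] p that by blast
qed

lemma X_interval_full: "X_interval \<tau> 0 1 = X"
proof
  show "X \<subseteq> X_interval \<tau> 0 1"
  proof
    fix p assume "p \<in> X"
    then obtain x e where v: "valid x e" "p = sp x e" by (rule X_cases)
    then show "p \<in> X_interval \<tau> 0 1"
      using sp_in_interval[OF v(1) zero_one_I1] by (auto simp: valid_def in_ival_def)
  qed
qed (rule X_interval_subset)

lemma fst_in_interval:
  assumes b: "b \<in> I1 \<tau>" "b' \<in> I1 \<tau>" "b < b'" and p: "p \<in> X"
  shows "b < fst p \<Longrightarrow> fst p < b' \<Longrightarrow> p \<in> X_interval \<tau> b b'" "fst p < b \<Longrightarrow> p \<notin> X_interval \<tau> b b'"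
    "b' < fst p \<Longrightarrow> p \<notin> X_interval \<tau> b b'"
proof -
  obtain x e where v: "valid x e" "p = sp x e" by (rule X_cases[OF p])
  show "b < fst p \<Longrightarrow> fst p < b' \<Longrightarrow> p \<in> X_interval \<tau> b b'" "fst p < b \<Longrightarrow> p \<notin> X_interval \<tau> b b'"
    "b' < fst p \<Longrightarrow> p \<notin> X_interval \<tau> b b'"
    using v sp_in_interval[OF v(1) b] by (auto simp: valid_def in_ival_def)
qed

lemma CXZ_interval:
  assumes b: "b \<in> I1 \<tau>" "b' \<in> I1 \<tau>" "b < b'"
  shows "indicator (X_interval \<tau> b b') \<in> CXZ \<tau>"
  unfolding CXZ_iff
proof (intro conjI allI impI)
  fix x e assume v: "valid x e"
  note F = fst_in_interval[OF b]
  show "\<exists>d>0. \<forall>q\<in>X. fst q \<in> side x e d \<longrightarrow> indicator (X_interval \<tau> b b') q = (indicator (X_interval \<tau> b b') (sp x e) :: int)"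
  proof (cases "in_ival b b' x e")
    case True
    then have "sp x e \<in> X_interval \<tau> b b'" using sp_in_interval[OF v b] by blast
    moreover have "\<exists>d>0. \<forall>y\<in>side x e d. b < y \<and> y < b'"
      using True by (intro exI[of _ "if e = 1 then b' - x else x - b"]) (auto simp: in_ival_def side_def)
    ultimately show ?thesis using F(1) by (metis indicator_simps(1))
  next
    case False
    then have "sp x e \<notin> X_interval \<tau> b b'" using sp_in_interval[OF v b] by blast
    moreover have "\<exists>d>0. \<forall>y\<in>side x e d. y < b \<or> b' < y"
      using False v b by (intro exI[of _ "if x < b then b - x else if b' < x then x - b' else 1"])
        (auto simp: in_ival_def side_def valid_def)
    ultimately show ?thesis using F(2,3) by (metis indicator_simps(2))
  qed
qed (use X_interval_subset in \<open>auto simp: indicator_def\<close>)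

text \<open>On a lap \<open>\<tau>\<close> is strictly monotonic and multiplies sides by
  \<open>dirs i\<close>, so the side of the preimage is recovered by multiplying with the same sign
  again. The delicate point is injectivity on the two sides of one \<open>x\<close>.\<close>

lemma bij_interval:
  assumes b: "b \<in> I1 \<tau>" "b' \<in> I1 \<tau>" "b < b'" and i: "Suc i < length as" "b \<in> lap i" "b' \<in> lap i"
  shows "bij_betw sg (X_interval \<tau> b b') (X_interval \<tau> (min (\<tau> b) (\<tau> b')) (max (\<tau> b) (\<tau> b')))"
proof -
  let ?u = "min (\<tau> b) (\<tau> b')" and ?v = "max (\<tau> b) (\<tau> b')"
  have b01: "0 \<le> b" "b' \<le> 1" using b I1_subset by auto
  have lapI: "x \<in> lap i" if "b \<le> x" "x \<le> b'" for x using that i by (auto simp: lap_def)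
  note m = mono_lap_less[OF i(1)]
  have mb: "dirs i * \<tau> b < dirs i * \<tau> b'" by (rule m[OF i(2,3) b(3)])
  have uI: "?u \<in> I1 \<tau>" "?v \<in> I1 \<tau>" using b I1_iff I1_subset by (auto simp: min_def max_def subset_iff)
  have uv: "?u < ?v" using mb dirs_cases[of i] by auto
  have ls: "lap_side i x e" if "in_ival b b' x e" for x e
    using that i by (auto simp: lap_side_def in_ival_def lap_def)
  have img: "in_ival ?u ?v (\<tau> x) (e * dirs i)" if xe: "in_ival b b' x e" for x e
  proof -
    have xl: "x \<in> lap i" using xe lapI by (auto simp: in_ival_def)
    have "b \<le> x" "x \<le> b'" using xe by (auto simp: in_ival_def)
    then have "x = b \<or> dirs i * \<tau> b < dirs i * \<tau> x" "x = b' \<or> dirs i * \<tau> x < dirs i * \<tau> b'"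
      using m[OF i(2) xl] m[OF xl i(3)] by linarith+
    then show ?thesis using dirs_cases[of i] xe mb b(3) by (auto simp: in_ival_def)
  qed
  have val: "valid x e" if "in_ival b b' x e" for x e using in_ival_valid[OF that b01] .
  have sg_eq: "sg (sp x e) = sp (\<tau> x) (e * dirs i)" if "in_ival b b' x e" for x e
    using sg_sp[OF val[OF that]] dr_eq[OF ls[OF that]] by simp
  show ?thesis unfolding bij_betw_def
  proof (intro conjI inj_onI)
    fix p q assume p: "p \<in> X_interval \<tau> b b'" and q: "q \<in> X_interval \<tau> b b'" and eq: "sg p = sg q"
    obtain x e where x: "p = sp x e" "in_ival b b' x e" using p by (rule X_interval_cases[OF _ b])
    obtain y f where y: "q = sp y f" "in_ival b b' y f" using q by (rule X_interval_cases[OF _ b])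
    have xl: "x \<in> lap i" "y \<in> lap i" using x y lapI by (auto simp: in_ival_def)
    have "\<tau> x = \<tau> y" using eq x y by (metis fst_sg fst_sp)
    then have xy: "x = y" using mono_sgn_inj_on[OF mono_lap[OF i(1)]] xl by (auto simp: inj_on_def)
    show "p = q"
    proof (cases "e = f")
      case False
      have eqs: "sp (\<tau> x) (e * dirs i) = sp (\<tau> x) (f * dirs i)" using eq x y xy sg_eq by metis
      have "e * dirs i \<noteq> f * dirs i" using False dirs_cases[of i] by auto
      \<comment> \<open>Equal images of different sides mean that \<open>\<tau> x\<close> is
        unsplit. As it is an interior point it lies outside \<open>I1\<close>, hence so does
        \<open>x\<close>, and the two sides of \<open>x\<close> were the same point.\<close>
      then have ns: "\<tau> x \<notin> split_points \<tau>" using eqs by (auto simp: sp_def)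
      have bx: "b < x" "x < b'" using x y xy False by (auto simp: in_ival_def)
      have "in_ival ?u ?v (\<tau> x) 1" "in_ival ?u ?v (\<tau> x) (-1)"
        using img[of x 1] img[of x "-1"] bx dirs_cases[of i] by (auto simp: in_ival_def)
      then have "?u < \<tau> x" "\<tau> x < ?v" by (auto simp: in_ival_def)
      moreover have "0 \<le> ?u" "?v \<le> 1" using uI I1_subset by auto
      ultimately have "\<tau> x \<notin> I1 \<tau>" using ns by (auto simp: split_points_iff)
      then have "x \<notin> split_points \<tau>" using I1_iff[of x] bx b01 by (auto simp: split_points_iff)
      then show ?thesis using x y xy by (simp add: sp_def)
    qed (use x y xy in simp)
  next
    show "sg ` X_interval \<tau> b b' = X_interval \<tau> ?u ?v"
    proof
      show "sg ` X_interval \<tau> b b' \<subseteq> X_interval \<tau> ?u ?v"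
      proof
        fix q assume "q \<in> sg ` X_interval \<tau> b b'"
        then obtain p where p: "p \<in> X_interval \<tau> b b'" "q = sg p" by blast
        obtain x e where x: "p = sp x e" "in_ival b b' x e" using p(1) by (rule X_interval_cases[OF _ b])
        have "in_ival ?u ?v (\<tau> x) (e * dirs i)" by (rule img[OF x(2)])
        moreover have "valid (\<tau> x) (e * dirs i)"
          using calculation uI I1_subset by (intro in_ival_valid[of ?u ?v]) auto
        ultimately show "q \<in> X_interval \<tau> ?u ?v" using sp_in_interval[OF _ uI uv] p x sg_eq by metis
      qed
      show "X_interval \<tau> ?u ?v \<subseteq> sg ` X_interval \<tau> b b'"
      proof
        fix q assume "q \<in> X_interval \<tau> ?u ?v"
        then obtain y e where y: "valid y e" "q = sp y e" "in_ival ?u ?v y e" by (rule X_interval_cases[OF _ uI uv])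
        have "connected (\<tau> ` {b..b'})"
          using b01 by (intro connected_continuous_image continuous_on_subset[OF cont]) auto
        moreover have "\<tau> b \<in> \<tau> ` {b..b'}" "\<tau> b' \<in> \<tau> ` {b..b'}" using b(3) by simp_all
        ultimately have "{\<tau> b..\<tau> b'} \<subseteq> \<tau> ` {b..b'}" "{\<tau> b'..\<tau> b} \<subseteq> \<tau> ` {b..b'}"
          using connected_contains_Icc by metis+
        moreover have "y \<in> {\<tau> b..\<tau> b'} \<or> y \<in> {\<tau> b'..\<tau> b}" using y(3) by (auto simp: in_ival_def)
        ultimately have "y \<in> \<tau> ` {b..b'}" by blast
        then obtain x where x: "b \<le> x" "x \<le> b'" "y = \<tau> x" by auto
        have xl: "x \<in> lap i" by (rule lapI[OF x(1,2)])
        have "x = b \<or> b < x" "x = b' \<or> x < b'" using x by auto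
        then have "in_ival b b' x (e * dirs i)"
          using y(3) x dirs_cases[of i] mb by (auto simp: in_ival_def min_def max_def split: if_splits)
        moreover have "e * dirs i * dirs i = e" using dirs_cases[of i] by auto
        ultimately have "in_ival b b' x (e * dirs i)" "q = sg (sp x (e * dirs i))"
          using sg_eq[of x "e * dirs i"] y(2) x(3) by metis+
        then show "q \<in> sg ` X_interval \<tau> b b'" using sp_in_interval[OF val b] by blast
      qed
    qed
  qed
qed

lemma finite_sg_fiber: "finite {p. p \<in> X \<and> sg p = q}"
proof (rule finite_subset)
  show "{p. p \<in> X \<and> sg p = q} \<subseteq> {x\<in>{0..1}. \<tau> x = fst q} \<times> {-1, 0, 1}"
  proof
    fix p assume "p \<in> {p. p \<in> X \<and> sg p = q}"
    then have p: "p \<in> X" "sg p = q" by auto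
    have "\<tau> (fst p) = fst q" using p(2) fst_sg by metis
    moreover have "snd p \<in> {-1, 0, 1}" using p(1) by (auto simp: X_space_def)
    ultimately show "p \<in> {x\<in>{0..1}. \<tau> x = fst q} \<times> {-1, 0, 1}" using X_01[OF p(1)] by (auto simp: mem_Times_iff)
  qed
qed (use finite_fiber in auto)

text \<open>Injectivity on the interval leaves one point of each fibre over the image interval and
  none elsewhere, so the operator merely moves the endpoints.\<close>

lemma transfer_op_interval:
  assumes b: "b \<in> I1 \<tau>" "b' \<in> I1 \<tau>" "b < b'" and i: "Suc i < length as" "b \<in> lap i" "b' \<in> lap i"
  shows "transfer_op \<tau> (indicator (X_interval \<tau> b b')) =
     indicator (X_interval \<tau> (min (\<tau> b) (\<tau> b')) (max (\<tau> b) (\<tau> b')))"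
proof
  fix q
  let ?I = "X_interval \<tau> b b'" and ?J = "X_interval \<tau> (min (\<tau> b) (\<tau> b')) (max (\<tau> b) (\<tau> b'))"
  note bij = bij_interval[OF b i]
  have "transfer_op \<tau> (indicator ?I) q = (\<Sum>p | p \<in> X \<and> sg p = q. if p \<in> ?I then 1 else 0)"
    unfolding transfer_op_eq by (intro sum.cong) (auto simp: indicator_def)
  also have "\<dots> = (\<Sum>p\<in>{p. p \<in> X \<and> sg p = q} \<inter> ?I. 1)"
    by (rule sum.inter_restrict[symmetric, OF finite_sg_fiber])
  also have "{p. p \<in> X \<and> sg p = q} \<inter> ?I = {p \<in> ?I. sg p = q}" using X_interval_subset by blast
  also have "(\<Sum>p\<in>{p \<in> ?I. sg p = q}. 1) = (indicator ?J q :: int)"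
  proof (cases "q \<in> ?J")
    case True
    then have "q \<in> sg ` ?I" using bij_betw_imp_surj_on[OF bij] by blast
    then obtain p where p: "p \<in> ?I" "sg p = q" by blast
    then have "{p \<in> ?I. sg p = q} = {p}" using bij by (auto simp: bij_betw_def inj_on_def)
    then show ?thesis using True by simp
  next
    case False
    then have "{p \<in> ?I. sg p = q} = {}" using bij by (auto simp: bij_betw_def)
    then show ?thesis using False by (simp only: sum.empty indicator_simps(2) not_False_eq_True)
  qed
  finally show "transfer_op \<tau> (indicator ?I) q = indicator ?J q" .
qed

end

section \<open>Eigenfunctionals of finite-to-one maps\<close>

lemma sum_power_le:
  fixes x :: real
  assumes "0 \<le> x" "x < 1"
  shows "(\<Sum>n<K. x ^ n) \<le> 1 / (1 - x)"
proof -
  have "(\<Sum>n<K. x ^ n) = (1 - x ^ K) / (1 - x)" using assms by (simp add: sum_gp_strict)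
  also have "\<dots> \<le> 1 / (1 - x)" using assms by (intro divide_right_mono) auto
  finally show ?thesis .
qed

text \<open>Tychonoff's theorem for the product of the intervals \<open>{- b f..b f}\<close>. A
  filter finer than \<open>sequentially\<close> replaces a subsequence, since the index set of all
  \<open>f\<close> need not be countable.\<close>

lemma pointwise_cluster_filter:
  fixes w :: "nat \<Rightarrow> 'a \<Rightarrow> real"
  assumes bnd: "\<And>m f. \<bar>w m f\<bar> \<le> b f"
  obtains G \<omega> where "G \<noteq> bot" "G \<le> sequentially" "\<And>f. ((\<lambda>m. w m f) \<longlongrightarrow> \<omega> f) G"
proof -
  define U where "U = PiE UNIV (\<lambda>f. {- b f..b f})"
  have "compactin (product_topology (\<lambda>f::'a. euclideanreal) UNIV) U"
    unfolding U_def by (subst compactin_PiE) simp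
  then have "compact U" by (simp add: euclidean_product_topology)
  moreover have "eventually (\<lambda>x. x \<in> U) (filtermap w sequentially)"
    unfolding eventually_filtermap U_def using bnd by (intro always_eventually) (auto simp: abs_le_iff minus_le_iff)
  moreover have "filtermap w sequentially \<noteq> bot" by (simp add: filtermap_bot_iff)
  ultimately obtain \<omega> where \<omega>: "inf (nhds \<omega>) (filtermap w sequentially) \<noteq> bot"
    unfolding compact_filter by blast
  define G where "G = inf sequentially (filtercomap w (nhds \<omega>))"
  have "G \<noteq> bot"
  proof
    assume "G = bot"
    then have "eventually (\<lambda>_. False) (inf sequentially (filtercomap w (nhds \<omega>)))"
      by (simp add: G_def)
    then obtain Q R where QR: "eventually Q sequentially" "eventually R (filtercomap w (nhds \<omega>))" "\<And>m. Q m \<Longrightarrow> R m \<Longrightarrow> False"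
      unfolding eventually_inf by blast
    obtain R' where R': "eventually R' (nhds \<omega>)" "\<And>m. R' (w m) \<Longrightarrow> R m"
      using QR(2) unfolding eventually_filtercomap by blast
    have "eventually (\<lambda>x. \<not> R' x) (filtermap w sequentially)"
      unfolding eventually_filtermap using QR(1) by eventually_elim (use QR(3) R'(2) in blast)
    then have "eventually (\<lambda>_. False) (inf (nhds \<omega>) (filtermap w sequentially))"
      unfolding eventually_inf using R'(1) by blast
    then show False using \<omega> by (simp add: trivial_limit_def)
  qed
  moreover have "G \<le> sequentially" by (simp add: G_def)
  moreover have "((\<lambda>m. w m f) \<longlongrightarrow> \<omega> f) G" for f
  proof -
    have "filterlim w (nhds \<omega>) G"
      by (rule filterlim_mono[OF filterlim_filtercomap[of w "nhds \<omega>"] order_refl]) (simp add: G_def)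
    moreover have "filterlim (\<lambda>x :: 'a \<Rightarrow> real. x f) (nhds (\<omega> f)) (nhds \<omega>)"
    proof (rule topological_tendstoI)
      fix A :: "real set" assume A: "open A" "\<omega> f \<in> A"
      have "open ((\<lambda>x :: 'a \<Rightarrow> real. x f) -` A)"
        by (rule open_vimage[OF A(1) continuous_on_product_coordinates])
      then show "eventually (\<lambda>x. x f \<in> A) (nhds \<omega>)" using A(2) unfolding eventually_nhds by auto
    qed
    ultimately show ?thesis by (rule filterlim_compose[rotated])
  qed
  ultimately show ?thesis by (rule that)
qed

text \<open>Pure counting: bounded fibres make the resolvent converge for small parameters, and the
  one point \<open>z0\<close> with exponentially many preimages makes it diverge before 1.\<close>

locale finite_to_one =
  fixes Y :: "'a set" and s :: "'a \<Rightarrow> 'a" and N :: nat and z0 :: 'a and M :: nat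
  assumes sY: "p \<in> Y \<Longrightarrow> s p \<in> Y"
    and fin: "finite {p\<in>Y. s p = q}" and cardN: "card {p\<in>Y. s p = q} \<le> N"
    and z0: "z0 \<in> Y" and M: "M \<ge> 1" and growth: "\<And>k. 2 ^ k \<le> card {p\<in>Y. (s ^^ (M * k)) p = z0}"
begin

definition fib :: "nat \<Rightarrow> 'a \<Rightarrow> 'a set" where "fib n q = {p\<in>Y. (s ^^ n) p = q}"

definition S :: "nat \<Rightarrow> ('a \<Rightarrow> real) \<Rightarrow> 'a \<Rightarrow> real" where "S n f q = (\<Sum>w\<in>fib n q. f w)"

definition c :: "nat \<Rightarrow> 'a \<Rightarrow> real" where "c n q = real (card (fib n q))"

lemma iterY: "p \<in> Y \<Longrightarrow> (s ^^ n) p \<in> Y"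
  by (induction n) (use sY in auto)

lemma fib_Y: "w \<in> fib n q \<Longrightarrow> w \<in> Y"
  by (simp add: fib_def)

lemma fib_add: "fib (m + n) q = (\<Union>v\<in>fib m q. fib n v)"
  using iterY by (auto simp: fib_def funpow_add)

lemma fib_Suc0: "fib (Suc 0) q = {p\<in>Y. s p = q}"
  by (simp add: fib_def)

lemma finite_fib: "finite (fib n q)"
proof (induction n arbitrary: q)
  case 0 show ?case by (rule finite_subset[of _ "{q}"]) (auto simp: fib_def)
next
  case (Suc n)
  have "fib (Suc n) q = (\<Union>v\<in>fib (Suc 0) q. fib n v)" using fib_add[of "Suc 0" n q] by simp
  then show ?case using Suc fin by (simp add: fib_Suc0)
qed

lemma S_add: "S (m + n) f q = S m (S n f) q"
  unfolding S_def fib_add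
proof (rule sum.UNION_disjoint)
  show "\<forall>i\<in>fib m q. \<forall>j\<in>fib m q. i \<noteq> j \<longrightarrow> fib n i \<inter> fib n j = {}" by (auto simp: fib_def)
qed (use finite_fib in auto)

lemma c_eq: "c n q = S n (\<lambda>_. 1) q"
  by (simp add: c_def S_def)

lemma c_add: "c (m + n) q = (\<Sum>v\<in>fib m q. c n v)"
  unfolding c_eq S_add by (simp add: S_def c_eq)

lemma c_nonneg [simp]: "0 \<le> c n q"
  by (simp add: c_def)

lemma c_0: "q \<in> Y \<Longrightarrow> c 0 q = 1"
proof -
  assume "q \<in> Y"
  then have "fib 0 q = {q}" by (auto simp: fib_def)
  then show ?thesis by (simp add: c_def)
qed

lemma c_le: "c n q \<le> real N ^ n"
proof (induction n arbitrary: q)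
  case 0
  have "card (fib 0 q) \<le> card {q}" by (rule card_mono) (auto simp: fib_def)
  then show ?case by (simp add: c_def)
next
  case (Suc n)
  have "c (Suc n) q = (\<Sum>v\<in>fib (Suc 0) q. c n v)" using c_add[of "Suc 0" n q] by simp
  also have "\<dots> \<le> (\<Sum>v\<in>fib (Suc 0) q. real N ^ n)" by (intro sum_mono Suc)
  also have "\<dots> = real (card (fib (Suc 0) q)) * real N ^ n" by simp
  also have "\<dots> \<le> real N * real N ^ n" using cardN by (intro mult_right_mono) (auto simp: fib_Suc0)
  finally show ?case by simp
qed

lemma S_bound:
  assumes "\<And>p. p \<in> Y \<Longrightarrow> \<bar>f p\<bar> \<le> C"
  shows "\<bar>S n f q\<bar> \<le> C * c n q"
proof -
  have "\<bar>S n f q\<bar> \<le> (\<Sum>w\<in>fib n q. \<bar>f w\<bar>)" unfolding S_def by (rule sum_abs)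
  also have "\<dots> \<le> (\<Sum>w\<in>fib n q. C)" using assms fib_Y by (intro sum_mono) blast
  finally show ?thesis by (simp add: c_def mult.commute)
qed

text \<open>The parameters at which the resolvent of the constant 1 is bounded uniformly over
  \<open>Y\<close>. The reciprocal of the supremum will be the eigenvalue.\<close>

definition T :: "real set" where
  "T = {t. 0 \<le> t \<and> (\<exists>B. \<forall>q\<in>Y. \<forall>K. (\<Sum>n<K. t ^ n * c n q) \<le> B)}"

lemma T_term_bound:
  assumes "t \<in> T"
  obtains B where "\<And>q K. q \<in> Y \<Longrightarrow> (\<Sum>n<K. t ^ n * c n q) \<le> B"
    "\<And>q n. q \<in> Y \<Longrightarrow> t ^ n * c n q \<le> B" "B \<ge> 1"
proof -
  obtain B where t0: "0 \<le> t" and B: "\<forall>q\<in>Y. \<forall>K. (\<Sum>n<K. t ^ n * c n q) \<le> B"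
    using assms by (auto simp: T_def)
  have "t ^ n * c n q \<le> B" if "q \<in> Y" for q n
  proof -
    have "t ^ n * c n q \<le> (\<Sum>n<Suc n. t ^ n * c n q)"
      using t0 by (intro member_le_sum) auto
    then show ?thesis using B that by (meson order_trans)
  qed
  moreover from this[OF z0, of 0] have "B \<ge> 1" using c_0[OF z0] by simp
  ultimately show ?thesis using that B by blast
qed

text \<open>Single terms of the series stay bounded, and at \<open>z0\<close> the term with index
  \<open>M * k\<close> is at least the \<open>k\<close>-th power of \<open>2 * t ^ M\<close>. This
  bound is what puts the eigenvalue above 1.\<close>

lemma T_le: "t \<in> T \<Longrightarrow> t \<le> root M (1/2)"
proof -
  assume t: "t \<in> T"
  obtain B where B: "\<And>q n. q \<in> Y \<Longrightarrow> t ^ n * c n q \<le> B" by (rule T_term_bound[OF t]) blast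
  have t0: "0 \<le> t" using t by (simp add: T_def)
  have "2 * t ^ M \<le> 1"
  proof (rule ccontr)
    assume "\<not> 2 * t ^ M \<le> 1"
    then obtain k where k: "B < (2 * t ^ M) ^ k" using real_arch_pow[of "2 * t ^ M" B] by auto
    have "(2 * t ^ M) ^ k = 2 ^ k * t ^ (M * k)" by (simp add: power_mult_distrib power_mult)
    also have "\<dots> \<le> c (M * k) z0 * t ^ (M * k)"
    proof (rule mult_right_mono)
      have "real (2 ^ k) \<le> c (M * k) z0" unfolding c_def fib_def by (rule of_nat_mono[OF growth])
      then show "2 ^ k \<le> c (M * k) z0" by simp
    qed (use t0 in simp)
    also have "\<dots> \<le> B" using B[OF z0, of "M * k"] by (simp add: mult.commute)
    finally show False using k by simp
  qed
  then have "t ^ M \<le> 1/2" by simp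
  then have "root M (t ^ M) \<le> root M (1/2)" using M by simp
  then show ?thesis using t0 M by (simp add: real_root_power_cancel)
qed

lemma root_less_1: "root M (1/2) < 1"
  using M real_root_less_iff[of M "1/2" 1] by simp

lemma T_pos: "\<exists>t\<in>T. 0 < t"
proof -
  \<comment> \<open>Chosen so that \<open>t * N \<le> 1/2\<close>, which makes the geometric series
    sum to at most 2; the summand 1 guards against \<open>N = 0\<close>.\<close>
  define t where "t = 1 / (2 * (real N + 1))"
  have t0: "0 < t" by (simp add: t_def)
  have "(\<Sum>n<K. t ^ n * c n q) \<le> 2" for K q
  proof -
    have "(\<Sum>n<K. t ^ n * c n q) \<le> (\<Sum>n<K. (1/2) ^ n)"
    proof (rule sum_mono)
      fix n
      have "t ^ n * c n q \<le> t ^ n * real N ^ n" using t0 c_le by (intro mult_left_mono) auto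
      also have "\<dots> = (t * real N) ^ n" by (simp add: power_mult_distrib)
      also have "\<dots> \<le> (1/2) ^ n" using t0 by (intro power_mono) (auto simp: t_def field_simps)
      finally show "t ^ n * c n q \<le> (1/2) ^ n" .
    qed
    also have "\<dots> \<le> 2" using sum_power_le[of "1/2" K] by simp
    finally show ?thesis .
  qed
  then have "t \<in> T" using t0 by (auto simp: T_def)
  then show ?thesis using t0 by blast
qed

text \<open>With \<open>B\<close> bounding all partial sums, the tails of the series decay like \<open>(1 - 1/B)\<^sup>n\<close>.\<close>

lemma T_open:
  assumes t: "t \<in> T" "0 < t" shows "\<exists>t'\<in>T. t < t'"
proof -
  obtain B where B: "\<And>q K. q \<in> Y \<Longrightarrow> (\<Sum>n<K. t ^ n * c n q) \<le> B" and B1: "B \<ge> 1"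
    by (rule T_term_bound[OF t(1)]) blast
  define r where "r = 1 - 1 / B"
  have r: "0 \<le> r" "r < 1" using B1 by (auto simp: r_def)
  \<comment> \<open>Splitting the fibres at time \<open>n\<close> bounds the tail by
    \<open>B\<close> times its first term. Each tail therefore loses at least the fraction
    \<open>1 / B\<close> of itself when that term is removed.\<close>
  have tail: "(\<Sum>j\<in>{n..<K}. t ^ j * c j q) \<le> B * (t ^ n * c n q)" if q: "q \<in> Y" and n: "n \<le> K" for q n K
  proof -
    have "(\<Sum>j\<in>{n..<K}. t ^ j * c j q) = (\<Sum>j<K - n. t ^ (n + j) * c (n + j) q)"
      using n by (intro sum.reindex_bij_witness[of _ "\<lambda>j. n + j" "\<lambda>j. j - n"]) auto
    also have "\<dots> = (\<Sum>j<K - n. \<Sum>v\<in>fib n q. t ^ n * (t ^ j * c j v))"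
      by (simp add: c_add power_add sum_distrib_left mult.assoc)
    also have "\<dots> = (\<Sum>v\<in>fib n q. t ^ n * (\<Sum>j<K - n. t ^ j * c j v))"
      by (subst sum.swap) (simp add: sum_distrib_left)
    also have "\<dots> \<le> (\<Sum>v\<in>fib n q. t ^ n * B)"
      using t B fib_Y by (intro sum_mono mult_left_mono) auto
    also have "\<dots> = B * (t ^ n * c n q)" by (simp add: c_def)
    finally show ?thesis .
  qed
  have decay: "(\<Sum>j\<in>{n..<K}. t ^ j * c j q) \<le> B * r ^ n" if q: "q \<in> Y" and n: "n \<le> K" for q n K
    using n
  proof (induction n)
    case 0 then show ?case using B[OF q, of K] by (simp add: atLeast0LessThan)
  next
    case (Suc n)
    let ?R = "\<lambda>n. \<Sum>j\<in>{n..<K}. t ^ j * c j q"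
    have "?R n = t ^ n * c n q + ?R (Suc n)" using Suc.prems by (simp add: sum.atLeast_Suc_lessThan)
    moreover have "?R n / B \<le> t ^ n * c n q" using tail[OF q, of n K] Suc.prems B1 by (simp add: field_simps)
    moreover have "r * ?R n = ?R n - ?R n / B" by (simp add: r_def algebra_simps)
    ultimately have "?R (Suc n) \<le> r * ?R n" by linarith
    also have "\<dots> \<le> r * (B * r ^ n)" using Suc r by (intro mult_left_mono) auto
    finally show ?case by (simp add: mult_ac)
  qed
  have decay1: "t ^ n * c n q \<le> B * r ^ n" if "q \<in> Y" for n q
    using decay[OF that, of n "Suc n"] by simp
  \<comment> \<open>Any factor strictly between 1 and \<open>1 / r\<close> would do if
    \<open>r > 0\<close>; this one also covers \<open>r = 0\<close>.\<close>
  define g where "g = 2 / (1 + r)"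
  have g: "1 < g" "0 \<le> g * r" "g * r < 1" using r by (auto simp: g_def field_simps)
  have "(\<Sum>n<K. (g * t) ^ n * c n q) \<le> B * (1 / (1 - g * r))" if q: "q \<in> Y" for q K
  proof -
    have "(\<Sum>n<K. (g * t) ^ n * c n q) \<le> (\<Sum>n<K. B * (g * r) ^ n)"
    proof (rule sum_mono)
      fix n
      have "g ^ n * (t ^ n * c n q) \<le> g ^ n * (B * r ^ n)" using decay1[OF q] g by (intro mult_left_mono) auto
      then show "(g * t) ^ n * c n q \<le> B * (g * r) ^ n" by (simp add: power_mult_distrib mult_ac)
    qed
    also have "\<dots> = B * (\<Sum>n<K. (g * r) ^ n)" by (simp add: sum_distrib_left)
    also have "\<dots> \<le> B * (1 / (1 - g * r))" using sum_power_le[OF g(2,3)] B1 by (intro mult_left_mono) auto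
    finally show ?thesis .
  qed
  then have "g * t \<in> T" using g t by (auto simp: T_def)
  moreover have "t < g * t" using g t by simp
  ultimately show ?thesis by blast
qed

lemma T_down: "t \<in> T \<Longrightarrow> 0 \<le> u \<Longrightarrow> u \<le> t \<Longrightarrow> u \<in> T"
proof -
  assume t: "t \<in> T" "0 \<le> u" "u \<le> t"
  then obtain B where B: "\<forall>q\<in>Y. \<forall>K. (\<Sum>n<K. t ^ n * c n q) \<le> B" by (auto simp: T_def)
  have "(\<Sum>n<K. u ^ n * c n q) \<le> (\<Sum>n<K. t ^ n * c n q)" for K q
    using t by (intro sum_mono mult_right_mono power_mono) auto
  then have "\<forall>q\<in>Y. \<forall>K. (\<Sum>n<K. u ^ n * c n q) \<le> B" using B by (meson order_trans)
  then show ?thesis using t(2) unfolding T_def by blast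
qed

definition t0 :: real where "t0 = Sup T"

lemma T_bdd: "bdd_above T"
  using T_le by (rule bdd_aboveI)

lemma t0_pos: "0 < t0" and t0_less: "t0 < 1" and t0_notin: "t0 \<notin> T"
proof -
  obtain t where t: "t \<in> T" "0 < t" using T_pos by blast
  then have "t \<le> t0" unfolding t0_def by (intro cSup_upper T_bdd)
  then show pos: "0 < t0" using t by simp
  have "t0 \<le> root M (1/2)" unfolding t0_def using t T_le by (intro cSup_least) auto
  then show "t0 < 1" using root_less_1 by simp
  show "t0 \<notin> T"
  proof
    assume "t0 \<in> T"
    then obtain t' where "t' \<in> T" "t0 < t'" using T_open pos by blast
    then show False using cSup_upper[OF _ T_bdd, of t'] by (simp add: t0_def)
  qed
qed

lemma below_t0: "0 \<le> t \<Longrightarrow> t < t0 \<Longrightarrow> t \<in> T"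
proof -
  assume t: "0 \<le> t" "t < t0"
  have "T \<noteq> {}" using T_pos by blast
  then obtain u where "u \<in> T" "t < u" using t(2) less_cSup_iff[OF _ T_bdd] unfolding t0_def by blast
  then show ?thesis using T_down[of u t] t by simp
qed

text \<open>As \<open>t0\<close> is not in \<open>T\<close>, partial sums at \<open>t0\<close>
  exceed every bound for suitable base points. A partial sum is continuous in the parameter, so the
  excess persists slightly below \<open>t0\<close>, where the full series still converges.\<close>

lemma near_t0: "\<exists>t q K. 0 < t \<and> t < t0 \<and> t0 - 1 / (real m + 1) < t \<and> q \<in> Y \<and> real m < (\<Sum>n<K. t ^ n * c n q)"
proof -
  have "\<not> (\<exists>B. \<forall>q\<in>Y. \<forall>K. (\<Sum>n<K. t0 ^ n * c n q) \<le> B)"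
    using t0_notin t0_pos unfolding T_def by simp
  then have "\<not> (\<forall>q\<in>Y. \<forall>K. (\<Sum>n<K. t0 ^ n * c n q) \<le> real m)" by blast
  then obtain q K where q: "q \<in> Y" "real m < (\<Sum>n<K. t0 ^ n * c n q)" by (auto simp: not_le)
  have "isCont (\<lambda>t. \<Sum>n<K. t ^ n * c n q) t0" by (intro continuous_intros)
  then have "((\<lambda>t. \<Sum>n<K. t ^ n * c n q) \<longlongrightarrow> (\<Sum>n<K. t0 ^ n * c n q)) (at_left t0)"
    unfolding isCont_def by (rule filterlim_mono) (auto simp: at_within_le_at)
  then have "eventually (\<lambda>t. real m < (\<Sum>n<K. t ^ n * c n q)) (at_left t0)"
    using q(2) by (rule order_tendstoD)
  moreover have "eventually (\<lambda>t. t \<in> {max 0 (t0 - 1 / (real m + 1))<..<t0}) (at_left t0)"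
    using t0_pos by (intro eventually_at_left_real) simp
  ultimately have "eventually (\<lambda>t. real m < (\<Sum>n<K. t ^ n * c n q) \<and> t \<in> {max 0 (t0 - 1 / (real m + 1))<..<t0}) (at_left t0)"
    by (rule eventually_conj)
  then obtain t where "real m < (\<Sum>n<K. t ^ n * c n q)" "t \<in> {max 0 (t0 - 1 / (real m + 1))<..<t0}"
    using eventually_happens'[OF trivial_limit_at_left_real] by blast
  then show ?thesis using q(1) by (intro exI[of _ t] exI[of _ q] exI[of _ K]) auto
qed

section \<open>The resolvent and its limit at the critical parameter\<close>

definition bdd :: "('a \<Rightarrow> real) \<Rightarrow> bool" where "bdd f \<longleftrightarrow> (\<exists>C. \<forall>p\<in>Y. \<bar>f p\<bar> \<le> C)"

lemma summable_S:
  assumes t: "t \<in> T" and q: "q \<in> Y" and f: "bdd f"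
  shows "summable (\<lambda>n. t ^ n * S n f q)"
proof -
  obtain C where C: "\<And>p. p \<in> Y \<Longrightarrow> \<bar>f p\<bar> \<le> C" using f by (auto simp: bdd_def)
  obtain B where B: "\<And>K. (\<Sum>n<K. t ^ n * c n q) \<le> B" by (rule T_term_bound[OF t]) (use q in blast)
  have t0: "0 \<le> t" using t by (simp add: T_def)
  have "summable (\<lambda>n. t ^ n * c n q)"
  proof (rule bounded_imp_summable)
    show "(\<Sum>k\<le>n. t ^ k * c k q) \<le> B" for n using B[of "Suc n"] unfolding lessThan_Suc_atMost .
  qed (use t0 in simp)
  then have "summable (\<lambda>n. C * (t ^ n * c n q))" by (rule summable_mult)
  moreover have "norm (t ^ n * S n f q) \<le> C * (t ^ n * c n q)" for n
  proof -
    have "\<bar>S n f q\<bar> \<le> C * c n q" by (rule S_bound[OF C])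
    then have "t ^ n * \<bar>S n f q\<bar> \<le> t ^ n * (C * c n q)" using t0 by (intro mult_left_mono) auto
    then show ?thesis using t0 by (simp add: abs_mult mult_ac)
  qed
  ultimately show ?thesis by (rule summable_comparison_test'[where N=0])
qed

definition W :: "real \<Rightarrow> 'a \<Rightarrow> ('a \<Rightarrow> real) \<Rightarrow> real" where
  "W t q f = (\<Sum>n. t ^ n * S n f q)"

lemma bdd_one: "bdd (\<lambda>_. 1)" by (auto simp: bdd_def)

lemma W_bound:
  assumes t: "t \<in> T" and q: "q \<in> Y" and C: "\<And>p. p \<in> Y \<Longrightarrow> \<bar>f p\<bar> \<le> C"
  shows "\<bar>W t q f\<bar> \<le> C * W t q (\<lambda>_. 1)"
proof -
  have f: "bdd f" using C by (auto simp: bdd_def)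
  have t0: "0 \<le> t" using t by (simp add: T_def)
  have le: "\<bar>t ^ n * S n f q\<bar> \<le> C * (t ^ n * S n (\<lambda>_. 1) q)" for n
  proof -
    have "\<bar>S n f q\<bar> \<le> C * c n q" by (rule S_bound[OF C])
    then have "t ^ n * \<bar>S n f q\<bar> \<le> t ^ n * (C * c n q)" using t0 by (intro mult_left_mono) auto
    then show ?thesis using t0 by (simp add: abs_mult mult_ac c_eq)
  qed
  have s1: "summable (\<lambda>n. C * (t ^ n * S n (\<lambda>_. 1) q))"
    by (intro summable_mult summable_S[OF t q bdd_one])
  then have sa: "summable (\<lambda>n. \<bar>t ^ n * S n f q\<bar>)"
    by (rule summable_comparison_test'[where N=0]) (use le in simp)
  have "\<bar>W t q f\<bar> \<le> (\<Sum>n. \<bar>t ^ n * S n f q\<bar>)" unfolding W_def by (rule summable_rabs[OF sa])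
  also have "\<dots> \<le> (\<Sum>n. C * (t ^ n * S n (\<lambda>_. 1) q))" by (rule suminf_le[OF le sa s1])
  also have "\<dots> = C * W t q (\<lambda>_. 1)" unfolding W_def by (rule suminf_mult[OF summable_S[OF t q bdd_one]])
  finally show ?thesis .
qed

lemma bdd_S: "bdd f \<Longrightarrow> bdd (S (Suc 0) f)"
proof -
  assume "bdd f"
  then obtain C where C: "\<And>p. p \<in> Y \<Longrightarrow> \<bar>f p\<bar> \<le> C" by (auto simp: bdd_def)
  have "C \<ge> 0" using C[OF z0] by linarith
  then have "C * c (Suc 0) q \<le> C * real N" for q using c_le[of "Suc 0" q] by (intro mult_left_mono) auto
  then have "\<bar>S (Suc 0) f q\<bar> \<le> C * real N" for q using S_bound[where n="Suc 0" and q=q, OF C] by (meson order_trans)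
  then show ?thesis by (auto simp: bdd_def)
qed

text \<open>The resolvent identity: up to the factor \<open>t\<close>, summing over preimages
  changes the resolvent only by the term of time 0. That term is the defect from being an
  eigenfunctional.\<close>

lemma W_shift:
  assumes t: "t \<in> T" and q: "q \<in> Y" and f: "bdd f"
  shows "t * W t q (S (Suc 0) f) = W t q f - f q"
proof -
  have "S n (S (Suc 0) f) q = S (Suc n) f q" for n using S_add[of n "Suc 0" f q] by simp
  then have "t * W t q (S (Suc 0) f) = t * (\<Sum>n. t ^ n * S (Suc n) f q)" unfolding W_def by simp
  also have "\<dots> = (\<Sum>n. t ^ Suc n * S (Suc n) f q)"
    using summable_S[OF t q bdd_S[OF f]] S_add[of _ "Suc 0" f q]
    by (subst suminf_mult[symmetric]) (simp_all add: mult.assoc)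
  also have "\<dots> = W t q f - t ^ 0 * S 0 f q"
    unfolding W_def by (rule suminf_split_head[OF summable_S[OF t q f]])
  also have "S 0 f q = f q"
  proof -
    have "fib 0 q = {q}" using q by (auto simp: fib_def)
    then show ?thesis by (simp add: S_def)
  qed
  finally show ?thesis by simp
qed

lemma W_add:
  assumes "t \<in> T" "q \<in> Y" "bdd f" "bdd g"
  shows "W t q (\<lambda>p. f p + g p) = W t q f + W t q g"
proof -
  have "t ^ n * S n (\<lambda>p. f p + g p) q = t ^ n * S n f q + t ^ n * S n g q" for n
    by (simp add: S_def sum.distrib algebra_simps)
  then show ?thesis unfolding W_def using assms by (simp add: suminf_add summable_S)
qed

lemma W_nonneg:
  assumes "t \<in> T" "q \<in> Y" "bdd f" "\<And>p. p \<in> Y \<Longrightarrow> 0 \<le> f p"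
  shows "0 \<le> W t q f"
  unfolding W_def
proof (rule suminf_nonneg[OF summable_S[OF assms(1-3)]])
  fix n
  have "0 \<le> S n f q" unfolding S_def using assms(4) fib_Y by (intro sum_nonneg) blast
  then show "0 \<le> t ^ n * S n f q" using assms(1) by (simp add: T_def)
qed

definition eigenfunctional :: "real \<Rightarrow> (('a \<Rightarrow> real) \<Rightarrow> real) \<Rightarrow> bool" where
  "eigenfunctional l \<omega> \<longleftrightarrow> (\<forall>f g. bdd f \<longrightarrow> bdd g \<longrightarrow> \<omega> (\<lambda>p. f p + g p) = \<omega> f + \<omega> g) \<and>
     (\<forall>f. bdd f \<longrightarrow> (\<forall>p\<in>Y. 0 \<le> f p) \<longrightarrow> 0 \<le> \<omega> f) \<and> \<omega> (\<lambda>_. 1) = 1 \<and>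
     (\<forall>f. bdd f \<longrightarrow> \<omega> (S (Suc 0) f) = l * \<omega> f)"

theorem eigenfunctional_exists: "\<exists>l>1. \<exists>\<omega>. eigenfunctional l \<omega>"
proof -
  have "\<forall>m. \<exists>t q. 0 < t \<and> t < t0 \<and> t0 - 1 / (real m + 1) < t \<and> q \<in> Y \<and> (\<exists>K. real m < (\<Sum>n<K. t ^ n * c n q))"
    using near_t0 by blast
  then obtain t q where tq: "\<And>m. 0 < t m" "\<And>m. t m < t0" "\<And>m. t0 - 1 / (real m + 1) < t m" "\<And>m. q m \<in> Y"
      "\<And>m. \<exists>K. real m < (\<Sum>n<K. t m ^ n * c n (q m))" by metis
  have tT: "t m \<in> T" for m using below_t0[of "t m"] tq(1,2)[of m] by simp
  define \<Phi> where "\<Phi> = (\<lambda>m. W (t m) (q m) (\<lambda>_. 1))"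
  have \<Phi>: "real m < \<Phi> m" for m
  proof -
    obtain K where K: "real m < (\<Sum>n<K. t m ^ n * c n (q m))" using tq(5) by blast
    also have "\<dots> \<le> \<Phi> m" unfolding \<Phi>_def W_def c_eq
      using tq(1)[of m] by (intro sum_le_suminf summable_S[OF tT tq(4) bdd_one]) (auto simp: S_def)
    finally show ?thesis .
  qed
  have \<Phi>0: "0 < \<Phi> m" for m using \<Phi>[of m] by (meson le_less_trans of_nat_0_le_iff)
  \<comment> \<open>The value 0 for unbounded \<open>f\<close> gives every \<open>f\<close> a bound
    valid for all \<open>m\<close>, as \<open>pointwise_cluster_filter\<close> demands.\<close>
  define w where "w = (\<lambda>m f. if bdd f then W (t m) (q m) f / \<Phi> m else 0)"
  have "\<exists>C. \<forall>m. \<bar>w m f\<bar> \<le> C" for f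
  proof (cases "bdd f")
    case True
    then obtain C where C: "\<And>p. p \<in> Y \<Longrightarrow> \<bar>f p\<bar> \<le> C" by (auto simp: bdd_def)
    have "\<bar>w m f\<bar> \<le> C" for m
      using W_bound[OF tT[of m] tq(4)[of m] C] \<Phi>0[of m] True by (simp add: w_def \<Phi>_def field_simps)
    then show ?thesis by blast
  qed (auto simp: w_def intro: exI[of _ 0])
  then obtain b where b: "\<And>m f. \<bar>w m f\<bar> \<le> b f" by metis
  obtain G \<omega> where G: "G \<noteq> bot" "G \<le> sequentially" "\<And>f. ((\<lambda>m. w m f) \<longlongrightarrow> \<omega> f) G"
    by (rule pointwise_cluster_filter[of w b, OF b]) blast
  have lim_t: "(t \<longlongrightarrow> t0) G"
  proof -
    have "(\<lambda>m. 1 / (real m + 1)) \<longlonglongrightarrow> 0"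
      using LIMSEQ_inverse_real_of_nat by (simp add: inverse_eq_divide add.commute)
    then have "(\<lambda>m. t0 - 1 / (real m + 1)) \<longlonglongrightarrow> t0 - 0" by (intro tendsto_intros)
    then have "t \<longlonglongrightarrow> t0"
      using tq(2,3) by (intro real_tendsto_sandwich[of "\<lambda>m. t0 - 1 / (real m + 1)" t sequentially "\<lambda>_. t0"])
        (auto intro!: always_eventually less_imp_le)
    then show ?thesis by (rule filterlim_mono[OF _ order_refl G(2)])
  qed
  have add: "\<omega> (\<lambda>p. f p + g p) = \<omega> f + \<omega> g" if fg: "bdd f" "bdd g" for f g
  proof -
    have "bdd (\<lambda>p. f p + g p)"
    proof -
      obtain C1 where "\<And>p. p \<in> Y \<Longrightarrow> \<bar>f p\<bar> \<le> C1" using fg(1) by (auto simp: bdd_def)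
      moreover obtain C2 where "\<And>p. p \<in> Y \<Longrightarrow> \<bar>g p\<bar> \<le> C2" using fg(2) by (auto simp: bdd_def)
      ultimately have "\<bar>f p + g p\<bar> \<le> C1 + C2" if "p \<in> Y" for p
        using that abs_triangle_ineq[of "f p" "g p"] by (smt (verit))
      then show ?thesis by (auto simp: bdd_def)
    qed
    then have "w m (\<lambda>p. f p + g p) = w m f + w m g" for m
      using W_add[OF tT[of m] tq(4)[of m] fg] fg by (simp add: w_def add_divide_distrib)
    then have "((\<lambda>m. w m (\<lambda>p. f p + g p)) \<longlongrightarrow> \<omega> f + \<omega> g) G" using tendsto_add[OF G(3)[of f] G(3)[of g]] by simp
    then show ?thesis by (rule tendsto_unique[OF G(1) G(3)])
  qed
  have pos: "0 \<le> \<omega> f" if f: "bdd f" "\<forall>p\<in>Y. 0 \<le> f p" for f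
  proof (rule tendsto_lowerbound[OF G(3) _ G(1)])
    have "0 \<le> w m f" for m using W_nonneg[OF tT[of m] tq(4)[of m] f(1)] f(2) \<Phi>0[of m] by (simp add: w_def)
    then show "eventually (\<lambda>m. 0 \<le> w m f) G" by simp
  qed
  have one: "\<omega> (\<lambda>_. 1) = 1"
  proof -
    have "w m (\<lambda>_. 1) = 1" for m using bdd_one \<Phi>0[of m] by (simp add: w_def \<Phi>_def)
    then show ?thesis using tendsto_unique[OF G(1) G(3)[of "\<lambda>_. 1"], of 1] by simp
  qed
  have eig: "\<omega> (S (Suc 0) f) = 1 / t0 * \<omega> f" if f: "bdd f" for f
  proof -
    obtain C where C: "\<And>p. p \<in> Y \<Longrightarrow> \<bar>f p\<bar> \<le> C" using f by (auto simp: bdd_def)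
    have C0: "0 \<le> C" using C[OF z0] by linarith
    \<comment> \<open>The defect of the resolvent identity is at most \<open>C\<close>, whereas the
      normalising constant \<open>\<Phi> m\<close> exceeds \<open>m\<close>.\<close>
    have "(\<lambda>m. f (q m) / \<Phi> m) \<longlonglongrightarrow> 0"
    proof (rule Lim_null_comparison)
      show "eventually (\<lambda>m. norm (f (q m) / \<Phi> m) \<le> C / real m) sequentially"
        using eventually_gt_at_top[of 0]
      proof eventually_elim
        case (elim m)
        have "\<bar>f (q m)\<bar> / \<Phi> m \<le> C / real m"
          using C[OF tq(4)[of m]] \<Phi>[of m] \<Phi>0[of m] C0 elim by (intro frac_le) auto
        then show ?case using \<Phi>0[of m] by simp
      qed
      show "(\<lambda>m. C / real m) \<longlonglongrightarrow> 0" by (rule lim_const_over_n)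
    qed
    then have f0: "((\<lambda>m. f (q m) / \<Phi> m) \<longlongrightarrow> 0) G" by (rule filterlim_mono[OF _ order_refl G(2)])
    have "t m * w m (S (Suc 0) f) = w m f - f (q m) / \<Phi> m" for m
      using W_shift[OF tT[of m] tq(4)[of m] f] bdd_S[OF f] f \<Phi>0[of m] by (simp add: w_def field_simps)
    then have "((\<lambda>m. t m * w m (S (Suc 0) f)) \<longlongrightarrow> \<omega> f - 0) G"
      using tendsto_diff[OF G(3)[of f] f0] by simp
    moreover have "((\<lambda>m. t m * w m (S (Suc 0) f)) \<longlongrightarrow> t0 * \<omega> (S (Suc 0) f)) G"
      by (rule tendsto_mult[OF lim_t G(3)])
    ultimately have "t0 * \<omega> (S (Suc 0) f) = \<omega> f" using tendsto_unique[OF G(1)] by fastforce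
    then show ?thesis using t0_pos by (simp add: field_simps)
  qed
  show ?thesis unfolding eigenfunctional_def
    using add pos one eig t0_pos t0_less by (intro exI[of _ "1 / t0"] conjI exI[of _ \<omega>]) auto
qed

end

section \<open>States and their distribution functions\<close>

context trans_map
begin

section \<open>Invariance of \<open>CXZ\<close> under the transfer operator\<close>

definition admissible :: "(point \<Rightarrow> int) \<Rightarrow> bool" where
  "admissible g \<longleftrightarrow> g \<in> CXZ \<tau> \<and> transfer_op \<tau> g \<in> CXZ \<tau> \<and> (\<exists>C. \<forall>p. \<bar>g p\<bar> \<le> C)"

definition cut :: "real \<Rightarrow> real \<Rightarrow> (point \<Rightarrow> int) \<Rightarrow> point \<Rightarrow> int" where
  "cut a b f = (\<lambda>p. if p \<in> X_interval \<tau> a b then f p else 0)"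

lemma admissible_add: "admissible f \<Longrightarrow> admissible g \<Longrightarrow> admissible (\<lambda>p. f p + g p)"
  unfolding admissible_def transfer_op_add
proof (elim conjE exE, intro conjI)
  fix C1 C2 assume "\<forall>p. \<bar>f p\<bar> \<le> C1" "\<forall>p. \<bar>g p\<bar> \<le> C2"
  then have "\<bar>f p + g p\<bar> \<le> C1 + C2" for p using abs_triangle_ineq[of "f p" "g p"] by (smt (verit))
  then show "\<exists>C. \<forall>p. \<bar>f p + g p\<bar> \<le> C" by blast
qed (auto intro: CXZ_add)

lemma admissible_const:
  assumes b: "a \<in> I1 \<tau>" "b \<in> I1 \<tau>" "a < b" and i: "Suc i < length as" "a \<in> lap i" "b \<in> lap i"
    and k: "\<And>p. p \<in> X_interval \<tau> a b \<Longrightarrow> f p = k"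
  shows "admissible (cut a b f)"
proof -
  have eq: "cut a b f = (\<lambda>p. k * indicator (X_interval \<tau> a b) p)"
    using k by (auto simp: cut_def indicator_def)
  have ab: "\<tau> a \<in> I1 \<tau>" "\<tau> b \<in> I1 \<tau>" "\<tau> a \<noteq> \<tau> b"
    using b I1_iff I1_subset mono_lap_less[OF i b(3)] by auto
  then have "indicator (X_interval \<tau> (min (\<tau> a) (\<tau> b)) (max (\<tau> a) (\<tau> b))) \<in> CXZ \<tau>"
    by (intro CXZ_interval) (auto simp: min_def max_def)
  then have "transfer_op \<tau> (cut a b f) \<in> CXZ \<tau>"
    unfolding eq transfer_op_scale transfer_op_interval[OF b i] by (rule CXZ_scale)
  moreover have "cut a b f \<in> CXZ \<tau>" unfolding eq by (intro CXZ_scale CXZ_interval b)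
  moreover have "\<forall>p. \<bar>cut a b f p\<bar> \<le> \<bar>k\<bar>" unfolding eq by (auto simp: indicator_def)
  ultimately show ?thesis unfolding admissible_def by blast
qed

lemma interval_split:
  assumes "a \<in> I1 \<tau>" "b \<in> I1 \<tau>" "g \<in> I1 \<tau>" "a < g" "g < b"
  shows "p \<in> X_interval \<tau> a b \<longleftrightarrow> p \<in> X_interval \<tau> a g \<or> p \<in> X_interval \<tau> g b"
    "\<not> (p \<in> X_interval \<tau> a g \<and> p \<in> X_interval \<tau> g b)"
proof -
  have "(p \<in> X_interval \<tau> a b \<longleftrightarrow> p \<in> X_interval \<tau> a g \<or> p \<in> X_interval \<tau> g b) \<and>
    \<not> (p \<in> X_interval \<tau> a g \<and> p \<in> X_interval \<tau> g b)"
  proof (cases "p \<in> X")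
    case True
    then obtain x e where v: "valid x e" "p = sp x e" by (rule X_cases)
    show ?thesis
      using sp_in_interval[OF v(1) assms(1,2)] sp_in_interval[OF v(1) assms(1,3)] sp_in_interval[OF v(1) assms(3,2)]
        in_ival_split[of a g b x e] assms v by auto
  next
    case False then show ?thesis using X_interval_subset by blast
  qed
  then show "p \<in> X_interval \<tau> a b \<longleftrightarrow> p \<in> X_interval \<tau> a g \<or> p \<in> X_interval \<tau> g b"
    "\<not> (p \<in> X_interval \<tau> a g \<and> p \<in> X_interval \<tau> g b)" by blast+
qed

lemma admissible_split:
  assumes "a \<in> I1 \<tau>" "b \<in> I1 \<tau>" "g \<in> I1 \<tau>" "a < g" "g < b" "admissible (cut a g f)" "admissible (cut g b f)"
  shows "admissible (cut a b f)"
proof -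
  have "cut a b f = (\<lambda>p. cut a g f p + cut g b f p)"
    using interval_split[OF assms(1-5)] by (auto simp: cut_def)
  then show ?thesis using admissible_add[OF assms(6,7)] by simp
qed

lemma const_side:
  assumes f: "f \<in> CXZ \<tau>" and v: "valid x e"
  shows "\<exists>d>0. (\<forall>q\<in>X. fst q \<in> side x e d \<longrightarrow> f q = f (sp x e)) \<and> (\<forall>i. lap_side i x e \<longrightarrow> (\<forall>y\<in>side x e d. y \<in> lap i))"
proof -
  obtain d1 where d1: "d1 > 0" "\<forall>q\<in>X. fst q \<in> side x e d1 \<longrightarrow> f q = f (sp x e)"
    using f v unfolding CXZ_iff by blast
  obtain i where i: "lap_side i x e" using lap_side_ex[OF v] by blast
  define d where "d = min d1 (if e = 1 then as ! Suc i - x else x - as ! i)"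
  have "d > 0" using i d1 by (auto simp: d_def lap_side_def in_ival_def)
  moreover have "\<forall>y\<in>side x e d. y \<in> lap i" using i by (auto simp: lap_side_def lap_def in_ival_def d_def side_def)
  moreover have "\<forall>q\<in>X. fst q \<in> side x e d \<longrightarrow> f q = f (sp x e)" using d1 side_mono[of _ x e d d1] by (auto simp: d_def)
  ultimately show ?thesis using lap_side_unique[OF i] by blast
qed

text \<open>Close to \<open>x\<close> the function is constant on each side and each side lies in
  one lap. An interval straddling \<open>x\<close> is cut at \<open>x\<close> if this point is in
  \<open>I1\<close>.\<close>

lemma admissible_local:
  assumes f: "f \<in> CXZ \<tau>" and x: "x \<in> {0..1}"
  shows "\<exists>d>0. \<forall>a\<in>I1 \<tau>. \<forall>b\<in>I1 \<tau>. a < b \<longrightarrow> x - d < a \<longrightarrow> b < x + d \<longrightarrow> admissible (cut a b f)"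
proof -
  have "\<exists>d>0. valid x e \<longrightarrow> (\<forall>q\<in>X. fst q \<in> side x e d \<longrightarrow> f q = f (sp x e)) \<and> (\<forall>i. lap_side i x e \<longrightarrow> (\<forall>y\<in>side x e d. y \<in> lap i))" for e
    using const_side[OF f, of x e] by (cases "valid x e") (auto intro: exI[of _ 1])
  then obtain D where D: "\<And>e. D e > 0" "\<And>e q. valid x e \<Longrightarrow> q \<in> X \<Longrightarrow> fst q \<in> side x e (D e) \<Longrightarrow> f q = f (sp x e)"
     "\<And>e i y. valid x e \<Longrightarrow> lap_side i x e \<Longrightarrow> y \<in> side x e (D e) \<Longrightarrow> y \<in> lap i"
    by metis
  define d where "d = min (D 1) (D (-1))"
  have one_side: "admissible (cut a b f)"
    if ab: "a \<in> I1 \<tau>" "b \<in> I1 \<tau>" "a < b" "x - d < a" "b < x + d" "valid x e" "e = 1 \<and> x \<le> a \<or> e = -1 \<and> b \<le> x" for a b e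
  proof -
    obtain i where i: "lap_side i x e" using lap_side_ex[OF ab(6)] by blast
    have xi: "x \<in> lap i" using i by (auto simp: lap_side_def lap_def in_ival_def)
    have near: "y \<in> side x e (D e) \<or> y = x" if "a \<le> y" "y \<le> b" for y
      using ab that by (auto simp: side_def d_def)
    show ?thesis
    proof (rule admissible_const[OF ab(1-3), of i _ "f (sp x e)"])
      show "Suc i < length as" using i by (simp add: lap_side_def)
      show "a \<in> lap i" "b \<in> lap i" using near[of a] near[of b] D(3)[OF ab(6) i] xi ab(3) by auto
      fix p assume "p \<in> X_interval \<tau> a b"
      then obtain y e' where p: "valid y e'" "p = sp y e'" "in_ival a b y e'" by (rule X_interval_cases[OF _ ab(1-3)])
      show "f p = f (sp x e)"
      proof (cases "y = x")
        case True
        then have "e' = e" using p(3) ab(7) by (auto simp: in_ival_def)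
        then show ?thesis using True p by simp
      next
        case False
        then have "y \<in> side x e (D e)" using near[of y] p(3) by (auto simp: in_ival_def)
        then show ?thesis using D(2)[OF ab(6) sp_in_X[OF p(1)]] p by simp
      qed
    qed
  qed
  have "admissible (cut a b f)" if ab: "a \<in> I1 \<tau>" "b \<in> I1 \<tau>" "a < b" "x - d < a" "b < x + d" for a b
  proof -
    have ab01: "0 \<le> a" "b \<le> 1" using ab I1_subset by auto
    consider "b \<le> x" | "x \<le> a" | "a < x" "x < b" by linarith
    then show ?thesis
    proof cases
      case 1
      then show ?thesis using one_side[OF ab, of "-1"] ab ab01 x by (auto simp: valid_def)
    next
      case 2
      then show ?thesis using one_side[OF ab, of 1] ab ab01 x by (auto simp: valid_def)
    next
      case 3
      then have v: "valid x 1" "valid x (-1)" using ab01 by (auto simp: valid_def)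
      show ?thesis
      proof (cases "x \<in> I1 \<tau>")
        case True
        show ?thesis
        proof (rule admissible_split[OF ab(1,2) True 3])
          show "admissible (cut a x f)" by (rule one_side[OF ab(1) True, of "-1"]) (use 3 ab v D(1) in \<open>auto simp: d_def\<close>)
          show "admissible (cut x b f)" by (rule one_side[OF True ab(2), of 1]) (use 3 ab v D(1) in \<open>auto simp: d_def\<close>)
        qed
      next
        case False
        \<comment> \<open>An \<open>x\<close> outside \<open>I1\<close> is neither split nor a
          partition point, so both sides carry the same value and lie in the same lap; no cut is
          required.\<close>
        then have eq: "sp x (-1) = sp x 1" by (simp add: sp_def split_points_iff)
        obtain i where i: "lap_side i x 1" using lap_side_ex[OF v(1)] by blast
        then have "x \<noteq> as ! i" using False as_I1[of i] by (auto simp: lap_side_def)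
        then have i': "lap_side i x (-1)" using i by (auto simp: lap_side_def in_ival_def)
        have sd: "a \<in> side x (-1) (D (-1))" "b \<in> side x 1 (D 1)" using 3 ab by (auto simp: side_def d_def)
        show ?thesis
        proof (rule admissible_const[OF ab(1-3), of i _ "f (sp x 1)"])
          show "Suc i < length as" using i by (simp add: lap_side_def)
          show "a \<in> lap i" "b \<in> lap i" using D(3)[OF v(2) i' sd(1)] D(3)[OF v(1) i sd(2)] by auto
          fix p assume "p \<in> X_interval \<tau> a b"
          then obtain y e' where p: "valid y e'" "p = sp y e'" "in_ival a b y e'" by (rule X_interval_cases[OF _ ab(1-3)])
          consider "y = x" | "y \<in> side x 1 (D 1)" | "y \<in> side x (-1) (D (-1))"
            using p(3) ab by (force simp: in_ival_def side_def d_def)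
          then show "f p = f (sp x 1)"
          proof cases
            case 1
            then show ?thesis using p eq by (auto simp: valid_def)
          next
            case 2
            then show ?thesis using D(2)[OF v(1) sp_in_X[OF p(1)]] p by simp
          next
            case 3
            then show ?thesis using D(2)[OF v(2) sp_in_X[OF p(1)]] p eq by simp
          qed
        qed
      qed
    qed
  qed
  moreover have "d > 0" using D(1) by (simp add: d_def)
  ultimately show ?thesis by blast
qed

text \<open>A bisection argument in place of compactness of the split space: the local statement is
  glued over finitely many intervals with endpoints in \<open>I1\<close>. It yields both boundedness
  and the invariance of \<open>CXZ\<close>.\<close>

lemma CXZ_admissible:
  assumes f: "f \<in> CXZ \<tau>" shows "admissible f"
proof -
  define P where "P = (\<lambda>u v. \<forall>a\<in>I1 \<tau>. \<forall>b\<in>I1 \<tau>. u \<le> a \<longrightarrow> a < b \<longrightarrow> b \<le> v \<longrightarrow> admissible (cut a b f))"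
  have "P 0 1"
  proof (rule Bolzano[where P = P])
    fix x :: real assume x: "0 \<le> x" "x \<le> 1"
    then obtain d where d: "d > 0" "\<forall>a\<in>I1 \<tau>. \<forall>b\<in>I1 \<tau>. a < b \<longrightarrow> x - d < a \<longrightarrow> b < x + d \<longrightarrow> admissible (cut a b f)"
      using admissible_local[OF f, of x] by auto
    show "\<exists>d>0. \<forall>a b. a \<le> x \<and> x \<le> b \<and> b - a < d \<longrightarrow> P a b"
      using d by (intro exI[of _ d]) (auto simp: P_def)
  next
    fix u v w assume uv: "P u v" and vw: "P v w" and "u \<le> v" "v \<le> w"
    show "P u w" unfolding P_def
    proof (intro ballI impI)
      fix a b assume ab: "a \<in> I1 \<tau>" "b \<in> I1 \<tau>" "u \<le> a" "a < b" "b \<le> w"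
      then have ab01: "0 \<le> a" "b \<le> 1" using I1_subset by auto
      consider "b \<le> v" | "v \<le> a" | "a < v" "v < b" by linarith
      then show "admissible (cut a b f)"
      proof cases
        case 3
        \<comment> \<open>The bisection point \<open>v\<close> need not belong to \<open>I1\<close>.
          Density provides \<open>g1 < v < g2\<close> close enough for
          \<open>admissible_local\<close> to bridge the gap.\<close>
        have "v \<in> {0..1}" using 3 ab01 by auto
        then obtain d where d: "d > 0" "\<forall>a\<in>I1 \<tau>. \<forall>b\<in>I1 \<tau>. a < b \<longrightarrow> v - d < a \<longrightarrow> b < v + d \<longrightarrow> admissible (cut a b f)"
          using admissible_local[OF f, of v] by blast
        obtain g1 where g1: "g1 \<in> I1 \<tau>" "max a (v - d) < g1" "g1 < v"
          by (rule I1_dense[of "max a (v - d)" v]) (use 3 ab01 d in auto)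
        obtain g2 where g2: "g2 \<in> I1 \<tau>" "v < g2" "g2 < min b (v + d)"
          by (rule I1_dense[of v "min b (v + d)"]) (use 3 ab01 d in auto)
        have 1: "admissible (cut a g1 f)" using uv g1 ab by (auto simp: P_def)
        have 2: "admissible (cut g1 g2 f)" using d g1 g2 by auto
        have 3: "admissible (cut g2 b f)" using vw g2 ab by (auto simp: P_def)
        have 4: "admissible (cut a g2 f)" by (rule admissible_split[OF ab(1) g2(1) g1(1) _ _ 1 2]) (use g1 g2 in auto)
        show ?thesis by (rule admissible_split[OF ab(1,2) g2(1) _ _ 4 3]) (use g1 g2 in auto)
      qed (use uv vw ab in \<open>auto simp: P_def\<close>)
    qed
  qed simp
  then have "admissible (cut 0 1 f)" using zero_one_I1 by (auto simp: P_def)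
  moreover have "cut 0 1 f = f" using f by (auto simp: cut_def X_interval_full CXZ_iff)
  ultimately show ?thesis by simp
qed

lemma transfer_op_CXZ: "f \<in> CXZ \<tau> \<Longrightarrow> transfer_op \<tau> f \<in> CXZ \<tau>"
  using CXZ_admissible by (simp add: admissible_def)

lemma transfer_op_iter_CXZ: "f \<in> CXZ \<tau> \<Longrightarrow> (transfer_op \<tau> ^^ n) f \<in> CXZ \<tau>"
  by (induction n) (auto intro: transfer_op_CXZ)

text \<open>Each lap contributes at most one preimage, because \<open>sg\<close> is injective on its
  order interval.\<close>

lemma card_sg_fiber: "card {p \<in> X. sg p = q} \<le> length as"
proof -
  let ?I = "\<lambda>i. X_interval \<tau> (as ! i) (as ! Suc i)"
  let ?L = "{i. Suc i < length as}"
  have finL: "finite ?L" by (rule finite_subset[of _ "{..<length as}"]) auto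
  have "{p \<in> X. sg p = q} \<subseteq> (\<Union>i\<in>?L. {p \<in> ?I i. sg p = q})"
  proof
    fix p assume p: "p \<in> {p \<in> X. sg p = q}"
    then obtain x e where v: "valid x e" "p = sp x e" using X_cases by blast
    obtain i where i: "lap_side i x e" using lap_side_ex[OF v(1)] by blast
    then have il: "Suc i < length as" by (simp add: lap_side_def)
    then have "p \<in> ?I i"
      using sp_in_interval[OF v(1) as_I1[of i] as_I1[of "Suc i"]] as_less[of i "Suc i"] i v by (simp add: lap_side_def)
    then show "p \<in> (\<Union>i\<in>?L. {p \<in> ?I i. sg p = q})" using p il by blast
  qed
  moreover have c1: "card {p \<in> ?I i. sg p = q} \<le> 1 \<and> finite {p \<in> ?I i. sg p = q}" if i: "i \<in> ?L" for i
  proof -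
    have il: "Suc i < length as" "as ! i < as ! Suc i" using i as_less by auto
    have "inj_on sg (?I i)"
      using bij_interval[OF as_I1 as_I1 il(2,1)] il by (auto simp: lap_def bij_betw_def)
    then have "inj_on sg {p \<in> ?I i. sg p = q}" by (rule inj_on_subset) auto
    moreover have "sg ` {p \<in> ?I i. sg p = q} \<subseteq> {q}" by auto
    ultimately show ?thesis using card_inj_on_le[of sg _ "{q}"] inj_on_finite[of sg _ "{q}"] by auto
  qed
  ultimately have "card {p \<in> X. sg p = q} \<le> card (\<Union>i\<in>?L. {p \<in> ?I i. sg p = q})"
    using finL by (intro card_mono finite_UN_I) auto
  also have "\<dots> \<le> (\<Sum>i\<in>?L. card {p \<in> ?I i. sg p = q})" by (rule card_UN_le[OF finL])
  also have "\<dots> \<le> (\<Sum>i\<in>?L. 1)" using c1 by (intro sum_mono) blast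
  also have "\<dots> \<le> card {..<length as}" unfolding card_eq_sum[symmetric] by (rule card_mono) auto
  finally show ?thesis by simp
qed

lemma sg_iter_X: "p \<in> X \<Longrightarrow> (sg ^^ n) p \<in> X"
  by (induction n) (auto intro: sg_in_X)

lemma sg_iter_I0: "x \<in> I0 \<tau> \<Longrightarrow> (sg ^^ n) (x, 0) = ((\<tau> ^^ n) x, 0) \<and> (\<tau> ^^ n) x \<in> I0 \<tau>"
  by (induction n) (use sg_I0 in auto)

section \<open>Existence of states\<close>

definition is_state :: "real \<Rightarrow> ((point \<Rightarrow> int) \<Rightarrow> real) \<Rightarrow> bool" where
  "is_state l \<omega> \<longleftrightarrow> (\<forall>f\<in>CXZ \<tau>. \<forall>g\<in>CXZ \<tau>. \<omega> (\<lambda>p. f p + g p) = \<omega> f + \<omega> g) \<and>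
     (\<forall>f\<in>CXZ \<tau>. (\<forall>p\<in>X. 0 \<le> f p) \<longrightarrow> 0 \<le> \<omega> f) \<and> \<omega> (indicator X) = 1 \<and>
     (\<forall>f\<in>CXZ \<tau>. \<omega> (transfer_op \<tau> f) = l * \<omega> f)"

text \<open>The growth of preimages is known for \<open>\<tau>\<close> on the line. A base point in
  \<open>I0\<close> transfers it to \<open>sg\<close>, since the iterated preimages of such a point
  again lie in \<open>I0\<close>, where nothing is split.\<close>

lemma state_exists: "\<exists>l>1. \<exists>\<omega>. is_state l \<omega>"
proof -
  obtain a b M where H: "0 \<le> a" "a < b" "b \<le> 1" "M \<ge> 1"
    "\<And>y k. y \<in> {a..b} \<Longrightarrow> 2 ^ k \<le> card {x\<in>{0..1}. (\<tau> ^^ (M * k)) x = y}" by (rule exponential_growth) blast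
  obtain y where y: "y \<in> I0 \<tau>" "a < y" "y < b" by (rule I0_dense[OF H(1-3)])
  have growth: "2 ^ k \<le> card {p \<in> X. (sg ^^ (M * k)) p = (y, 0)}" if fin: "finite {p \<in> X. (sg ^^ (M * k)) p = (y, 0)}" for k
  proof -
    let ?A = "{x\<in>{0..1}. (\<tau> ^^ (M * k)) x = y}"
    have "2 ^ k \<le> card ?A" using H(5) y by simp
    also have "\<dots> = card ((\<lambda>x. (x, 0 :: int)) ` ?A)" by (rule card_image[symmetric]) (simp add: inj_on_def)
    also have "\<dots> \<le> card {p \<in> X. (sg ^^ (M * k)) p = (y, 0)}"
    proof (rule card_mono[OF fin])
      show "(\<lambda>x. (x, 0 :: int)) ` ?A \<subseteq> {p \<in> X. (sg ^^ (M * k)) p = (y, 0)}"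
      proof clarify
        fix x assume x: "x \<in> {0..1}" "y = (\<tau> ^^ (M * k)) x"
        then have "x \<in> I0 \<tau>" using y(1) I1_iter_iff[OF x(1), of "M * k"] by (auto simp: I0_def)
        then show "(x, 0) \<in> X \<and> (sg ^^ (M * k)) (x, 0) = ((\<tau> ^^ (M * k)) x, 0)"
          using sg_iter_I0 I0_in_X by (auto simp: X0_def)
      qed
    qed
    finally show ?thesis .
  qed
  have fin1: "finite {p \<in> X. (sg ^^ n) p = q}" for n q
  proof (induction n arbitrary: q)
    case 0 show ?case by (rule finite_subset[of _ "{q}"]) auto
  next
    case (Suc n)
    have "{p \<in> X. (sg ^^ Suc n) p = q} \<subseteq> (\<Union>v\<in>{v. v \<in> X \<and> sg v = q}. {p \<in> X. (sg ^^ n) p = v})"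
    proof
      fix p assume p: "p \<in> {p \<in> X. (sg ^^ Suc n) p = q}"
      have "(sg ^^ n) p \<in> X" using p sg_iter_X by blast
      then show "p \<in> (\<Union>v\<in>{v. v \<in> X \<and> sg v = q}. {p \<in> X. (sg ^^ n) p = v})" using p by auto
    qed
    then show ?case by (rule finite_subset) (use Suc finite_sg_fiber in auto)
  qed
  interpret F: finite_to_one X sg "length as" "(y, 0)" M
  proof
    show "(y, 0) \<in> X" using I0_in_X[OF y(1)] by (simp add: X0_def)
      show "sg p \<in> X" if "p \<in> X" for p by (rule sg_in_X[OF that])
    show "finite {p \<in> X. sg p = q}" for q by (rule finite_sg_fiber)
    show "card {p \<in> X. sg p = q} \<le> length as" for q by (rule card_sg_fiber)
    show "2 ^ k \<le> card {p \<in> X. (sg ^^ (M * k)) p = (y, 0)}" for k by (rule growth[OF fin1])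
  qed (rule H(4))
  obtain l \<omega> where l: "l > 1" and om: "F.eigenfunctional l \<omega>"
    using F.eigenfunctional_exists by blast
  have add: "\<omega> (\<lambda>p. f p + g p) = \<omega> f + \<omega> g" if "F.bdd f" "F.bdd g" for f g
    using om that unfolding F.eigenfunctional_def by simp
  have pos: "0 \<le> \<omega> f" if "F.bdd f" "\<And>p. p \<in> X \<Longrightarrow> 0 \<le> f p" for f
    using om that unfolding F.eigenfunctional_def by simp
  have one: "\<omega> (\<lambda>_. 1) = 1" using om unfolding F.eigenfunctional_def by simp
  have eig: "\<omega> (F.S (Suc 0) f) = l * \<omega> f" if "F.bdd f" for f
    using om that unfolding F.eigenfunctional_def by simp
  define w where "w = (\<lambda>f :: point \<Rightarrow> int. \<omega> (\<lambda>p. real_of_int (f p)))"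
  have bdd: "F.bdd (\<lambda>p. real_of_int (f p))" if f: "f \<in> CXZ \<tau>" for f
  proof -
    obtain C where "\<And>p. \<bar>f p\<bar> \<le> C" using CXZ_admissible[OF f] by (auto simp: admissible_def)
    then have "\<bar>real_of_int (f p)\<bar> \<le> real_of_int C" for p by (metis of_int_abs of_int_le_iff)
    then show ?thesis unfolding F.bdd_def by blast
  qed
  \<comment> \<open>The functional acts on functions on the whole type; positivity applied to both
    differences shows that only the values on \<open>X\<close> matter.\<close>
  have cong: "\<omega> f = \<omega> g" if fg: "F.bdd f" "F.bdd g" "\<And>p. p \<in> X \<Longrightarrow> f p = g p" for f g
  proof -
    have b0: "F.bdd (\<lambda>p. g p - f p)" "F.bdd (\<lambda>p. f p - g p)" using fg(3) by (auto simp: F.bdd_def intro!: exI[of _ 0])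
    have "\<omega> (\<lambda>p. f p + (g p - f p)) = \<omega> f + \<omega> (\<lambda>p. g p - f p)" by (rule add[OF fg(1) b0(1)])
    then have 1: "\<omega> g = \<omega> f + \<omega> (\<lambda>p. g p - f p)" by simp
    have "\<omega> (\<lambda>p. g p + (f p - g p)) = \<omega> g + \<omega> (\<lambda>p. f p - g p)" by (rule add[OF fg(2) b0(2)])
    then have 2: "\<omega> f = \<omega> g + \<omega> (\<lambda>p. f p - g p)" by simp
    have "0 \<le> \<omega> (\<lambda>p. g p - f p)" "0 \<le> \<omega> (\<lambda>p. f p - g p)" using pos b0 fg(3) by auto
    then show ?thesis using 1 2 by linarith
  qed
  have "is_state l w" unfolding is_state_def
  proof (intro conjI ballI impI)
    fix f g assume fg: "f \<in> CXZ \<tau>" "g \<in> CXZ \<tau>"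
    show "w (\<lambda>p. f p + g p) = w f + w g" using add[OF bdd[OF fg(1)] bdd[OF fg(2)]] by (simp add: w_def)
  next
    fix f assume "f \<in> CXZ \<tau>" "\<forall>p\<in>X. 0 \<le> f p"
    then show "0 \<le> w f" unfolding w_def by (intro pos bdd) auto
  next
    have "\<omega> (\<lambda>p. real_of_int (indicator X p)) = \<omega> (\<lambda>_. 1)"
      by (rule cong[OF bdd[OF CXZ_unit] F.bdd_one]) simp
    then show "w (indicator X) = 1" by (simp add: w_def one)
  next
    fix f assume f: "f \<in> CXZ \<tau>"
    have "(\<lambda>q. real_of_int (transfer_op \<tau> f q)) = F.S (Suc 0) (\<lambda>p. real_of_int (f p))"
      by (rule ext) (simp add: transfer_op_eq F.S_def F.fib_def)
    then show "w (transfer_op \<tau> f) = l * w f" unfolding w_def using eig[OF bdd[OF f]] by simp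
  qed
  then show ?thesis using l by blast
qed

text \<open>Two points near \<open>x\<close> that do not straddle it, should it be a partition
  point, share a lap with \<open>x\<close>. This form allows \<open>jump_step\<close> to apply the
  scaling rule.\<close>

lemma near_lap:
  assumes x: "x \<in> {0..1}"
  shows "\<exists>d>0. \<forall>a b. 0 \<le> a \<longrightarrow> a < b \<longrightarrow> b \<le> 1 \<longrightarrow> \<bar>a - x\<bar> < d \<longrightarrow> \<bar>b - x\<bar> < d \<longrightarrow> (x \<in> set as \<longrightarrow> x \<le> a \<or> b \<le> x) \<longrightarrow>
     (\<exists>i. Suc i < length as \<and> a \<in> lap i \<and> b \<in> lap i \<and> x \<in> lap i)"
proof -
  have "\<exists>d i. d > 0 \<and> (x < 1 \<longrightarrow> Suc i < length as \<and> as ! i \<le> x \<and> x + d \<le> as ! Suc i \<and> (as ! i < x \<longrightarrow> as ! i \<le> x - d))"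
  proof (cases "x < 1")
    case True
    then obtain i where i: "Suc i < length as" "as ! i \<le> x" "x < as ! Suc i" using locate_right[of x] x by auto
    then show ?thesis
      by (intro exI[of _ "if as ! i < x then min (x - as ! i) (as ! Suc i - x) else as ! Suc i - x"] exI[of _ i]) auto
  qed (auto intro: exI[of _ 1])
  then obtain d1 i where 1: "d1 > 0" "x < 1 \<Longrightarrow> Suc i < length as \<and> as ! i \<le> x \<and> x + d1 \<le> as ! Suc i \<and> (as ! i < x \<longrightarrow> as ! i \<le> x - d1)"
    by blast
  have "\<exists>d j. d > 0 \<and> (0 < x \<longrightarrow> Suc j < length as \<and> as ! j \<le> x - d \<and> x \<le> as ! Suc j)"
  proof (cases "0 < x")
    case True
    then obtain j where j: "Suc j < length as" "as ! j < x" "x \<le> as ! Suc j" using locate_left[of x] x by auto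
    then show ?thesis by (intro exI[of _ "x - as ! j"] exI[of _ j]) auto
  qed (auto intro: exI[of _ 1])
  then obtain d2 j where 2: "d2 > 0" "0 < x \<Longrightarrow> Suc j < length as \<and> as ! j \<le> x - d2 \<and> x \<le> as ! Suc j" by blast
  show ?thesis
  proof (intro exI[of _ "min d1 d2"] conjI allI impI)
    fix a b assume ab: "0 \<le> a" "a < b" "b \<le> 1" "\<bar>a - x\<bar> < min d1 d2" "\<bar>b - x\<bar> < min d1 d2" "x \<in> set as \<longrightarrow> x \<le> a \<or> b \<le> x"
    consider "x \<le> a" | "b \<le> x" | "a < x" "x < b" by linarith
    then show "\<exists>i. Suc i < length as \<and> a \<in> lap i \<and> b \<in> lap i \<and> x \<in> lap i"
    proof cases
      case c: 1
      then have "x < 1" using ab by linarith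
      then show ?thesis using 1(2) ab c by (intro exI[of _ i]) (auto simp: lap_def)
    next
      case c: 2
      then have "0 < x" using ab by linarith
      then show ?thesis using 2(2) ab c by (intro exI[of _ j]) (auto simp: lap_def)
    next
      case 3
      then have x1: "x < 1" using ab by linarith
      have "x \<noteq> as ! i" using ab(6) 3 1(2)[OF x1] by auto
      then show ?thesis using 1(2)[OF x1] ab 3 by (intro exI[of _ i]) (auto simp: lap_def)
    qed
  qed (use 1 2 in auto)
qed

end

text \<open>An abstraction of the distribution function of a state. It is controlled only on
  \<open>I1\<close>, where clopen intervals have their endpoints, and the last assumption is the
  eigenvalue equation on an interval inside one lap.\<close>

locale scaled_trans_map = trans_map +
  fixes h :: "real \<Rightarrow> real" and l :: real
  assumes h0: "h 0 = 0" and h1: "h 1 = 1" and l: "l > 1"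
    and h_mono: "a \<in> I1 \<tau> \<Longrightarrow> b \<in> I1 \<tau> \<Longrightarrow> a \<le> b \<Longrightarrow> h a \<le> h b"
    and h_scale: "Suc i < length as \<Longrightarrow> a \<in> lap i \<Longrightarrow> b \<in> lap i \<Longrightarrow> a \<in> I1 \<tau> \<Longrightarrow> b \<in> I1 \<tau> \<Longrightarrow> a < b \<Longrightarrow>
       dirs i * (h (\<tau> b) - h (\<tau> a)) = l * (h b - h a)"
begin

lemma h_01: "a \<in> I1 \<tau> \<Longrightarrow> 0 \<le> h a" "a \<in> I1 \<tau> \<Longrightarrow> h a \<le> 1"
  using h_mono[OF zero_one_I1(1), of a] h_mono[OF _ zero_one_I1(2), of a] h0 h1 I1_subset by auto

text \<open>A jump of height \<open>m\<close> at a point of the split space over \<open>x\<close>: pairs of \<open>I1\<close>-points close to \<open>x\<close>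
  that do not straddle \<open>x\<close> if \<open>x\<close> itself is split.\<close>

definition jump :: "real \<Rightarrow> real \<Rightarrow> bool" where
  "jump x m \<longleftrightarrow> (\<forall>d>0. \<exists>a\<in>I1 \<tau>. \<exists>b\<in>I1 \<tau>. a < b \<and> \<bar>a - x\<bar> < d \<and> \<bar>b - x\<bar> < d \<and> (x \<in> I1 \<tau> \<longrightarrow> x \<le> a \<or> b \<le> x) \<and> m \<le> h b - h a)"

text \<open>The image of a witnessing pair lies close to \<open>\<tau> x\<close> and has its
  increment multiplied by \<open>l\<close>. It does not straddle a split \<open>\<tau> x\<close>,
  because \<open>\<tau>\<close> is monotonic on the common lap and \<open>I1\<close> is
  invariant.\<close>

lemma jump_step:
  assumes x: "x \<in> {0..1}" and j: "jump x m" shows "jump (\<tau> x) (l * m)"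
  unfolding jump_def
proof (intro allI impI)
  fix e :: real assume e: "e > 0"
  obtain d1 where d1: "d1 > 0" "\<And>y. y \<in> {0..1} \<Longrightarrow> dist y x < d1 \<Longrightarrow> dist (\<tau> y) (\<tau> x) < e"
    using cont x e unfolding continuous_on_iff by blast
  obtain d2 where d2: "d2 > 0" "\<And>a b. 0 \<le> a \<Longrightarrow> a < b \<Longrightarrow> b \<le> 1 \<Longrightarrow> \<bar>a - x\<bar> < d2 \<Longrightarrow> \<bar>b - x\<bar> < d2 \<Longrightarrow> (x \<in> set as \<longrightarrow> x \<le> a \<or> b \<le> x) \<Longrightarrow>
     (\<exists>i. Suc i < length as \<and> a \<in> lap i \<and> b \<in> lap i \<and> x \<in> lap i)" using near_lap[OF x] by blast
  have "min d1 d2 > 0" using d1 d2 by simp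
  then obtain a b where ab: "a \<in> I1 \<tau>" "b \<in> I1 \<tau>" "a < b" "\<bar>a - x\<bar> < min d1 d2" "\<bar>b - x\<bar> < min d1 d2"
     "x \<in> I1 \<tau> \<longrightarrow> x \<le> a \<or> b \<le> x" "m \<le> h b - h a" using j unfolding jump_def by meson
  have ab01: "a \<in> {0..1}" "b \<in> {0..1}" using ab I1_subset by auto
  obtain i where i: "Suc i < length as" "a \<in> lap i" "b \<in> lap i" "x \<in> lap i"
    using d2(2)[of a b] ab ab01 set_as_I1 by auto
  have sc: "dirs i * (h (\<tau> b) - h (\<tau> a)) = l * (h b - h a)" by (rule h_scale[OF i(1-3) ab(1-3)])
  have lm: "l * m \<le> l * (h b - h a)" using ab(7) l by (intro mult_left_mono) auto
  have near: "\<bar>\<tau> a - \<tau> x\<bar> < e" "\<bar>\<tau> b - \<tau> x\<bar> < e"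
    using d1(2)[OF ab01(1)] d1(2)[OF ab01(2)] ab by (auto simp: dist_real_def)
  have tI: "\<tau> a \<in> I1 \<tau>" "\<tau> b \<in> I1 \<tau>" using I1_iff ab ab01 by auto
  have mab: "dirs i * \<tau> a < dirs i * \<tau> b" by (rule mono_lap_less[OF i(1-3) ab(3)])
  have str: "dirs i * \<tau> x \<le> dirs i * \<tau> a \<or> dirs i * \<tau> b \<le> dirs i * \<tau> x" if "\<tau> x \<in> I1 \<tau>"
  proof -
    have "x \<le> a \<or> b \<le> x" using that I1_iff[OF x] ab(6) by blast
    then show ?thesis
      using mono_lap_less[OF i(1) i(4) i(2)] mono_lap_less[OF i(1) i(3) i(4)] by (metis le_less)
  qed
  show "\<exists>a\<in>I1 \<tau>. \<exists>b\<in>I1 \<tau>. a < b \<and> \<bar>a - \<tau> x\<bar> < e \<and> \<bar>b - \<tau> x\<bar> < e \<and> (\<tau> x \<in> I1 \<tau> \<longrightarrow> \<tau> x \<le> a \<or> b \<le> \<tau> x) \<and> l * m \<le> h b - h a"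
  proof (cases "dirs i = 1")
    case True
    show ?thesis by (rule bexI[OF _ tI(1)], rule bexI[OF _ tI(2)]) (use True mab near str sc lm in auto)
  next
    case False
    then have "dirs i = -1" using dirs_cases[of i] by auto
    then show ?thesis by (intro bexI[OF _ tI(2)] bexI[OF _ tI(1)]) (use mab near str sc lm in auto)
  qed
qed

lemma no_jump:
  assumes x: "x \<in> {0..1}" and m: "m > 0" shows "\<not> jump x m"
proof
  assume j: "jump x m"
  have jn: "jump ((\<tau> ^^ n) x) (l ^ n * m)" for n
  proof (induction n)
    case (Suc n)
    then show ?case using jump_step[OF iter_maps[OF x], of n] by (simp add: mult.assoc)
  qed (use j in simp)
  obtain n where n: "1 / m < l ^ n" using real_arch_pow[OF l] by blast
  obtain a b where ab: "a \<in> I1 \<tau>" "b \<in> I1 \<tau>" "l ^ n * m \<le> h b - h a"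
    using jn[of n] unfolding jump_def by (meson zero_less_one)
  have "1 < l ^ n * m" using n m by (simp add: field_simps)
  then show False using ab h_01[OF ab(1)] h_01[OF ab(2)] by linarith
qed

lemma h_small:
  assumes x: "x \<in> {0..1}" and m: "m > 0"
  shows "\<exists>d>0. \<forall>a\<in>I1 \<tau>. \<forall>b\<in>I1 \<tau>. a < b \<longrightarrow> \<bar>a - x\<bar> < d \<longrightarrow> \<bar>b - x\<bar> < d \<longrightarrow> h b - h a < m"
proof -
  have "\<not> jump x (m / 2)" using no_jump[OF x] m by simp
  then obtain d where d: "d > 0" "\<And>a b. a \<in> I1 \<tau> \<Longrightarrow> b \<in> I1 \<tau> \<Longrightarrow> a < b \<Longrightarrow> \<bar>a - x\<bar> < d \<Longrightarrow> \<bar>b - x\<bar> < d \<Longrightarrow>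
      (x \<in> I1 \<tau> \<longrightarrow> x \<le> a \<or> b \<le> x) \<Longrightarrow> h b - h a < m / 2" unfolding jump_def by (metis not_le)
  have "h b - h a < m" if ab: "a \<in> I1 \<tau>" "b \<in> I1 \<tau>" "a < b" "\<bar>a - x\<bar> < d" "\<bar>b - x\<bar> < d" for a b
  proof (cases "x \<in> I1 \<tau> \<and> a < x \<and> x < b")
    case True
    then have "h x - h a < m / 2" "h b - h x < m / 2" using d(2)[of a x] d(2)[of x b] ab d(1) by auto
    then show ?thesis by linarith
  next
    case False
    then have "h b - h a < m / 2" using d(2)[OF ab] by force
    then show ?thesis using m by linarith
  qed
  then show ?thesis using d(1) by blast
qed

definition H :: "real \<Rightarrow> real" where
  "H x = Sup (h ` {b \<in> I1 \<tau>. b \<le> x})"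

lemma H_bdd: "bdd_above (h ` {b \<in> I1 \<tau>. b \<le> x})"
  using h_01(2) by (intro bdd_aboveI[of _ 1]) auto

lemma H_ge: "b \<in> I1 \<tau> \<Longrightarrow> b \<le> x \<Longrightarrow> h b \<le> H x"
  unfolding H_def by (rule cSup_upper[OF _ H_bdd]) simp

lemma H_le: "b \<in> I1 \<tau> \<Longrightarrow> 0 \<le> x \<Longrightarrow> x \<le> b \<Longrightarrow> H x \<le> h b"
  unfolding H_def using zero_one_I1 h_mono by (intro cSup_least) auto

lemma H_I1: "b \<in> I1 \<tau> \<Longrightarrow> H b = h b"
  using H_ge[of b b] H_le[of b b] I1_subset by fastforce

lemma H_0: "H 0 = 0" and H_1: "H 1 = 1"
  using H_I1 zero_one_I1 h0 h1 by auto

lemma H_mono: "0 \<le> x \<Longrightarrow> x \<le> y \<Longrightarrow> H x \<le> H y"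
  unfolding H_def using zero_one_I1 by (intro cSup_subset_mono H_bdd) auto

lemma I1_left:
  assumes "x \<in> {0..1}" "d > 0"
  obtains a where "a \<in> I1 \<tau>" "a \<le> x" "x - d < a" "x = 0 \<or> a < x"
proof (cases "x = 0")
  case True then show ?thesis using that[of 0] zero_one_I1 assms by auto
next
  case False
  obtain a where "a \<in> I1 \<tau>" "max 0 (x - d) < a" "a < x"
    by (rule I1_dense[of "max 0 (x - d)" x]) (use False assms in auto)
  then show ?thesis using that[of a] by auto
qed

lemma I1_right:
  assumes "x \<in> {0..1}" "d > 0"
  obtains b where "b \<in> I1 \<tau>" "x \<le> b" "b < x + d" "x = 1 \<or> x < b"
proof (cases "x = 1")
  case True then show ?thesis using that[of 1] zero_one_I1 assms by auto
next
  case False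
  obtain a where "a \<in> I1 \<tau>" "x < a" "a < min 1 (x + d)"
    by (rule I1_dense[of x "min 1 (x + d)"]) (use False assms in auto)
  then show ?thesis using that[of a] by auto
qed

lemma H_cont: "continuous_on {0..1} H"
  unfolding continuous_on_iff
proof (intro ballI allI impI)
  fix x e :: real assume x: "x \<in> {0..1}" and e: "e > 0"
  obtain d where d: "d > 0" "\<forall>a\<in>I1 \<tau>. \<forall>b\<in>I1 \<tau>. a < b \<longrightarrow> \<bar>a - x\<bar> < d \<longrightarrow> \<bar>b - x\<bar> < d \<longrightarrow> h b - h a < e"
    using h_small[OF x e] by blast
  obtain a where a: "a \<in> I1 \<tau>" "a \<le> x" "x - d < a" "x = 0 \<or> a < x" by (rule I1_left[OF x d(1)])
  obtain b where b: "b \<in> I1 \<tau>" "x \<le> b" "b < x + d" "x = 1 \<or> x < b" by (rule I1_right[OF x d(1)])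
  have ab: "a < b" using a b by auto
  then have hab: "h b - h a < e" using d a b by auto
  define r where "r = min (if x = 0 then 1 else x - a) (if x = 1 then 1 else b - x)"
  have "r > 0" using a b by (auto simp: r_def)
  moreover have "dist (H y) (H x) < e" if y: "y \<in> {0..1}" "dist y x < r" for y
  proof -
    have "a \<le> y" "y \<le> b" using y a b by (auto simp: r_def dist_real_def abs_less_iff split: if_splits)
    then have "h a \<le> H y" "H y \<le> h b" "h a \<le> H x" "H x \<le> h b"
      using H_ge[OF a(1)] H_le[OF b(1)] a b x y by auto
    then show ?thesis using hab by (auto simp: dist_real_def)
  qed
  ultimately show "\<exists>d>0. \<forall>x'\<in>{0..1}. dist x' x < d \<longrightarrow> dist (H x') (H x) < e" by blast
qed

text \<open>The function \<open>G\<close> is constant on the points of \<open>I1\<close> inside the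
  lap by the assumed scaling. These are dense and \<open>G\<close> is continuous, so it is constant
  on the closed lap.\<close>

lemma H_scale:
  assumes i: "Suc i < length as" and x: "x \<in> lap i"
  shows "dirs i * (H (\<tau> x) - H (\<tau> (as ! i))) = l * (H x - H (as ! i))"
proof -
  define S where "S = I1 \<tau> \<inter> {as ! i<..<as ! Suc i}"
  define G where "G = (\<lambda>y. dirs i * H (\<tau> y) - l * H y)"
  have lt: "as ! i < as ! Suc i" using as_less[of i "Suc i"] i by simp
  have a01: "0 \<le> as ! i" "as ! Suc i \<le> 1" using as_01[of i] as_01[of "Suc i"] i by auto
  have "S \<subseteq> lap i" by (auto simp: S_def lap_def)
  then have cS: "closure S \<subseteq> lap i" by (rule closure_minimal) (simp add: lap_def)
  have "\<tau> ` {0..1} \<subseteq> {0..1}" using maps by blast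
  then have "continuous_on {0..1} (\<lambda>y. H (\<tau> y))"
    using continuous_on_compose[OF cont continuous_on_subset[OF H_cont]] by (simp add: o_def)
  then have "continuous_on {0..1} G" unfolding G_def by (intro continuous_intros H_cont)
  then have cG: "continuous_on (closure S) G" by (rule continuous_on_subset) (use cS lap_subset[OF i] in blast)
  have const: "G y = G (as ! i)" if y: "y \<in> S" for y
  proof -
    have yy: "y \<in> I1 \<tau>" "as ! i < y" "y \<in> lap i" "as ! i \<in> lap i" using y lt by (auto simp: S_def lap_def)
    have ai: "as ! i \<in> I1 \<tau>" using as_I1 i by simp
    have "dirs i * (h (\<tau> y) - h (\<tau> (as ! i))) = l * (h y - h (as ! i))"
      by (rule h_scale[OF i yy(4,3) ai yy(1,2)])
    moreover have "\<tau> y \<in> I1 \<tau>" "\<tau> (as ! i) \<in> I1 \<tau>" using I1_iff yy ai I1_subset by auto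
    ultimately show ?thesis using H_I1 yy ai by (simp add: G_def algebra_simps)
  qed
  have "x \<in> closure S" unfolding closure_approachable
  proof (intro allI impI)
    fix e :: real assume e: "e > 0"
    have "max (as ! i) (x - e) < min (as ! Suc i) (x + e)" using x lt e by (auto simp: lap_def)
    then obtain y where "y \<in> I1 \<tau>" "max (as ! i) (x - e) < y" "y < min (as ! Suc i) (x + e)"
      by (rule I1_dense[rotated]) (use a01 in auto)
    then show "\<exists>y\<in>S. dist y x < e" by (intro bexI[of _ y]) (auto simp: S_def dist_real_def)
  qed
  then have "G x = G (as ! i)" 
    using continuous_constant_on_closure[OF cG, of "G (as ! i)" x] const by blast
  then show ?thesis by (simp add: G_def algebra_simps)
qed

text \<open>On each lap \<open>H (\<tau> x)\<close> is an affine function of \<open>H x\<close>, so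
  finitely many values of \<open>H\<close> on a set stay finitely many on its image. This drives the
  proof of \<open>H_strict\<close>.\<close>

lemma H_image_finite:
  assumes fin: "finite (H ` A)" and A: "A \<subseteq> {0..1}" shows "finite (H ` \<tau> ` A)"
proof -
  let ?g = "\<lambda>i r. H (\<tau> (as ! i)) + dirs i * (l * (r - H (as ! i)))"
  let ?L = "{i. Suc i < length as}"
  have "H ` \<tau> ` A \<subseteq> (\<Union>i\<in>?L. ?g i ` H ` A)"
  proof
    fix z assume "z \<in> H ` \<tau> ` A"
    then obtain x where x: "x \<in> A" "z = H (\<tau> x)" by blast
    then have "0 \<le> x" "x \<le> 1" using A by auto
    then obtain i where i: "Suc i < length as" "x \<in> lap i" by (rule locate)
    have "dirs i * (H (\<tau> x) - H (\<tau> (as ! i))) = l * (H x - H (as ! i))" by (rule H_scale[OF i])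
    then have "z = ?g i (H x)" using dirs_cases[of i] x by (auto simp: algebra_simps)
    then show "z \<in> (\<Union>i\<in>?L. ?g i ` H ` A)" using i x by blast
  qed
  moreover have "finite ?L" by (rule finite_subset[of _ "{..<length as}"]) auto
  ultimately show ?thesis using fin by (meson finite_UN_I finite_imageI finite_subset)
qed

lemma H_strict:
  assumes "0 \<le> u" "u < v" "v \<le> 1" shows "H u < H v"
proof (rule ccontr)
  assume "\<not> H u < H v"
  then have eq: "H u = H v" using H_mono[of u v] assms by simp
  obtain c where c: "0 < c" "c < 1" "\<tau> c = c" by (rule fixed_interior)
  have J01: "{u<..<v} \<subseteq> {0..1}" using assms by auto
  have fin: "finite (H ` (\<tau> ^^ n) ` {u<..<v})" for n
  proof (induction n)
    case 0
    have "H x = H u" if "x \<in> {u<..<v}" for x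
      using H_mono[of u x] H_mono[of x v] that assms eq by auto
    then have "H ` (\<tau> ^^ 0) ` {u<..<v} \<subseteq> {H u}" by auto
    then show ?case by (rule finite_subset) simp
  next
    case (Suc n)
    have "finite (H ` \<tau> ` (\<tau> ^^ n) ` {u<..<v})" by (rule H_image_finite[OF Suc iter_image_subset[OF J01]])
    then show ?case by (simp add: image_comp)
  qed
  have "{0..1} \<subseteq> H ` {0..1}"
  proof -
    have "connected (H ` {0..1})" by (intro connected_continuous_image H_cont) simp
    moreover have "0 \<in> H ` {0..1}" "1 \<in> H ` {0..1}" using H_0 H_1 by (force intro: image_eqI)+
    ultimately show ?thesis using connected_contains_Icc by metis
  qed
  \<comment> \<open>The orbit of the interval reaches every point except possibly the endpoints and
    the fixed point \<open>c\<close>; their three values are added separately.\<close>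
  also have "\<dots> \<subseteq> H ` {0, c, 1} \<union> (\<Union>n. H ` (\<tau> ^^ n) ` {u<..<v})"
  proof
    fix z assume "z \<in> H ` {0..1}"
    then obtain y where y: "y \<in> {0..1}" "z = H y" by blast
    show "z \<in> H ` {0, c, 1} \<union> (\<Union>n. H ` (\<tau> ^^ n) ` {u<..<v})"
    proof (cases "y \<in> {0, c, 1}")
      case True then show ?thesis using y by blast
    next
      case False
      then have "0 < y" "y < 1" "y \<noteq> c" using y by auto
      then obtain n x where "x \<in> {u<..<v}" "(\<tau> ^^ n) x = y" using orbit_cover[OF assms c] by blast
      then show ?thesis using y by blast
    qed
  qed
  finally have "{0..1} \<subseteq> H ` {0, c, 1} \<union> (\<Union>n. H ` (\<tau> ^^ n) ` {u<..<v})" .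
  moreover have "countable (H ` {0, c, 1} \<union> (\<Union>n. H ` (\<tau> ^^ n) ` {u<..<v}))"
    by (intro countable_Un countable_UN countable_finite[OF fin]) (auto intro: countable_finite)
  ultimately have "countable {0..1::real}" by (rule countable_subset)
  then show False using uncountable_closed_interval[of 0 "1::real"] by simp
qed

end

section \<open>From dimension triples to conjugacies\<close>

context trans_map
begin

section \<open>The dimension group and the values of states on it\<close>

lemma transfer_op_iter_add:
  "(transfer_op \<tau> ^^ n) (\<lambda>p. f p + g p) = (\<lambda>p. (transfer_op \<tau> ^^ n) f p + (transfer_op \<tau> ^^ n) g p)"
  by (induction n) (simp_all add: transfer_op_add)

lemma transfer_op_iter_eq_mono:
  assumes "(transfer_op \<tau> ^^ n) f = (transfer_op \<tau> ^^ n) g"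
  shows "(transfer_op \<tau> ^^ (m + n)) f = (transfer_op \<tau> ^^ (m + n)) g"
  using assms by (simp add: funpow_add)

lemma DG_rel_trans: "trans (DG_rel \<tau>)"
proof (rule transI)
  fix f g k assume "(f, g) \<in> DG_rel \<tau>" "(g, k) \<in> DG_rel \<tau>"
  then obtain n m where n: "f \<in> CXZ \<tau>" "k \<in> CXZ \<tau>" "(transfer_op \<tau> ^^ n) f = (transfer_op \<tau> ^^ n) g"
    "(transfer_op \<tau> ^^ m) g = (transfer_op \<tau> ^^ m) k" by (auto simp: DG_rel_def)
  have "(transfer_op \<tau> ^^ (m + n)) f = (transfer_op \<tau> ^^ (m + n)) k"
    using transfer_op_iter_eq_mono[OF n(3), of m] transfer_op_iter_eq_mono[OF n(4), of n] by (simp add: add.commute)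
  then show "(f, k) \<in> DG_rel \<tau>" using n unfolding DG_rel_def by blast
qed

lemma equiv_DG_rel: "equiv (CXZ \<tau>) (DG_rel \<tau>)"
proof (rule equivI)
  show "DG_rel \<tau> \<subseteq> CXZ \<tau> \<times> CXZ \<tau>" by (auto simp: DG_rel_def)
  show "refl_on (CXZ \<tau>) (DG_rel \<tau>)" by (rule refl_onI) (auto simp: DG_rel_def)
  show "sym (DG_rel \<tau>)" by (rule symI) (auto simp: DG_rel_def eq_commute)
qed (rule DG_rel_trans)

lemma class_self: "f \<in> CXZ \<tau> \<Longrightarrow> f \<in> DG_class \<tau> f"
  unfolding DG_class_def by (rule equiv_class_self[OF equiv_DG_rel])

lemma in_class: "g \<in> DG_class \<tau> f \<longleftrightarrow> (f, g) \<in> DG_rel \<tau>"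
  by (simp add: DG_class_def)

lemma class_eqI: "(f, g) \<in> DG_rel \<tau> \<Longrightarrow> DG_class \<tau> f = DG_class \<tau> g"
  unfolding DG_class_def by (rule equiv_class_eq[OF equiv_DG_rel])

lemma class_carrier: "f \<in> CXZ \<tau> \<Longrightarrow> DG_class \<tau> f \<in> carrier (DG \<tau>)"
  by (simp add: DG_def DG_class_def quotientI)

lemma carrier_cases:
  assumes "A \<in> carrier (DG \<tau>)" obtains f where "f \<in> CXZ \<tau>" "A = DG_class \<tau> f"
  using assms by (auto simp: DG_def DG_class_def quotient_def)

lemma DG_rel_add:
  assumes "(f, f') \<in> DG_rel \<tau>" "(g, g') \<in> DG_rel \<tau>"
  shows "((\<lambda>p. f p + g p), (\<lambda>p. f' p + g' p)) \<in> DG_rel \<tau>"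
proof -
  obtain n m where n: "(transfer_op \<tau> ^^ n) f = (transfer_op \<tau> ^^ n) f'"
    "(transfer_op \<tau> ^^ m) g = (transfer_op \<tau> ^^ m) g'" using assms by (auto simp: DG_rel_def)
  have "(transfer_op \<tau> ^^ (m + n)) f = (transfer_op \<tau> ^^ (m + n)) f'"
    "(transfer_op \<tau> ^^ (m + n)) g = (transfer_op \<tau> ^^ (m + n)) g'"
    using transfer_op_iter_eq_mono[OF n(1), of m] transfer_op_iter_eq_mono[OF n(2), of n] by (simp_all add: add.commute)
  then have "(transfer_op \<tau> ^^ (m + n)) (\<lambda>p. f p + g p) = (transfer_op \<tau> ^^ (m + n)) (\<lambda>p. f' p + g' p)"
    unfolding transfer_op_iter_add by simp
  then show ?thesis using assms CXZ_add unfolding DG_rel_def by blast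
qed

lemma DG_mult:
  assumes "f \<in> CXZ \<tau>" "g \<in> CXZ \<tau>"
  shows "DG_class \<tau> f \<otimes>\<^bsub>DG \<tau>\<^esub> DG_class \<tau> g = DG_class \<tau> (\<lambda>p. f p + g p)"
proof -
  have "DG_class \<tau> (\<lambda>p. f' p + g' p) = DG_class \<tau> (\<lambda>p. f p + g p)"
    if "f' \<in> DG_class \<tau> f" "g' \<in> DG_class \<tau> g" for f' g'
    using class_eqI[OF DG_rel_add] that unfolding in_class by metis
  moreover have "f \<in> DG_class \<tau> f" "g \<in> DG_class \<tau> g" using assms class_self by auto
  ultimately have "(\<Union>f'\<in>DG_class \<tau> f. \<Union>g'\<in>DG_class \<tau> g. DG_class \<tau> (\<lambda>p. f' p + g' p)) = DG_class \<tau> (\<lambda>p. f p + g p)"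
    by blast
  then show ?thesis by (simp add: DG_def)
qed

lemma DG_shift_class:
  assumes "f \<in> CXZ \<tau>" shows "DG_shift \<tau> (DG_class \<tau> f) = DG_class \<tau> (transfer_op \<tau> f)"
proof -
  have "DG_class \<tau> (transfer_op \<tau> g) = DG_class \<tau> (transfer_op \<tau> f)" if g: "g \<in> DG_class \<tau> f" for g
  proof -
    obtain n where n: "g \<in> CXZ \<tau>" "(transfer_op \<tau> ^^ n) f = (transfer_op \<tau> ^^ n) g"
      using g by (auto simp: in_class DG_rel_def)
    have "(transfer_op \<tau> ^^ n) (transfer_op \<tau> f) = (transfer_op \<tau> ^^ n) (transfer_op \<tau> g)"
      using n(2) by (metis funpow_swap1)
    then have "(transfer_op \<tau> f, transfer_op \<tau> g) \<in> DG_rel \<tau>"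
      using assms n(1) transfer_op_CXZ unfolding DG_rel_def by blast
    then show ?thesis by (rule class_eqI[symmetric])
  qed
  then show ?thesis unfolding DG_shift_def using class_self[OF assms] by blast
qed

lemma state_iter:
  assumes "is_state l \<omega>" "f \<in> CXZ \<tau>" shows "\<omega> ((transfer_op \<tau> ^^ n) f) = l ^ n * \<omega> f"
proof (induction n)
  case (Suc n)
  have "\<omega> (transfer_op \<tau> ((transfer_op \<tau> ^^ n) f)) = l * \<omega> ((transfer_op \<tau> ^^ n) f)"
    using assms transfer_op_iter_CXZ unfolding is_state_def by blast
  then show ?case using Suc by simp
qed simp

text \<open>Functions that become equal after \<open>n\<close> steps have values agreeing up to the
  nonzero factor \<open>l ^ n\<close>, so a state descends to \<open>DG\<close>.\<close>

lemma state_class: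
  assumes "is_state l \<omega>" "l > 0" "(f, g) \<in> DG_rel \<tau>" shows "\<omega> f = \<omega> g"
proof -
  obtain n where n: "f \<in> CXZ \<tau>" "g \<in> CXZ \<tau>" "(transfer_op \<tau> ^^ n) f = (transfer_op \<tau> ^^ n) g"
    using assms by (auto simp: DG_rel_def)
  then have "l ^ n * \<omega> f = l ^ n * \<omega> g" using state_iter[OF assms(1)] by metis
  then show ?thesis using assms(2) by simp
qed

definition class_val :: "((point \<Rightarrow> int) \<Rightarrow> real) \<Rightarrow> (point \<Rightarrow> int) set \<Rightarrow> real" where
  "class_val \<omega> A = \<omega> (SOME f. f \<in> A)"

lemma class_val_eq:
  assumes "is_state l \<omega>" "l > 0" "f \<in> CXZ \<tau>" shows "class_val \<omega> (DG_class \<tau> f) = \<omega> f"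
proof -
  have "(SOME g. g \<in> DG_class \<tau> f) \<in> DG_class \<tau> f" by (rule someI[of _ f]) (rule class_self[OF assms(3)])
  then show ?thesis using state_class[OF assms(1,2)] unfolding class_val_def in_class by metis
qed

text \<open>The value at 0 is set apart because \<open>X_interval \<tau> 0 0\<close> is not empty:
  it consists of the unsplit point 0.\<close>

definition state_cdf :: "((point \<Rightarrow> int) \<Rightarrow> real) \<Rightarrow> real \<Rightarrow> real" where
  "state_cdf \<omega> b = (if b = 0 then 0 else \<omega> (indicator (X_interval \<tau> 0 b)))"

lemma state_cdf_diff:
  assumes st: "is_state l \<omega>" and ab: "a \<in> I1 \<tau>" "b \<in> I1 \<tau>" "a < b"
  shows "\<omega> (indicator (X_interval \<tau> a b)) = state_cdf \<omega> b - state_cdf \<omega> a"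
proof -
  have ab0: "0 \<le> a" "b \<noteq> 0" using ab I1_subset by auto
  show ?thesis
  proof (cases "a = 0")
    case False
    then have a: "0 < a" using ab0 by simp
    have "indicator (X_interval \<tau> 0 b) = (\<lambda>p. indicator (X_interval \<tau> 0 a) p + indicator (X_interval \<tau> a b) p :: int)"
      using interval_split[OF zero_one_I1(1) ab(2,1) a ab(3)] by (auto simp: indicator_def fun_eq_iff)
    moreover have "\<omega> (\<lambda>p. indicator (X_interval \<tau> 0 a) p + indicator (X_interval \<tau> a b) p) =
        \<omega> (indicator (X_interval \<tau> 0 a)) + \<omega> (indicator (X_interval \<tau> a b))"
      using st CXZ_interval[OF zero_one_I1(1) ab(1) a] CXZ_interval[OF ab] unfolding is_state_def by blast
    ultimately show ?thesis using False ab0 by (simp add: state_cdf_def)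
  qed (use ab0 in \<open>simp add: state_cdf_def\<close>)
qed

lemma scaled_state:
  assumes st: "is_state l \<omega>" and l: "l > 1"
  shows "scaled_trans_map \<tau> (state_cdf \<omega>) l"
proof unfold_locales
  show "1 < l" by (rule l)
  show "state_cdf \<omega> 0 = 0" by (simp add: state_cdf_def)
  show "state_cdf \<omega> 1 = 1" using st by (simp add: state_cdf_def X_interval_full is_state_def)
  show "state_cdf \<omega> a \<le> state_cdf \<omega> b" if ab: "a \<in> I1 \<tau>" "b \<in> I1 \<tau>" "a \<le> b" for a b
  proof (cases "a = b")
    case False
    then have lt: "a < b" using ab by simp
    have "0 \<le> \<omega> (indicator (X_interval \<tau> a b))"
      using st CXZ_interval[OF ab(1,2) lt] unfolding is_state_def by simp
    then show ?thesis using state_cdf_diff[OF st ab(1,2) lt] by simp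
  qed simp
  fix i a b assume i: "Suc i < length as" "a \<in> lap i" "b \<in> lap i" and ab: "a \<in> I1 \<tau>" "b \<in> I1 \<tau>" "a < b"
  have tI: "\<tau> a \<in> I1 \<tau>" "\<tau> b \<in> I1 \<tau>" using I1_iff ab I1_subset by auto
  have m: "dirs i * \<tau> a < dirs i * \<tau> b" by (rule mono_lap_less[OF i ab(3)])
  have "\<omega> (transfer_op \<tau> (indicator (X_interval \<tau> a b))) = l * \<omega> (indicator (X_interval \<tau> a b))"
    using st CXZ_interval[OF ab] unfolding is_state_def by blast
  then have e: "\<omega> (indicator (X_interval \<tau> (min (\<tau> a) (\<tau> b)) (max (\<tau> a) (\<tau> b)))) = l * (state_cdf \<omega> b - state_cdf \<omega> a)"
    unfolding transfer_op_interval[OF ab i] state_cdf_diff[OF st ab] .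
  show "dirs i * (state_cdf \<omega> (\<tau> b) - state_cdf \<omega> (\<tau> a)) = l * (state_cdf \<omega> b - state_cdf \<omega> a)"
  proof (cases "dirs i = 1")
    case True
    then have "\<tau> a < \<tau> b" using m by simp
    then show ?thesis using e state_cdf_diff[OF st tI] True by (simp add: min_def max_def)
  next
    case False
    then have d: "dirs i = -1" using dirs_cases[of i] by simp
    then have "\<tau> b < \<tau> a" using m by simp
    then show ?thesis using e state_cdf_diff[OF st tI(2,1)] d by (simp add: min_def max_def)
  qed
qed

end

context scaled_trans_map
begin

lemma H_inj: "inj_on H {0..1}"
proof (rule inj_onI)
  fix x y assume "x \<in> {0..1}" "y \<in> {0..1}" "H x = H y"
  then show "x = y" using H_strict[of x y] H_strict[of y x] by (cases x y rule: linorder_cases) auto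
qed

lemma H_image: "H ` {0..1} = {0..1}"
proof
  show "H ` {0..1} \<subseteq> {0..1}" using H_mono[of 0] H_mono[of _ 1] H_0 H_1 by auto
  have "connected (H ` {0..1})" by (intro connected_continuous_image H_cont) simp
  moreover have "0 \<in> H ` {0..1}" "1 \<in> H ` {0..1}" using H_0 H_1 by (force intro: image_eqI)+
  ultimately show "{0..1} \<subseteq> H ` {0..1}" using connected_contains_Icc by metis
qed

lemma H_01: "x \<in> {0..1} \<Longrightarrow> H x \<in> {0..1}"
  using H_image by blast

lemma H_homeo: "\<exists>k. homeomorphism {0..1} {0..1} H k"
  using homeomorphism_compact[OF _ H_cont H_image H_inj] by auto

lemma H_le_iff: "x \<in> {0..1} \<Longrightarrow> y \<in> {0..1} \<Longrightarrow> H x \<le> H y \<longleftrightarrow> x \<le> y"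
  using H_strict[of y x] H_mono[of x y] by (metis atLeastAtMost_iff leD not_le)

lemma H_less_iff: "x \<in> {0..1} \<Longrightarrow> y \<in> {0..1} \<Longrightarrow> H x < H y \<longleftrightarrow> x < y"
  using H_le_iff[of y x] by (simp add: not_le[symmetric])

end

text \<open>In the coordinates \<open>H\<close> both maps are piecewise linear with slopes \<open>\<plusminus>l\<close>, the same breakpoints and
  the same signs, hence differ by a constant; surjectivity makes the constant zero.\<close>

lemma scaled_conjugacy:
  assumes s1: "scaled_trans_map \<tau>1 h1 l" and s2: "scaled_trans_map \<tau>2 h2 l"
    and len: "length (assoc_partition \<tau>1) = length (assoc_partition \<tau>2)"
    and pts: "\<And>i. i < length (assoc_partition \<tau>1) \<Longrightarrow> h1 (assoc_partition \<tau>1 ! i) = h2 (assoc_partition \<tau>2 ! i)"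
    and dir0: "pm_map.dirs \<tau>1 0 = pm_map.dirs \<tau>2 0"
  shows "\<exists>h. increasing_conjugacy \<tau>1 \<tau>2 h"
proof -
  interpret A: scaled_trans_map \<tau>1 h1 l by (rule s1)
  interpret B: scaled_trans_map \<tau>2 h2 l by (rule s2)
  obtain k1 where k1: "homeomorphism {0..1} {0..1} A.H k1" using A.H_homeo by blast
  obtain k2 where k2: "homeomorphism {0..1} {0..1} B.H k2" using B.H_homeo by blast
  define h where "h = k2 \<circ> A.H"
  have hom: "homeomorphism {0..1} {0..1} h (k1 \<circ> B.H)"
    unfolding h_def by (rule homeomorphism_compose[OF k1 homeomorphism_symD[OF k2]])
  have h01: "h x \<in> {0..1}" if "x \<in> {0..1}" for x using hom that unfolding homeomorphism_def by blast
  have Hh: "B.H (h x) = A.H x" if "x \<in> {0..1}" for x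
    using k2 A.H_01[OF that] unfolding homeomorphism_def h_def by simp
  have dirs: "Suc i < length A.as \<Longrightarrow> A.dirs i = B.dirs i" for i
  proof (induction i)
    case (Suc i) then show ?case using A.dirs_alternate[of i] B.dirs_alternate[of i] len by simp
  qed (rule dir0)
  have Hpts: "A.H (A.as ! i) = B.H (B.as ! i)" if "i < length A.as" for i
    using A.H_I1[OF A.as_I1[OF that]] B.H_I1[of "B.as ! i"] B.as_I1[of i] pts[OF that] that len by simp
  have in01: "A.as ! i \<in> {0..1}" "B.as ! i \<in> {0..1}" if "i < length A.as" for i
    using A.as_01[OF that] B.as_01[of i] that len by auto
  have hpts: "h (A.as ! i) = B.as ! i" if i: "i < length A.as" for i
    using inj_onD[OF B.H_inj, of "h (A.as ! i)" "B.as ! i"] Hh[OF in01(1)[OF i]] Hpts[OF i] h01[OF in01(1)[OF i]] in01(2)[OF i]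
    by simp
  define D where "D = (\<lambda>x. A.H (\<tau>1 x) - B.H (\<tau>2 (h x)))"
  have Dlap: "D x = D (A.as ! i)" if i: "Suc i < length A.as" and x: "x \<in> A.lap i" for i x
  proof -
    have x01: "x \<in> {0..1}" using A.lap_subset[OF i] x by blast
    have i': "i < length A.as" "Suc i < length B.as" using i len by auto
    have "A.H (A.as ! i) \<le> A.H x" "A.H x \<le> A.H (A.as ! Suc i)"
      using x A.H_le_iff in01(1)[OF i] in01(1)[OF i'(1)] x01 by (auto simp: A.lap_def)
    then have "B.H (B.as ! i) \<le> B.H (h x)" "B.H (h x) \<le> B.H (B.as ! Suc i)"
      using Hpts[OF i] Hpts[OF i'(1)] Hh[OF x01] by auto
    then have hx: "h x \<in> B.lap i"
      using B.H_le_iff in01(2)[OF i] in01(2)[OF i'(1)] h01[OF x01] by (auto simp: B.lap_def)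
    have "A.dirs i * (A.H (\<tau>1 x) - A.H (\<tau>1 (A.as ! i))) = B.dirs i * (B.H (\<tau>2 (h x)) - B.H (\<tau>2 (B.as ! i)))"
      unfolding A.H_scale[OF i x] B.H_scale[OF i'(2) hx] using Hpts[OF i'(1)] Hh[OF x01] by simp
    then have "A.H (\<tau>1 x) - A.H (\<tau>1 (A.as ! i)) = B.H (\<tau>2 (h x)) - B.H (\<tau>2 (B.as ! i))"
      using dirs[OF i] B.dirs_cases[of i] by auto
    then show ?thesis using hpts[OF i'(1)] by (simp add: D_def)
  qed
  have Dpts: "i < length A.as \<Longrightarrow> D (A.as ! i) = D 0" for i
  proof (induction i)
    case 0 show ?case by (simp add: A.as_0)
  next
    case (Suc i)
    have "A.as ! Suc i \<in> A.lap i" using A.as_less[of i "Suc i"] Suc.prems by (simp add: A.lap_def)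
    then show ?case using Dlap[OF Suc.prems] Suc by simp
  qed
  have Dconst: "D x = D 0" if x: "x \<in> {0..1}" for x
  proof -
    have "0 \<le> x" "x \<le> 1" using x by auto
    then obtain i where i: "Suc i < length A.as" "x \<in> A.lap i" by (rule A.locate)
    then show ?thesis using Dlap[OF i] Dpts[of i] by simp
  qed
  \<comment> \<open>At a point where \<open>\<tau>1\<close> takes the value 0 the difference is at
    most 0, and where it takes the value 1 it is at least 0.\<close>
  have D0: "D 0 = 0"
  proof -
    have "0 \<in> \<tau>1 ` {0..1}" "1 \<in> \<tau>1 ` {0..1}" unfolding A.surj by simp_all
    then obtain x0 x1 where x: "x0 \<in> {0..1}" "\<tau>1 x0 = 0" "x1 \<in> {0..1}" "\<tau>1 x1 = 1" by (metis imageE)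
    have "B.H (\<tau>2 (h x0)) \<in> {0..1}" "B.H (\<tau>2 (h x1)) \<in> {0..1}"
      using B.H_01 B.maps h01 x by blast+
    moreover have "D x0 = - B.H (\<tau>2 (h x0))" "D x1 = 1 - B.H (\<tau>2 (h x1))"
      using x by (simp_all add: D_def A.H_0 A.H_1)
    ultimately show ?thesis using Dconst[OF x(1)] Dconst[OF x(3)] by auto
  qed
  have "increasing_conjugacy \<tau>1 \<tau>2 h" unfolding increasing_conjugacy_def
  proof (intro conjI ballI exI[of _ "k1 \<circ> B.H"])
    show "strict_mono_on {0..1} h"
    proof (rule strict_mono_onI)
      fix x y :: real assume xy: "x \<in> {0..1}" "y \<in> {0..1}" "x < y"
      then have "B.H (h x) < B.H (h y)" using A.H_less_iff Hh by simp
      then show "h x < h y" using B.H_less_iff h01 xy by blast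
    qed
    fix x :: real assume x: "x \<in> {0..1}"
    have "B.H (h (\<tau>1 x)) = B.H (\<tau>2 (h x))" using Dconst[OF x] D0 Hh[OF A.maps[OF x]] by (simp add: D_def)
    then show "h (\<tau>1 x) = \<tau>2 (h x)"
      using inj_onD[OF B.H_inj] h01 A.maps[OF x] B.maps x by blast
  qed (rule hom)
  then show ?thesis by blast
qed

text \<open>Each property of an isomorphism of triples supplies one clause of
  \<open>is_state\<close> for the pulled-back functional: the homomorphism gives additivity, the
  cones positivity, unitality the normalisation, and intertwining the eigenvalue. The generators
  then align the two distribution functions at the partition points.\<close>

lemma conjugacy_from_iso:
  assumes t1: "trans_map \<tau>1" and t2: "trans_map \<tau>2" and dir0: "pm_map.dirs \<tau>1 0 = pm_map.dirs \<tau>2 0"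
    and iso: "dimension_triple_iso \<tau>1 \<tau>2 \<Phi>" and un: "unital \<tau>1 \<tau>2 \<Phi>"
    and gens: "map \<Phi> (canonical_generators \<tau>1) = canonical_generators \<tau>2"
  shows "\<exists>h. increasing_conjugacy \<tau>1 \<tau>2 h"
proof -
  interpret A: trans_map \<tau>1 by (rule t1)
  interpret B: trans_map \<tau>2 by (rule t2)
  obtain l \<omega> where l: "l > 1" and st: "B.is_state l \<omega>" using B.state_exists by blast
  have l0: "l > 0" using l by simp
  have hom: "\<Phi> \<in> hom (DG \<tau>1) (DG \<tau>2)" using iso by (simp add: dimension_triple_iso_def Group.iso_def)
  have \<Phi>c: "\<Phi> A \<in> carrier (DG \<tau>2)" if "A \<in> carrier (DG \<tau>1)" for A using hom_in_carrier[OF hom that] .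
  define w where "w = (\<lambda>f. B.class_val \<omega> (\<Phi> (DG_class \<tau>1 f)))"
  have wI: "\<exists>g\<in>CXZ \<tau>2. \<Phi> (DG_class \<tau>1 f) = DG_class \<tau>2 g \<and> w f = \<omega> g" if f: "f \<in> CXZ \<tau>1" for f
  proof -
    obtain g where "g \<in> CXZ \<tau>2" "\<Phi> (DG_class \<tau>1 f) = DG_class \<tau>2 g"
      by (rule B.carrier_cases[OF \<Phi>c[OF A.class_carrier[OF f]]])
    then show ?thesis using B.class_val_eq[OF st l0] by (auto simp: w_def)
  qed
  have w_eq: "w f = \<omega> g" if "f \<in> CXZ \<tau>1" "g \<in> CXZ \<tau>2" "\<Phi> (DG_class \<tau>1 f) = DG_class \<tau>2 g" for f g
    unfolding w_def that(3) by (rule B.class_val_eq[OF st l0 that(2)])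
  have st1: "A.is_state l w" unfolding A.is_state_def
  proof (intro conjI ballI impI)
    fix f1 f2 assume f: "f1 \<in> CXZ \<tau>1" "f2 \<in> CXZ \<tau>1"
    obtain g1 where g1: "g1 \<in> CXZ \<tau>2" "\<Phi> (DG_class \<tau>1 f1) = DG_class \<tau>2 g1" "w f1 = \<omega> g1" using wI[OF f(1)] by blast
    obtain g2 where g2: "g2 \<in> CXZ \<tau>2" "\<Phi> (DG_class \<tau>1 f2) = DG_class \<tau>2 g2" "w f2 = \<omega> g2" using wI[OF f(2)] by blast
    have "\<Phi> (DG_class \<tau>1 (\<lambda>p. f1 p + f2 p)) = DG_class \<tau>2 (\<lambda>p. g1 p + g2 p)"
      using hom_mult[OF hom A.class_carrier[OF f(1)] A.class_carrier[OF f(2)]]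
      unfolding A.DG_mult[OF f] g1 g2 B.DG_mult[OF g1(1) g2(1)] .
    then have "w (\<lambda>p. f1 p + f2 p) = \<omega> (\<lambda>p. g1 p + g2 p)"
      by (intro w_eq A.CXZ_add B.CXZ_add f g1 g2)
    also have "\<dots> = \<omega> g1 + \<omega> g2" using st g1 g2 unfolding B.is_state_def by blast
    finally show "w (\<lambda>p. f1 p + f2 p) = w f1 + w f2" using g1 g2 by simp
  next
    fix f assume f: "f \<in> CXZ \<tau>1" "\<forall>p\<in>A.X. 0 \<le> f p"
    have "DG_class \<tau>1 f \<in> DG_pos \<tau>1"
      unfolding DG_pos_def using f by (intro CollectI exI[of _ f] conjI exI[of _ 0]) auto
    then have "\<Phi> (DG_class \<tau>1 f) \<in> DG_pos \<tau>2" using iso unfolding dimension_triple_iso_def by blast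
    then obtain g n where g: "\<Phi> (DG_class \<tau>1 f) = DG_class \<tau>2 g" "g \<in> CXZ \<tau>2" "\<forall>p\<in>B.X. 0 \<le> (transfer_op \<tau>2 ^^ n) g p"
      unfolding DG_pos_def by blast
    \<comment> \<open>Positivity in \<open>DG\<close> is only eventual: some iterate of
      \<open>g\<close> is nonnegative. The eigenvalue equation removes the iterate at the cost of
      the positive factor \<open>l ^ n\<close>.\<close>
    have "0 \<le> \<omega> ((transfer_op \<tau>2 ^^ n) g)"
      using st g(3) B.transfer_op_iter_CXZ[OF g(2)] unfolding B.is_state_def by blast
    then have "0 \<le> \<omega> g" 
      using B.state_iter[OF st g(2), of n] mult_le_cancel_left_pos[of "l ^ n" 0 "\<omega> g"] l0 by simp
    then show "0 \<le> w f" using w_eq[OF f(1) g(2,1)] by simp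
  next
    have "w (indicator A.X) = \<omega> (indicator B.X)"
      using un by (intro w_eq A.CXZ_unit B.CXZ_unit) (simp add: unital_def DG_unit_def)
    then show "w (indicator A.X) = 1" using st by (simp add: B.is_state_def)
  next
    fix f assume f: "f \<in> CXZ \<tau>1"
    obtain g where g: "g \<in> CXZ \<tau>2" "\<Phi> (DG_class \<tau>1 f) = DG_class \<tau>2 g" "w f = \<omega> g" using wI[OF f] by blast
    have "\<Phi> (DG_shift \<tau>1 (DG_class \<tau>1 f)) = DG_shift \<tau>2 (\<Phi> (DG_class \<tau>1 f))"
      using iso A.class_carrier[OF f] unfolding dimension_triple_iso_def by blast
    then have "\<Phi> (DG_class \<tau>1 (transfer_op \<tau>1 f)) = DG_class \<tau>2 (transfer_op \<tau>2 g)"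
      unfolding A.DG_shift_class[OF f] g(2) B.DG_shift_class[OF g(1)] .
    then have "w (transfer_op \<tau>1 f) = \<omega> (transfer_op \<tau>2 g)"
      by (intro w_eq A.transfer_op_CXZ B.transfer_op_CXZ f g)
    also have "\<dots> = l * \<omega> g" using st g(1) unfolding B.is_state_def by blast
    finally show "w (transfer_op \<tau>1 f) = l * w f" using g(3) by simp
  qed
  have "length A.as - 1 = length B.as - 1"
    using arg_cong[OF gens, of length] by (simp add: canonical_generators_def)
  then have len: "length A.as = length B.as" using A.as_len B.as_len by simp
  have gen: "w (indicator (X_interval \<tau>1 (A.as ! i) (A.as ! Suc i))) = \<omega> (indicator (X_interval \<tau>2 (B.as ! i) (B.as ! Suc i)))"
    if i: "Suc i < length A.as" for i
  proof (rule w_eq)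
    show "indicator (X_interval \<tau>1 (A.as ! i) (A.as ! Suc i)) \<in> CXZ \<tau>1"
      using i A.as_less by (intro A.CXZ_interval A.as_I1) auto
    show "indicator (X_interval \<tau>2 (B.as ! i) (B.as ! Suc i)) \<in> CXZ \<tau>2"
      using i B.as_less len by (intro B.CXZ_interval B.as_I1) auto
    have "map \<Phi> (canonical_generators \<tau>1) ! i = canonical_generators \<tau>2 ! i" using gens by simp
    then show "\<Phi> (DG_class \<tau>1 (indicator (X_interval \<tau>1 (A.as ! i) (A.as ! Suc i)))) =
       DG_class \<tau>2 (indicator (X_interval \<tau>2 (B.as ! i) (B.as ! Suc i)))"
      using i len by (simp add: canonical_generators_def)
  qed
  \<comment> \<open>The generators give the increments between consecutive partition points, and the
    sums start from the common value 0.\<close>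
  have pts: "i < length A.as \<Longrightarrow> A.state_cdf w (A.as ! i) = B.state_cdf \<omega> (B.as ! i)" for i
  proof (induction i)
    case 0 then show ?case by (simp add: A.as_0 B.as_0 A.state_cdf_def B.state_cdf_def)
  next
    case (Suc i)
    have "A.state_cdf w (A.as ! Suc i) - A.state_cdf w (A.as ! i) = B.state_cdf \<omega> (B.as ! Suc i) - B.state_cdf \<omega> (B.as ! i)"
      using gen[OF Suc.prems] A.state_cdf_diff[OF st1 A.as_I1 A.as_I1 A.as_less[of i "Suc i"]]
        B.state_cdf_diff[OF st B.as_I1 B.as_I1 B.as_less[of i "Suc i"]] Suc.prems len by simp
    then show ?case using Suc by simp
  qed
  show ?thesis
    by (rule scaled_conjugacy[OF A.scaled_state[OF st1 l] B.scaled_state[OF st l] len pts dir0])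
qed

section \<open>From conjugacies to dimension triples\<close>

text \<open>The conjugacy \<open>h\<close> is extended by the identity outside \<open>[0,1]\<close>, so that \<open>h\<close> and its inverse \<open>k\<close>
  are bijections of the whole line and composition with them acts on functions without restriction.\<close>

locale conjugate_maps =
  fixes \<tau>1 \<tau>2 h k :: "real \<Rightarrow> real"
  assumes t1: "trans_map \<tau>1" and t2: "trans_map \<tau>2"
    and hk: "\<And>x. k (h x) = x" and kh: "\<And>y. h (k y) = y"
    and h01: "\<And>x. h x \<in> {0..1} \<longleftrightarrow> x \<in> {0..1}"
    and h_cont: "continuous_on {0..1} h" and k_cont: "continuous_on {0..1} k"
    and h_less: "\<And>x y. x \<in> {0..1} \<Longrightarrow> y \<in> {0..1} \<Longrightarrow> h x < h y \<longleftrightarrow> x < y"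
    and conj: "\<And>x. x \<in> {0..1} \<Longrightarrow> h (\<tau>1 x) = \<tau>2 (h x)"
begin

sublocale A: trans_map \<tau>1 by (rule t1)
sublocale B: trans_map \<tau>2 by (rule t2)

text \<open>The hypotheses are symmetric, so inclusions proved in one direction yield the reverse
  ones by interpreting the locale with the roles exchanged.\<close>

lemma swap: "conjugate_maps \<tau>2 \<tau>1 k h"
proof
  have k01: "k y \<in> {0..1} \<longleftrightarrow> y \<in> {0..1}" for y using h01[of "k y"] kh by simp
  then show "k y \<in> {0..1} \<longleftrightarrow> y \<in> {0..1}" for y .
  show "k x < k y \<longleftrightarrow> x < y" if "x \<in> {0..1}" "y \<in> {0..1}" for x y
    using h_less[of "k x" "k y"] k01 that kh by simp
  show "k (\<tau>2 y) = \<tau>1 (k y)" if "y \<in> {0..1}" for y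
    using conj[of "k y"] k01 that kh hk by metis
qed (use t1 t2 hk kh h_cont k_cont in \<open>auto simp: trans_map_def trans_map_axioms_def pm_map_def\<close>)

lemma h_le: "x \<in> {0..1} \<Longrightarrow> y \<in> {0..1} \<Longrightarrow> h x \<le> h y \<longleftrightarrow> x \<le> y"
  using h_less[of y x] by (simp add: not_less[symmetric])

lemma h_inj: "h x = h y \<longleftrightarrow> x = y"
  using hk by metis

lemma h_mem: "h x \<in> h ` S \<Longrightarrow> x \<in> S"
  by (auto simp: h_inj)

lemma h_0: "h 0 = 0" and h_1: "h 1 = 1"
proof -
  have k01: "k y \<in> {0..1} \<longleftrightarrow> y \<in> {0..1}" for y using h01[of "k y"] kh by simp
  have "h 0 \<le> h (k 0)" "h (k 1) \<le> h 1" using k01[of 0] k01[of 1] by (subst h_le; simp)+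
  then show "h 0 = 0" "h 1 = 1" using h01[of 0] h01[of 1] kh by auto
qed

lemma h_Ioo:
  assumes "u \<in> {0..1}" "v \<in> {0..1}" shows "h ` {u<..<v} = {h u<..<h v}"
proof
  have s: "{u<..<v} \<subseteq> {0..1}" using assms by auto
  show "h ` {u<..<v} \<subseteq> {h u<..<h v}" using s h_less assms by auto
  show "{h u<..<h v} \<subseteq> h ` {u<..<v}"
  proof
    fix y assume y: "y \<in> {h u<..<h v}"
    have "h u \<in> {0..1}" "h v \<in> {0..1}" using assms h01 by auto
    then have "y \<in> {0..1}" using y by auto
    then have "k y \<in> {0..1}" using h01[of "k y"] kh by simp
    then have "u < k y" "k y < v" using h_less[of u "k y"] h_less[of "k y" v] y kh assms by auto
    then show "y \<in> h ` {u<..<v}" using kh[of y] by (metis greaterThanLessThan_iff imageI)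
  qed
qed

lemma mono_sgn_image:
  assumes m: "mono_sgn e S \<tau>1" and S: "S \<subseteq> {0..1}" and e: "e \<in> {1, -1}"
  shows "mono_sgn e (h ` S) \<tau>2"
  unfolding mono_sgn_def
proof (intro ballI impI)
  fix x' y' assume "x' \<in> h ` S" "y' \<in> h ` S" and lt: "x' < y'"
  then obtain x y where xy: "x \<in> S" "y \<in> S" "x' = h x" "y' = h y" by blast
  have xy01: "x \<in> {0..1}" "y \<in> {0..1}" using xy S by auto
  have "x < y" using lt xy h_less[OF xy01] by simp
  then have "e * \<tau>1 x < e * \<tau>1 y" using m xy unfolding mono_sgn_def by blast
  then have "e * h (\<tau>1 x) < e * h (\<tau>1 y)"
    using e h_less[OF A.maps[OF xy01(1)] A.maps[OF xy01(2)]] h_less[OF A.maps[OF xy01(2)] A.maps[OF xy01(1)]] by auto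
  then show "e * \<tau>2 x' < e * \<tau>2 y'" using conj xy01 xy by simp
qed

lemma strictly_monotonic_image:
  assumes "strictly_monotonic_on S \<tau>1" "S \<subseteq> {0..1}" shows "strictly_monotonic_on (h ` S) \<tau>2"
proof -
  obtain e where "e \<in> {1, -1}" "mono_sgn e S \<tau>1" using assms(1) by (auto simp: strictly_monotonic_on_iff_mono_sgn)
  then show ?thesis using mono_sgn_image assms(2) unfolding strictly_monotonic_on_iff_mono_sgn by blast
qed

lemma as_in: "i < length A.as \<Longrightarrow> A.as ! i \<in> {0..1}"
  using A.as_01 by auto

lemma monotonicity_points_image: "monotonicity_points \<tau>2 (map h A.as)"
  unfolding monotonicity_points_def
proof (intro conjI allI impI)
  show "2 \<le> length (map h A.as)" using A.as_len by simp
  show "hd (map h A.as) = 0" "last (map h A.as) = 1"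
    using A.as_ne A.as_hd A.as_last h_0 h_1 by (simp_all add: hd_map last_map)
  show "sorted_wrt (<) (map h A.as)"
    using A.as_less as_in h_less by (auto simp: sorted_wrt_iff_nth_less)
  fix i assume "Suc i < length (map h A.as)"
  then have i: "Suc i < length A.as" by simp
  have "strictly_monotonic_on {A.as ! i<..<A.as ! Suc i} \<tau>1"
    using A.mp_as i by (simp add: monotonicity_points_def)
  moreover have s: "{A.as ! i<..<A.as ! Suc i} \<subseteq> {0..1}" using as_in[of i] as_in[of "Suc i"] i by auto
  ultimately have "strictly_monotonic_on (h ` {A.as ! i<..<A.as ! Suc i}) \<tau>2" by (rule strictly_monotonic_image)
  then show "strictly_monotonic_on {map h A.as ! i<..<map h A.as ! Suc i} \<tau>2"
    using h_Ioo[OF as_in as_in, of i "Suc i"] i by simp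
qed

text \<open>The maximal list is unique, so it suffices that the image list is maximal. A larger
  interval of monotonicity for \<open>\<tau>2\<close> would pull back along \<open>k\<close> to one
  for \<open>\<tau>1\<close>.\<close>

lemma as_image: "B.as = map h A.as"
proof (rule B.as_eqI)
  interpret S: conjugate_maps \<tau>2 \<tau>1 k h by (rule swap)
  show "maximal_monotonicity_points \<tau>2 (map h A.as)" unfolding maximal_monotonicity_points_def
  proof (intro conjI allI impI notI)
    fix i u v assume "Suc i < length (map h A.as)"
      and uv: "{u<..<v} \<subseteq> {0..1} \<and> {map h A.as ! i<..<map h A.as ! Suc i} \<subset> {u<..<v}"
      and sm: "strictly_monotonic_on {u<..<v} \<tau>2"
    then have i: "Suc i < length A.as" by simp
    have ne: "{u<..<v} \<noteq> {}" using uv by auto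
    then have uv01: "u \<in> {0..1}" "v \<in> {0..1}" using uv by (auto simp: greaterThanLessThan_subseteq_atLeastAtMost_iff)
    have eq: "k ` {u<..<v} = {k u<..<k v}" by (rule S.h_Ioo[OF uv01])
    have I: "h ` {A.as ! i<..<A.as ! Suc i} = {map h A.as ! i<..<map h A.as ! Suc i}"
      using h_Ioo[OF as_in as_in, of i "Suc i"] i by simp
    have inv: "k ` h ` T = T" for T using hk by (simp add: image_comp)
    have "inj_on k {u<..<v}" by (rule inj_onI) (simp add: S.h_inj)
    then have "k ` (h ` {A.as ! i<..<A.as ! Suc i}) \<subset> k ` {u<..<v}"
      by (rule image_strict_mono) (use uv I in simp)
    then have "{A.as ! i<..<A.as ! Suc i} \<subset> {k u<..<k v}" unfolding inv eq .
    moreover have "strictly_monotonic_on {k u<..<k v} \<tau>1"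
      using S.strictly_monotonic_image[OF sm] uv eq by simp
    moreover have "{k u<..<k v} \<subseteq> {0..1}" using S.h01 uv unfolding eq[symmetric] by blast
    ultimately show False using A.maximal_as i unfolding maximal_monotonicity_points_def by blast
  qed (rule monotonicity_points_image)
qed

lemma len_as: "length B.as = length A.as" and nth_as: "i < length A.as \<Longrightarrow> B.as ! i = h (A.as ! i)"
  by (simp_all add: as_image)

text \<open>The image of the orbit contains \<open>h x\<close> and is forward and backward
  invariant, hence it is one of the sets being intersected.\<close>

lemma generalized_orbit_image_subset:
  assumes x: "x \<in> {0..1}" shows "generalized_orbit \<tau>2 (h x) \<subseteq> h ` generalized_orbit \<tau>1 x"
proof -
  let ?G = "generalized_orbit \<tau>1 x"
  have G01: "?G \<subseteq> {0..1}" by (rule A.generalized_orbit_subset[OF x])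
  have "h ` ?G \<in> {A. A \<subseteq> {0..1} \<and> h x \<in> A \<and> \<tau>2 ` A \<subseteq> A \<and> {y \<in> {0..1}. \<tau>2 y \<in> A} \<subseteq> A}"
  proof (rule CollectI, intro conjI subsetI)
    fix z assume "z \<in> h ` ?G" then show "z \<in> {0..1}" using G01 h01 by blast
  next
    show "h x \<in> h ` ?G" using A.generalized_orbit_self by blast
  next
    fix z assume "z \<in> \<tau>2 ` h ` ?G"
    then obtain y where y: "y \<in> ?G" "z = \<tau>2 (h y)" by blast
    have y01: "y \<in> {0..1}" using y(1) G01 by blast
    have "z = h (\<tau>1 y)" using conj[OF y01] y(2) by simp
    moreover have "\<tau>1 y \<in> ?G" using A.generalized_orbit_iff[OF y01] y(1) by blast
    ultimately have "z = h (\<tau>1 y)" "\<tau>1 y \<in> ?G" by blast+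
    then show "z \<in> h ` ?G" by blast
  next
    fix z assume z: "z \<in> {y \<in> {0..1}. \<tau>2 y \<in> h ` ?G}"
    then have kz: "k z \<in> {0..1}" using h01[of "k z"] kh by simp
    have "h (\<tau>1 (k z)) \<in> h ` ?G" using conj[OF kz] z kh by simp
    then have "\<tau>1 (k z) \<in> ?G" by (rule h_mem)
    then have "k z \<in> ?G" using A.generalized_orbit_iff[OF kz] by blast
    then have "h (k z) \<in> h ` ?G" by (rule imageI)
    then show "z \<in> h ` ?G" by (simp add: kh)
  qed
  then show ?thesis unfolding generalized_orbit_def[of \<tau>2] by (rule Inter_lower)
qed

lemma I1_image_subset: "I1 \<tau>2 \<subseteq> h ` I1 \<tau>1"
proof
  fix z assume "z \<in> I1 \<tau>2"
  then obtain a where a: "a \<in> set A.as" "z \<in> generalized_orbit \<tau>2 (h a)" by (auto simp: I1_def as_image)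
  then have "z \<in> h ` generalized_orbit \<tau>1 a" using generalized_orbit_image_subset[of a] A.set_as_01[OF a(1)] by auto
  then show "z \<in> h ` I1 \<tau>1" using a(1) unfolding I1_def by blast
qed

lemma I1_iff: "h x \<in> I1 \<tau>2 \<longleftrightarrow> x \<in> I1 \<tau>1"
proof
  interpret S: conjugate_maps \<tau>2 \<tau>1 k h by (rule swap)
  show "h x \<in> I1 \<tau>2" if "x \<in> I1 \<tau>1"
  proof -
    have "k (h x) \<in> k ` I1 \<tau>2" using subsetD[OF S.I1_image_subset that] by (simp only: hk)
    then show ?thesis by (rule S.h_mem)
  qed
  show "x \<in> I1 \<tau>1" if "h x \<in> I1 \<tau>2"
    by (rule h_mem[OF subsetD[OF I1_image_subset that]])
qed

lemma split_iff: "h x \<in> split_points \<tau>2 \<longleftrightarrow> x \<in> split_points \<tau>1"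
proof -
  have "h x = 0 \<longleftrightarrow> x = 0" "h x = 1 \<longleftrightarrow> x = 1" using h_inj[of x 0] h_inj[of x 1] h_0 h_1 by simp_all
  then show ?thesis unfolding split_points_def by (simp add: I1_iff)
qed

text \<open>The lift of \<open>h\<close> to the split spaces. The side marker is kept because
  \<open>h\<close> is increasing; a decreasing conjugacy would have to flip it.\<close>

definition E :: "point \<Rightarrow> point" where "E p = (h (fst p), snd p)"

definition E' :: "point \<Rightarrow> point" where "E' p = (k (fst p), snd p)"

lemma E_inv [simp]: "E' (E p) = p" "E (E' p) = p"
  by (simp_all add: E_def E'_def hk kh)

lemma fst_E [simp]: "fst (E p) = h (fst p)"
  by (simp add: E_def)

lemma E_X: "E p \<in> B.X \<longleftrightarrow> p \<in> A.X"
proof -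
  have "h (fst p) \<in> {0..1} \<longleftrightarrow> fst p \<in> {0..1}" by (rule h01)
  then show ?thesis using split_iff[of "fst p"] unfolding X_space_def E_def by (cases p) auto
qed

lemma E_sp: "B.sp (h x) e = E (A.sp x e)"
  by (simp add: A.sp_def B.sp_def E_def split_iff)

lemma valid_h: "valid (h x) e \<longleftrightarrow> valid x e"
proof -
  have "x \<in> {0..1} \<Longrightarrow> 0 < h x \<longleftrightarrow> 0 < x" "x \<in> {0..1} \<Longrightarrow> h x < 1 \<longleftrightarrow> x < 1"
    using h_less[of 0 x] h_less[of x 1] h_0 h_1 by auto
  then show ?thesis using h01[of x] unfolding valid_def by auto
qed

lemma in_ival_h: "a \<in> {0..1} \<Longrightarrow> b \<in> {0..1} \<Longrightarrow> x \<in> {0..1} \<Longrightarrow> in_ival (h a) (h b) (h x) e \<longleftrightarrow> in_ival a b x e"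
  unfolding in_ival_def using h_less h_le by simp

lemma lap_side_h: "x \<in> {0..1} \<Longrightarrow> B.lap_side i (h x) e \<longleftrightarrow> A.lap_side i x e"
  unfolding A.lap_side_def B.lap_side_def len_as
  using in_ival_h[OF as_in as_in, of i "Suc i"] nth_as[of i] nth_as[of "Suc i"] by (cases "Suc i < length A.as") simp_all

lemma dirs_h:
  assumes i: "Suc i < length A.as" shows "B.dirs i = A.dirs i"
proof -
  have e: "A.dirs i \<in> {1, -1}" "B.dirs i \<in> {1, -1}" using A.dirs_cases[of i] B.dirs_cases[of i] by auto
  let ?J = "{A.as ! i<..<A.as ! Suc i}"
  have a: "A.as ! i \<in> {0..1}" "A.as ! Suc i \<in> {0..1}" using as_in i by auto
  have "mono_sgn (A.dirs i) ?J \<tau>1" by (rule mono_sgn_subset[OF A.mono_lap[OF i]]) (auto simp: A.lap_def)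
  moreover have "?J \<subseteq> {0..1}" using a by auto
  ultimately have "mono_sgn (A.dirs i) (h ` ?J) \<tau>2" using e(1) by (rule mono_sgn_image)
  then have m1: "mono_sgn (A.dirs i) {h (A.as ! i)<..<h (A.as ! Suc i)} \<tau>2" unfolding h_Ioo[OF a] .
  have m2: "mono_sgn (B.dirs i) {h (A.as ! i)<..<h (A.as ! Suc i)} \<tau>2"
    by (rule mono_sgn_subset[OF B.mono_lap]) (use i len_as nth_as in \<open>auto simp: B.lap_def\<close>)
  have "h (A.as ! i) < h (A.as ! Suc i)" using h_less[OF a] A.as_less[of i "Suc i"] i by simp
  then obtain x where x: "h (A.as ! i) < x" "x < h (A.as ! Suc i)" using dense by blast
  obtain y where y: "x < y" "y < h (A.as ! Suc i)" using x dense by blast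
  show ?thesis by (rule mono_sgn_unique[OF m2 m1 e(2,1), of x y]) (use x y in auto)
qed

lemma dr_h:
  assumes v: "valid x e" shows "B.dr (h x) e = A.dr x e"
proof -
  obtain i where i: "A.lap_side i x e" using A.lap_side_ex[OF v] by blast
  then have "B.lap_side i (h x) e" using lap_side_h valid_01[OF v] by blast
  then show ?thesis using A.dr_eq[OF i] B.dr_eq dirs_h i by (simp add: A.lap_side_def)
qed

lemma sg_E:
  assumes p: "p \<in> A.X" shows "B.sg (E p) = E (A.sg p)"
proof -
  obtain x e where v: "valid x e" "p = A.sp x e" by (rule A.X_cases[OF p])
  have "B.sg (E p) = B.sp (\<tau>2 (h x)) (B.dr (h x) e)" using B.sg_sp[of "h x" e] valid_h v by (simp add: E_sp)
  also have "\<dots> = E (A.sp (\<tau>1 x) (A.dr x e))" using conj[OF valid_01[OF v(1)]] dr_h[OF v(1)] E_sp by metis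
  finally show ?thesis using A.sg_sp v by simp
qed

section \<open>Transport of functions and of the dimension triple\<close>

definition P :: "(point \<Rightarrow> int) \<Rightarrow> point \<Rightarrow> int" where "P f = f \<circ> E"

definition Q :: "(point \<Rightarrow> int) \<Rightarrow> point \<Rightarrow> int" where "Q f = f \<circ> E'"

lemma PQ [simp]: "P (Q f) = f" "Q (P f) = f"
  by (auto simp: P_def Q_def)

lemma P_CXZ:
  assumes f: "f \<in> CXZ \<tau>2" shows "P f \<in> CXZ \<tau>1"
  unfolding A.CXZ_iff
proof (intro conjI allI impI)
  fix p assume "p \<notin> A.X"
  then have "E p \<notin> B.X" by (simp only: E_X not_False_eq_True)
  then show "P f p = 0" using f unfolding B.CXZ_iff P_def o_def by blast
next
  fix x e assume v: "valid x e"
  have x01: "x \<in> {0..1}" by (rule valid_01[OF v])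
  obtain d where d: "d > 0" "\<forall>q\<in>B.X. fst q \<in> side (h x) e d \<longrightarrow> f q = f (B.sp (h x) e)"
    using f v valid_h unfolding B.CXZ_iff by blast
  obtain d' where d': "d' > 0" "\<And>y. y \<in> {0..1} \<Longrightarrow> dist y x < d' \<Longrightarrow> dist (h y) (h x) < d"
    using h_cont x01 d(1) unfolding continuous_on_iff by blast
  have "P f q = P f (A.sp x e)" if q: "q \<in> A.X" "fst q \<in> side x e d'" for q
  proof -
    have q01: "fst q \<in> {0..1}" by (rule A.X_01[OF q(1)])
    have "dist (fst q) x < d'" using q(2) v by (auto simp: side_def valid_def dist_real_def)
    then have "\<bar>h (fst q) - h x\<bar> < d" using d'(2)[OF q01] by (simp add: dist_real_def)
    then have "h (fst q) \<in> side (h x) e d"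
      using q(2) v h_less[OF x01 q01] h_less[OF q01 x01] by (auto simp: valid_def side_simps)
    then show ?thesis using d(2) E_X q(1) by (simp add: P_def E_sp[symmetric])
  qed
  then show "\<exists>d>0. \<forall>q\<in>A.X. fst q \<in> side x e d \<longrightarrow> P f q = P f (A.sp x e)" using d'(1) by blast
qed

text \<open>By \<open>sg_E\<close> the lift \<open>E\<close> maps the fibre over \<open>q\<close>
  bijectively onto the fibre over \<open>E q\<close>, so the two sums have the same terms.\<close>

lemma transfer_op_P: "transfer_op \<tau>1 (P f) = P (transfer_op \<tau>2 f)"
proof
  fix q
  have "(\<Sum>p | p \<in> A.X \<and> A.sg p = q. P f p) = (\<Sum>p | p \<in> B.X \<and> B.sg p = E q. f p)"
  proof (rule sum.reindex_bij_witness[of _ E' E])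
    fix p assume "p \<in> {p. p \<in> A.X \<and> A.sg p = q}"
    then show "E p \<in> {p. p \<in> B.X \<and> B.sg p = E q}" using E_X sg_E by auto
  next
    fix p assume p: "p \<in> {p. p \<in> B.X \<and> B.sg p = E q}"
    then have "E' p \<in> A.X" using E_X[of "E' p"] by simp
    moreover from this have "E (A.sg (E' p)) = E q" using sg_E[of "E' p"] p by simp
    then have "E' (E (A.sg (E' p))) = E' (E q)" by (rule arg_cong)
    then have "A.sg (E' p) = q" by simp
    ultimately show "E' p \<in> {p. p \<in> A.X \<and> A.sg p = q}" by blast
  qed (auto simp: P_def)
  then show "transfer_op \<tau>1 (P f) q = P (transfer_op \<tau>2 f) q"
    unfolding A.transfer_op_eq P_def o_def B.transfer_op_eq by (simp add: P_def)
qed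

lemma X_interval_E:
  assumes a: "a \<in> I1 \<tau>1" "b \<in> I1 \<tau>1" "a < b"
  shows "E p \<in> X_interval \<tau>2 (h a) (h b) \<longleftrightarrow> p \<in> X_interval \<tau>1 a b"
proof (cases "p \<in> A.X")
  case True
  then obtain x e where v: "valid x e" "p = A.sp x e" by (rule A.X_cases)
  have a01: "a \<in> {0..1}" "b \<in> {0..1}" using a A.I1_subset by auto
  have "h a < h b" using h_less[OF a01] a by simp
  then have "E p \<in> X_interval \<tau>2 (h a) (h b) \<longleftrightarrow> in_ival (h a) (h b) (h x) e"
    using B.sp_in_interval[of "h x" e "h a" "h b"] valid_h v I1_iff a by (simp add: E_sp)
  then show ?thesis using A.sp_in_interval[OF v(1) a] v(2) in_ival_h[OF a01 valid_01[OF v(1)]] by simp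
next
  case False
  then show ?thesis using E_X[of p] A.X_interval_subset B.X_interval_subset by blast
qed

lemma Q_CXZ:
  assumes f: "f \<in> CXZ \<tau>1" shows "Q f \<in> CXZ \<tau>2"
proof -
  interpret S: conjugate_maps \<tau>2 \<tau>1 k h by (rule swap)
  have "S.P f = Q f" by (simp add: S.P_def Q_def S.E_def E'_def fun_eq_iff)
  then show ?thesis using S.P_CXZ[OF f] by simp
qed

lemma transfer_op_Q: "transfer_op \<tau>2 (Q f) = Q (transfer_op \<tau>1 f)"
  using transfer_op_P[of "Q f"] by (metis PQ)

lemma transfer_op_iter_Q: "(transfer_op \<tau>2 ^^ n) (Q f) = Q ((transfer_op \<tau>1 ^^ n) f)"
  by (induction n) (simp_all add: transfer_op_Q)

lemma E'_X: "E' p \<in> A.X \<longleftrightarrow> p \<in> B.X"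
  using E_X[of "E' p"] by simp

text \<open>A class is a set of functions, so the isomorphism can be the plain image under
  \<open>Q\<close>. As \<open>Q\<close> is a bijection commuting with the transfer operators,
  classes go exactly onto classes and no representatives have to be chosen.\<close>

definition \<Phi> :: "(point \<Rightarrow> int) set \<Rightarrow> (point \<Rightarrow> int) set" where "\<Phi> A = Q ` A"

lemma \<Phi>_class:
  assumes f: "f \<in> CXZ \<tau>1" shows "\<Phi> (DG_class \<tau>1 f) = DG_class \<tau>2 (Q f)"
proof
  show "\<Phi> (DG_class \<tau>1 f) \<subseteq> DG_class \<tau>2 (Q f)"
  proof
    fix g' assume "g' \<in> \<Phi> (DG_class \<tau>1 f)"
    then obtain g n where g: "g' = Q g" "g \<in> CXZ \<tau>1" "(transfer_op \<tau>1 ^^ n) f = (transfer_op \<tau>1 ^^ n) g"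
      unfolding \<Phi>_def by (auto simp: A.in_class DG_rel_def)
    then have "(transfer_op \<tau>2 ^^ n) (Q f) = (transfer_op \<tau>2 ^^ n) (Q g)" by (simp add: transfer_op_iter_Q)
    then show "g' \<in> DG_class \<tau>2 (Q f)" using g f Q_CXZ unfolding B.in_class DG_rel_def by blast
  qed
  show "DG_class \<tau>2 (Q f) \<subseteq> \<Phi> (DG_class \<tau>1 f)"
  proof
    fix g assume "g \<in> DG_class \<tau>2 (Q f)"
    then obtain n where g: "g \<in> CXZ \<tau>2" "(transfer_op \<tau>2 ^^ n) (Q f) = (transfer_op \<tau>2 ^^ n) (Q (P g))"
      by (auto simp: B.in_class DG_rel_def)
    then have "(transfer_op \<tau>1 ^^ n) f = (transfer_op \<tau>1 ^^ n) (P g)"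
      unfolding transfer_op_iter_Q by (metis PQ(1))
    then have "P g \<in> DG_class \<tau>1 f" using f P_CXZ[OF g(1)] unfolding A.in_class DG_rel_def by blast
    then show "g \<in> \<Phi> (DG_class \<tau>1 f)" unfolding \<Phi>_def by (metis PQ(2) imageI)
  qed
qed

lemma \<Phi>_hom: "\<Phi> \<in> hom (DG \<tau>1) (DG \<tau>2)"
proof (rule homI)
  fix A assume "A \<in> carrier (DG \<tau>1)"
  then obtain f where f: "f \<in> CXZ \<tau>1" "A = DG_class \<tau>1 f" by (rule A.carrier_cases)
  then show "\<Phi> A \<in> carrier (DG \<tau>2)" using \<Phi>_class B.class_carrier Q_CXZ by simp
  fix B assume "B \<in> carrier (DG \<tau>1)"
  then obtain g where g: "g \<in> CXZ \<tau>1" "B = DG_class \<tau>1 g" by (rule A.carrier_cases)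
  have "Q (\<lambda>p. f p + g p) = (\<lambda>p. Q f p + Q g p)" by (simp add: Q_def o_def)
  then show "\<Phi> (A \<otimes>\<^bsub>DG \<tau>1\<^esub> B) = \<Phi> A \<otimes>\<^bsub>DG \<tau>2\<^esub> \<Phi> B"
    using f g by (simp add: A.DG_mult B.DG_mult \<Phi>_class Q_CXZ A.CXZ_add)
qed

lemma \<Phi>_surj: "g \<in> CXZ \<tau>2 \<Longrightarrow> DG_class \<tau>2 g = \<Phi> (DG_class \<tau>1 (P g))"
  using \<Phi>_class[OF P_CXZ] by simp

lemma \<Phi>_iso: "\<Phi> \<in> iso (DG \<tau>1) (DG \<tau>2)"
  unfolding Group.iso_def bij_betw_def
proof (intro CollectI conjI)
  have "inj Q" by (rule inj_on_inverseI[of _ P]) simp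
  then show "inj_on \<Phi> (carrier (DG \<tau>1))" unfolding \<Phi>_def by (intro inj_onI) (simp only: inj_image_eq_iff)
  show "\<Phi> ` carrier (DG \<tau>1) = carrier (DG \<tau>2)"
  proof
    show "\<Phi> ` carrier (DG \<tau>1) \<subseteq> carrier (DG \<tau>2)" using hom_in_carrier[OF \<Phi>_hom] by blast
    show "carrier (DG \<tau>2) \<subseteq> \<Phi> ` carrier (DG \<tau>1)"
    proof
      fix A assume "A \<in> carrier (DG \<tau>2)"
      then obtain g where g: "g \<in> CXZ \<tau>2" "A = DG_class \<tau>2 g" by (rule B.carrier_cases)
      then show "A \<in> \<Phi> ` carrier (DG \<tau>1)" using \<Phi>_surj A.class_carrier[OF P_CXZ[OF g(1)]] by simp
    qed
  qed
qed (rule \<Phi>_hom)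

lemma \<Phi>_pos: "\<Phi> ` DG_pos \<tau>1 = DG_pos \<tau>2"
proof
  show "\<Phi> ` DG_pos \<tau>1 \<subseteq> DG_pos \<tau>2"
  proof
    fix A assume "A \<in> \<Phi> ` DG_pos \<tau>1"
    then obtain f n where f: "f \<in> CXZ \<tau>1" "A = \<Phi> (DG_class \<tau>1 f)" "\<forall>p\<in>A.X. 0 \<le> (transfer_op \<tau>1 ^^ n) f p"
      unfolding DG_pos_def by blast
    have "\<forall>p\<in>B.X. 0 \<le> (transfer_op \<tau>2 ^^ n) (Q f) p"
      using f(3) E'_X unfolding transfer_op_iter_Q by (simp add: Q_def)
    then show "A \<in> DG_pos \<tau>2" using f Q_CXZ \<Phi>_class unfolding DG_pos_def by blast
  qed
  show "DG_pos \<tau>2 \<subseteq> \<Phi> ` DG_pos \<tau>1"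
  proof
    fix A assume "A \<in> DG_pos \<tau>2"
    then obtain g n where g: "g \<in> CXZ \<tau>2" "A = DG_class \<tau>2 g" "\<forall>p\<in>B.X. 0 \<le> (transfer_op \<tau>2 ^^ n) g p"
      unfolding DG_pos_def by blast
    have "(transfer_op \<tau>1 ^^ n) (P g) = P ((transfer_op \<tau>2 ^^ n) g)"
      using transfer_op_iter_Q[of n "P g"] by (metis PQ)
    then have "\<forall>p\<in>A.X. 0 \<le> (transfer_op \<tau>1 ^^ n) (P g) p"
      using g(3) E_X by (simp add: P_def)
    then have "DG_class \<tau>1 (P g) \<in> DG_pos \<tau>1" using P_CXZ[OF g(1)] unfolding DG_pos_def by blast
    then show "A \<in> \<Phi> ` DG_pos \<tau>1" using \<Phi>_surj[OF g(1)] g(2) by blast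
  qed
qed

lemma \<Phi>_shift:
  assumes "A \<in> carrier (DG \<tau>1)" shows "\<Phi> (DG_shift \<tau>1 A) = DG_shift \<tau>2 (\<Phi> A)"
proof -
  obtain f where f: "f \<in> CXZ \<tau>1" "A = DG_class \<tau>1 f" by (rule A.carrier_cases[OF assms])
  then show ?thesis
    by (simp add: A.DG_shift_class B.DG_shift_class \<Phi>_class A.transfer_op_CXZ Q_CXZ transfer_op_Q)
qed

lemma \<Phi>_generators: "map \<Phi> (canonical_generators \<tau>1) = canonical_generators \<tau>2"
proof (rule nth_equalityI)
  show "length (map \<Phi> (canonical_generators \<tau>1)) = length (canonical_generators \<tau>2)"
    by (simp add: canonical_generators_def len_as)
  fix i assume "i < length (map \<Phi> (canonical_generators \<tau>1))"
  then have i: "i < length A.as - 1" by (simp add: canonical_generators_def)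
  then have i': "i < length A.as" "Suc i < length A.as" by simp_all
  let ?I = "X_interval \<tau>1 (A.as ! i) (A.as ! Suc i)" and ?J = "X_interval \<tau>2 (B.as ! i) (B.as ! Suc i)"
  have a: "A.as ! i \<in> I1 \<tau>1" "A.as ! Suc i \<in> I1 \<tau>1" "A.as ! i < A.as ! Suc i"
    using A.as_I1 A.as_less i' by auto
  have "E' p \<in> ?I \<longleftrightarrow> p \<in> ?J" for p using X_interval_E[OF a, of "E' p"] nth_as i' by simp
  then have "Q (indicator ?I) = indicator ?J" by (simp add: Q_def fun_eq_iff indicator_def)
  then have "\<Phi> (DG_class \<tau>1 (indicator ?I)) = DG_class \<tau>2 (indicator ?J)"
    using \<Phi>_class[OF A.CXZ_interval[OF a]] by simp
  then show "map \<Phi> (canonical_generators \<tau>1) ! i = canonical_generators \<tau>2 ! i"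
    using i len_as by (simp add: canonical_generators_def)
qed

lemma \<Phi>_unital: "unital \<tau>1 \<tau>2 \<Phi>"
proof -
  have "Q (indicator A.X) = indicator B.X" using E'_X by (simp add: Q_def fun_eq_iff indicator_def)
  then show ?thesis using \<Phi>_class[OF A.CXZ_unit] by (simp add: unital_def DG_unit_def)
qed

lemma iso_exists:
  "\<exists>\<Phi>. dimension_triple_iso \<tau>1 \<tau>2 \<Phi> \<and> unital \<tau>1 \<tau>2 \<Phi> \<and> map \<Phi> (canonical_generators \<tau>1) = canonical_generators \<tau>2"
  unfolding dimension_triple_iso_def
  using \<Phi>_iso \<Phi>_pos \<Phi>_shift \<Phi>_unital \<Phi>_generators by (intro exI[of _ \<Phi>]) auto

end

lemma increasing_conjugacy_extend:
  assumes t1: "trans_map \<tau>1" and t2: "trans_map \<tau>2" and c: "increasing_conjugacy \<tau>1 \<tau>2 h"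
  shows "\<exists>h k. conjugate_maps \<tau>1 \<tau>2 h k"
proof -
  obtain k where hom: "homeomorphism {0..1} {0..1} h k" and sm: "strict_mono_on {0..1} h"
    and cj: "\<And>x. x \<in> {0..1} \<Longrightarrow> h (\<tau>1 x) = \<tau>2 (h x)"
    using c unfolding increasing_conjugacy_def by blast
  interpret A: trans_map \<tau>1 by (rule t1)
  define h' where "h' = (\<lambda>x. if x \<in> {0..1} then h x else x)"
  define k' where "k' = (\<lambda>x. if x \<in> {0..1} then k x else x)"
  have h01: "h x \<in> {0..1}" if "x \<in> {0..1}" for x using hom that unfolding homeomorphism_def by blast
  have k01: "k x \<in> {0..1}" if "x \<in> {0..1}" for x using hom that unfolding homeomorphism_def by blast
  have "conjugate_maps \<tau>1 \<tau>2 h' k'"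
  proof (rule conjugate_maps.intro[OF t1 t2])
    show "k' (h' x) = x" for x using hom h01[of x] unfolding h'_def k'_def homeomorphism_def by auto
    show "h' (k' x) = x" for x using hom k01[of x] unfolding h'_def k'_def homeomorphism_def by auto
    show "h' x \<in> {0..1} \<longleftrightarrow> x \<in> {0..1}" for x using h01[of x] by (simp add: h'_def)
    show "continuous_on {0..1} h'" using homeomorphism_cont1[OF hom] by (rule continuous_on_eq) (simp add: h'_def)
    show "continuous_on {0..1} k'" using homeomorphism_cont2[OF hom] by (rule continuous_on_eq) (simp add: k'_def)
    show "h' x < h' y \<longleftrightarrow> x < y" if "x \<in> {0..1}" "y \<in> {0..1}" for x y
      using strict_mono_on_less[OF sm that] that by (simp add: h'_def)
    show "h' (\<tau>1 x) = \<tau>2 (h' x)" if "x \<in> {0..1}" for x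
      using cj[OF that] A.maps[OF that] that by (simp add: h'_def)
  qed
  then show ?thesis by blast
qed

theorem theorem6p2:
  fixes \<tau>1 \<tau>2 :: "real \<Rightarrow> real"
  assumes "interval_map \<tau>1" and "transitive_map \<tau>1" and "piecewise_monotonic \<tau>1"
    and "interval_map \<tau>2" and "transitive_map \<tau>2" and "piecewise_monotonic \<tau>2"
  shows "(\<exists>h. increasing_conjugacy \<tau>1 \<tau>2 h) \<longleftrightarrow>
     ((strict_mono_on (first_interval \<tau>1) \<tau>1 \<and> strict_mono_on (first_interval \<tau>2) \<tau>2 \<or>
       strict_antimono_on (first_interval \<tau>1) \<tau>1 \<and> strict_antimono_on (first_interval \<tau>2) \<tau>2) \<and>
      (\<exists>\<Phi>. dimension_triple_iso \<tau>1 \<tau>2 \<Phi> \<and> unital \<tau>1 \<tau>2 \<Phi> \<and>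
           map \<Phi> (canonical_generators \<tau>1) = canonical_generators \<tau>2))"
proof -
  have t1: "trans_map \<tau>1" and t2: "trans_map \<tau>2"
    using assms by (auto intro!: trans_map.intro pm_map.intro trans_map_axioms.intro)
  interpret A: trans_map \<tau>1 by (rule t1)
  interpret B: trans_map \<tau>2 by (rule t2)
  \<comment> \<open>The two alternatives of condition (i) say that both first signs are 1 or both
    are -1; since no other signs occur, this is their equality.\<close>
  have dir: "(strict_mono_on (first_interval \<tau>1) \<tau>1 \<and> strict_mono_on (first_interval \<tau>2) \<tau>2 \<or>
       strict_antimono_on (first_interval \<tau>1) \<tau>1 \<and> strict_antimono_on (first_interval \<tau>2) \<tau>2) \<longleftrightarrow> A.dirs 0 = B.dirs 0"
    unfolding A.first_interval_mono B.first_interval_mono using A.dirs_cases[of 0] B.dirs_cases[of 0] by auto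
  show ?thesis unfolding dir
  proof (intro iffI conjI)
    assume "\<exists>h. increasing_conjugacy \<tau>1 \<tau>2 h"
    then obtain h k where "conjugate_maps \<tau>1 \<tau>2 h k" using increasing_conjugacy_extend[OF t1 t2] by blast
    then interpret C: conjugate_maps \<tau>1 \<tau>2 h k .
    show "A.dirs 0 = B.dirs 0" using C.dirs_h[of 0] A.as_len by simp
    show "\<exists>\<Phi>. dimension_triple_iso \<tau>1 \<tau>2 \<Phi> \<and> unital \<tau>1 \<tau>2 \<Phi> \<and> map \<Phi> (canonical_generators \<tau>1) = canonical_generators \<tau>2"
      by (rule C.iso_exists)
  next
    assume "A.dirs 0 = B.dirs 0 \<and> (\<exists>\<Phi>. dimension_triple_iso \<tau>1 \<tau>2 \<Phi> \<and> unital \<tau>1 \<tau>2 \<Phi> \<and>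
           map \<Phi> (canonical_generators \<tau>1) = canonical_generators \<tau>2)"
    then show "\<exists>h. increasing_conjugacy \<tau>1 \<tau>2 h" using conjugacy_from_iso[OF t1 t2] by blast
  qed
qed

end
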